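(* Let $w\in\tilde S_n$ and write $\tilde F_w=\sum_{\lambda\in\mathrm{Par}^n}a_{w\lambda}\tilde F_\lambda$. (1) If $a_{w\lambda}\ne0$ then $\lambda(w)\preceq^*\lambda\preceq\mu(w)$. (2) $a_{w\mu(w)}=a_{w\lambda(w)}=1$.
   Context: Fix $n\ge3$; indices mod $n$. Realize the affine symmetric group $\tilde S_n$ as the group of bijections $w:\mathbb Z\to\mathbb Z$ with $w(i+n)=w(i)+n$ and $\sum_{i=1}^nw(i)=\sum_{i=1}^ni$, generated by $s_0,\dots,s_{n-1}$ where $s_i$ exchanges $i+kn$ and $i+1+kn$ for all $k$; $l$ is the Coxeter length. $\mathcal U_n$ is the $\mathbb C$-algebra generated by $u_0,\dots,u_{n-1}$ with $u_i^2=0$, $u_iu_{i+1}u_i=u_{i+1}u_iu_{i+1}$, $u_iu_j=u_ju_i$ for $|i-j|\ge2$. For $A\subsetneq\{0,\dots,n-1\}$, $u_A$ is the product of the $u_a$, $a\in A$, in any order where $u_{i+1}$ precedes $u_i$ whenever $i,i+1\in A$; $h_k(\mathbf u)=\sum_{|A|=k}u_A$ for $0\le k\le n-1$. $\mathcal U_n$ acts on $\mathbb C[\tilde S_n]$ by $u_i\cdot w=s_iw$ if $l(s_iw)>l(w)$, else $0$; $\langle w,v\rangle=\delta_{wv}$. $\tilde F_w(X)$ is the symmetric function whose coefficient of $x_1^{a_1}\cdots x_t^{a_t}$ (sequences with entries in $[0,n-1]$) is $\langle h_{a_t}(\mathbf u)\cdots h_{a_1}(\mathbf u)\cdot1,w\rangle$,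 other coefficients $0$. $\mathrm{Par}^n$ is the set of partitions with $\lambda_1\le n-1$. The code of $v$ is $c(v)=(c_1,\dots,c_n)$, $c_i=\#\{j>i:v(j)<v(i)\}$; $\mu(w)\in\mathrm{Par}^n$ is the conjugate of the partition obtained by sorting $c(w^{-1})$ decreasingly. $w$ is Grassmannian if it is the minimal-length element of its coset $S_nw$, $S_n=\langle s_1,\dots,s_{n-1}\rangle$; $w\mapsto\mu(w)$ is a bijection from Grassmannian elements onto $\mathrm{Par}^n$, and $\tilde F_\mu:=\tilde F_w$ for the Grassmannian $w$ with $\mu(w)=\mu$ (affine Schur functions); these form a basis of the space spanned by the $m_\lambda$, $\lambda\in\mathrm{Par}^n$, which contains every $\tilde F_w$, so the $a_{w\lambda}$ are well defined. The automorphism $*$ of $\tilde S_n$ given by $s_i\mapsto s_{n-i}$ ($s_0\mapsto s_0$) maps Grassmannian elements to Grassmannian elements; define the involution $*$ on $\mathrm{Par}^n$ by $\mu(v)^*=\mu(v^* )$ for Grassmannian $v$. $\preceq$ is dominance order; $\lambda\preceq^*\mu$ means $\mu^*\preceq\lambda^*$. Finally $\lambda(w):=\mu(w^{-1})^*$. *)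

theory Defs
  imports
    Complex_Main
    "HOL-Library.Poly_Mapping"
    "HOL-Algebra.Coset"
    "HOL-Algebra.Bij"
    "HOL-Algebra.Generated_Groups"
begin

subsection \<open>The affine symmetric group\<close>

definition affine_perms :: "nat \<Rightarrow> (int \<Rightarrow> int) set" where
  "affine_perms n = {w. bij w \<and> (\<forall>i. w (i + int n) = w i + int n) \<and>
     (\<Sum>i\<in>{1..int n}. w i) = (\<Sum>i\<in>{1..int n}. i)}"

definition affine_group :: "nat \<Rightarrow> (int \<Rightarrow> int) monoid" where
  "affine_group n = \<lparr>carrier = affine_perms n, mult = (\<lambda>v w. v \<circ> w), one = id\<rparr>"

text \<open>The index is read modulo \<open>n\<close>, so that \<open>simple_refl n n = simple_refl n 0\<close>.\<close>

definition simple_refl :: "nat \<Rightarrow> nat \<Rightarrow> int \<Rightarrow> int" where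
  "simple_refl n i j =
     (if j mod int n = int i mod int n then j + 1
      else if j mod int n = (int i + 1) mod int n then j - 1
      else j)"

definition coxeter_length :: "nat \<Rightarrow> (int \<Rightarrow> int) \<Rightarrow> nat" where
  "coxeter_length n w =
     (LEAST k. \<exists>is. length is = k \<and> set is \<subseteq> {..<n} \<and> w = foldr (\<lambda>i v. simple_refl n i \<circ> v) is id)"

definition finite_subgroup :: "nat \<Rightarrow> (int \<Rightarrow> int) set" where
  "finite_subgroup n = generate (affine_group n) (simple_refl n ` {1..<n})"

definition grassmannian :: "nat \<Rightarrow> (int \<Rightarrow> int) \<Rightarrow> bool" where
  "grassmannian n w \<longleftrightarrow> w \<in> affine_perms n \<and>
     is_arg_min (coxeter_length n) (\<lambda>v. v \<in> finite_subgroup n #>\<^bsub>affine_group n\<^esub> w) w"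

text \<open>Elements of \<^const>\<open>auto\<close> are extensional, hence determined by their values on the
  generators.\<close>

definition affine_star :: "nat \<Rightarrow> (int \<Rightarrow> int) \<Rightarrow> (int \<Rightarrow> int)" where
  "affine_star n = (THE \<phi>. \<phi> \<in> auto (affine_group n) \<and>
     (\<forall>i<n. \<phi> (simple_refl n i) = simple_refl n (n - i)))"


subsection \<open>Partitions and codes\<close>

text \<open>A partition is the weakly decreasing list of its positive parts.\<close>

definition Par :: "nat \<Rightarrow> nat list set" where
  "Par n = {l. sorted_wrt (\<ge>) l \<and> (\<forall>x\<in>set l. 1 \<le> x \<and> x \<le> n - 1)}"

definition conjugate :: "nat list \<Rightarrow> nat list" where
  "conjugate l = map (\<lambda>j. length (filter (\<lambda>x. j \<le> x) l)) [1..<Suc (Max (insert 0 (set l)))]"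

definition dominated :: "nat list \<Rightarrow> nat list \<Rightarrow> bool" where
  "dominated l m \<longleftrightarrow> sum_list l = sum_list m \<and> (\<forall>k. sum_list (take k l) \<le> sum_list (take k m))"

definition code :: "nat \<Rightarrow> (int \<Rightarrow> int) \<Rightarrow> nat list" where
  "code n v = map (\<lambda>i. card {j. int i < j \<and> v j < v (int i)}) [1..<Suc n]"

definition shape :: "nat \<Rightarrow> (int \<Rightarrow> int) \<Rightarrow> nat list" where
  "shape n w = conjugate (filter (\<lambda>x. 0 < x) (rev (sort (code n (inv\<^bsub>affine_group n\<^esub> w)))))"

definition grassmannian_of :: "nat \<Rightarrow> nat list \<Rightarrow> (int \<Rightarrow> int)" where
  "grassmannian_of n = the_inv_into {v. grassmannian n v} (shape n)"

definition par_star :: "nat \<Rightarrow> nat list \<Rightarrow> nat list" where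
  "par_star n l = shape n (affine_star n (grassmannian_of n l))"

definition star_dominated :: "nat \<Rightarrow> nat list \<Rightarrow> nat list \<Rightarrow> bool" where
  "star_dominated n l m \<longleftrightarrow> dominated (par_star n m) (par_star n l)"

definition lower_shape :: "nat \<Rightarrow> (int \<Rightarrow> int) \<Rightarrow> nat list" where
  "lower_shape n w = par_star n (shape n (inv\<^bsub>affine_group n\<^esub> w))"


subsection \<open>The action of the affine nilCoxeter algebra on the group algebra\<close>

text \<open>The space \<open>\<complex>[G]\<close> of the affine symmetric group \<open>G\<close> consists of finitely supported functions,
  \<open>single w 1\<close> being the basis vector \<open>w\<close>. Elements of the nilCoxeter algebra occur only through
  the operators by which they act on it; a product acts by composition, its rightmost
  factor first.\<close>

type_synonym group_vec = "(int \<Rightarrow> int) \<Rightarrow>\<^sub>0 complex"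

definition u_act :: "nat \<Rightarrow> nat \<Rightarrow> group_vec \<Rightarrow> group_vec" where
  "u_act n i f = (\<Sum>w\<in>Poly_Mapping.keys f.
     if coxeter_length n (simple_refl n i \<circ> w) > coxeter_length n w
     then Poly_Mapping.single (simple_refl n i \<circ> w) (Poly_Mapping.lookup f w) else 0)"

definition cyclically_decreasing :: "nat \<Rightarrow> nat set \<Rightarrow> nat list \<Rightarrow> bool" where
  "cyclically_decreasing n A is \<longleftrightarrow> distinct is \<and> set is = A \<and>
     (\<forall>p<length is. \<forall>q<length is. is ! p = Suc (is ! q) mod n \<longrightarrow> p < q)"

text \<open>For \<open>A \<subset> {..<n}\<close> cyclically decreasing words exist, and any two of them differ by
  commutations \<open>u\<^sub>i u\<^sub>j = u\<^sub>j u\<^sub>i\<close> of non-neighbours, so the choice is immaterial.\<close>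

definition u_set_act :: "nat \<Rightarrow> nat set \<Rightarrow> group_vec \<Rightarrow> group_vec" where
  "u_set_act n A = foldr (u_act n) (SOME is. cyclically_decreasing n A is)"

definition h_act :: "nat \<Rightarrow> nat \<Rightarrow> group_vec \<Rightarrow> group_vec" where
  "h_act n k f = (\<Sum>A | A \<subset> {..<n} \<and> card A = k. u_set_act n A f)"


subsection \<open>Affine Stanley symmetric functions and affine Schur functions\<close>

text \<open>A formal power series in \<open>x\<^sub>1, x\<^sub>2, \<dots>\<close> is given by its coefficients: an exponent vector
  \<open>\<alpha>\<close> stands for the monomial in which \<open>x\<^sub>i\<close> has exponent \<open>lookup \<alpha> (i - 1)\<close>.
  \<open>Poly_Mapping.degree \<alpha>\<close> is the number of variables up to the last one that occurs;
  further zero exponents would not matter since \<open>h\<^sub>0\<close> acts as the identity.\<close>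

type_synonym series = "(nat \<Rightarrow>\<^sub>0 nat) \<Rightarrow> complex"

definition affine_stanley :: "nat \<Rightarrow> (int \<Rightarrow> int) \<Rightarrow> series" where
  "affine_stanley n w \<alpha> =
     (if \<forall>i. Poly_Mapping.lookup \<alpha> i \<le> n - 1
      then Poly_Mapping.lookup
             (fold (h_act n) (map (Poly_Mapping.lookup \<alpha>) [0..<Poly_Mapping.degree \<alpha>])
                (Poly_Mapping.single id 1)) w
      else 0)"

definition affine_schur :: "nat \<Rightarrow> nat list \<Rightarrow> series" where
  "affine_schur n l = affine_stanley n (grassmannian_of n l)"

text \<open>The coefficient family of the expansion of the affine Stanley function of \<open>w\<close> in the
  basis of affine Schur functions, extended by \<open>0\<close> outside \<open>Par n\<close>.\<close>

definition schur_coeff :: "nat \<Rightarrow> (int \<Rightarrow> int) \<Rightarrow> nat list \<Rightarrow> complex" where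
  "schur_coeff n w = (THE a. finite {l. a l \<noteq> 0} \<and> {l. a l \<noteq> 0} \<subseteq> Par n \<and>
     (\<forall>\<alpha>. affine_stanley n w \<alpha> = (\<Sum>l | a l \<noteq> 0. a l * affine_schur n l \<alpha>)))"

end

theory Submission
  imports Defs "HOL-Computational_Algebra.Formal_Power_Series"
begin

text \<open>The generating functions \<open>\<Prod>(1 + x u\<^sub>i)\<close> of the \<open>h\<^sub>k\<close> on a proper part of the cycle commute by
  the Yang-Baxter argument of Fomin and Stanley. Products \<open>u\<^sub>A u\<^sub>B\<close> on the whole cycle are reduced to
  this case by cutting the cycle at intervals whose letters can be pulled out on both sides and by
  inclusion-exclusion over the sets of cuts. Hence the \<open>h\<^sub>k\<close> commute and affine Stanley functions are
  symmetric.

  Multiplying by a cyclically decreasing element of content \<open>A\<close> permutes the code of \<open>w\<^sup>-\<^sup>1\<close> and adds 1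
  at the positions in \<open>A\<close>. So the code of \<open>w\<^sup>-\<^sup>1\<close> gives the row sums of a 0-1 matrix whose column sums are
  the exponents of a monomial, which bounds the exponents by \<open>\<mu>(w)\<close> in dominance order; at \<open>\<mu>(w)\<close> the
  factorization is forced, since every factor has to decrement all nonzero entries. Since codes are
  the periodic vectors with a zero entry, and those of Grassmannian elements are increasing, affine
  Schur functions are unitriangular. This gives the upper bound.

  With \<open>e\<^sub>k\<close> the sum of the cyclically increasing products, \<open>\<Sum>(-1)\<^sup>i e\<^sub>i h\<^sub>k\<^sub>-\<^sub>i = 0\<close> for \<open>0 < k < n\<close>, so the \<open>e\<^sub>k\<close> are
  polynomials in the \<open>h\<^sub>k\<close>. The coefficients of the \<open>e\<close>-monomials at \<open>w\<close> are the coefficients of the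
  affine Stanley functions of both \<open>w\<^sup>*\<close> and \<open>w\<^sup>-\<^sup>1\<close>. Therefore an expansion for \<open>w\<close> becomes, with all
  partitions replaced by their images under \<open>*\<close>, one for \<open>w\<^sup>-\<^sup>1\<close>, and the lower bound is the upper bound
  for \<open>w\<^sup>-\<^sup>1\<close>.\<close>

subsection \<open>NilCoxeter chains\<close>

text \<open>The Yang-Baxter argument needs the letters on a line, while two proper subsets
  \<open>A\<close>, \<open>B\<close> of the cycle may together cover it, leaving no free index to
  cut at. What always exists is an interval leading from an index outside \<open>B\<close> to an
  index outside \<open>A\<close>. A set of such cuts imposes separate conditions on \<open>A\<close>
  and on \<open>B\<close>, and the sum of \<open>u_dec A * u_dec B\<close> over the pairs that
  satisfy them, unless it is empty, factors as
  \<open>u_dec C * h_on R i * h_on R j * u_dec C'\<close> with \<open>R\<close> proper and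
  \<open>C\<close>, \<open>C'\<close> of equal size. Exchanging the two degrees therefore affects
  only the middle, where commutation is known. For the relation between \<open>e\<close> and
  \<open>h\<close> missing letters suffice as cuts, because fewer than \<open>n\<close> letters are
  involved. Codes are taken at \<open>iv w\<close> throughout: left multiplication of
  \<open>w\<close> by a reflection exchanges positions of \<open>iv w\<close>, and codes are indexed
  by positions.\<close>

fun esym :: "'a::ring_1 list \<Rightarrow> nat \<Rightarrow> 'a" where
  "esym [] k = (if k = 0 then 1 else 0)"
| "esym (a # as) k = esym as k + (case k of 0 \<Rightarrow> 0 | Suc j \<Rightarrow> a * esym as j)"

definition gen :: "'a::ring_1 \<Rightarrow> 'a list \<Rightarrow> 'a" where
  "gen t as = prod_list (map (\<lambda>a. 1 + t * a) as)"

text \<open>The relations of a nilCoxeter algebra of type A, with neighbours in the list as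
  neighbours in the diagram. The element 0 is compatible with all of them, so letters may be
  replaced by 0.\<close>

fun nil_chain :: "'a::ring_1 list \<Rightarrow> bool" where
  "nil_chain [] \<longleftrightarrow> True"
| "nil_chain (a # as) \<longleftrightarrow> a * a = 0 \<and> nil_chain as \<and> (\<forall>b\<in>set (tl as). a * b = b * a) \<and>
     (as \<noteq> [] \<longrightarrow> a * hd as * a = hd as * a * hd as)"

lemma gen_simps [simp]: "gen t [] = 1" "gen t (a # as) = (1 + t * a) * gen t as"
  by (simp_all add: gen_def)

text \<open>The additive Yang-Baxter equation: the linear terms agree since
  \<open>x + (y - x) = y\<close>, the quadratic ones agree termwise, and the cubic ones agree by the
  braid relation.\<close>

lemma yang_baxter:
  fixes a b x y :: "'a::ring_1"
  assumes x: "\<And>z. z * x = x * z" and y: "\<And>z. z * y = y * z"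
    and a: "a * a = 0" and b: "b * b = 0" and br: "a * b * a = b * a * b"
  shows "(1 + x * a) * (1 + y * b) * (1 + (y - x) * a) = (1 + (y - x) * b) * (1 + y * a) * (1 + x * b)"
proof -
  have ax: "a * x = x * a" "b * x = x * b" "y * x = x * y" "a * y = y * a" "b * y = y * b"
    by (rule x y)+
  have ax': "a * (x * z) = x * (a * z)" "b * (x * z) = x * (b * z)" "y * (x * z) = x * (y * z)"
    "a * (y * z) = y * (a * z)" "b * (y * z) = y * (b * z)" for z
    by (simp_all add: ax flip: mult.assoc)
  have aa: "a * (a * z) = 0" "b * (b * z) = 0" "b * (a * b) = a * (b * a)" for z
    by (simp_all add: a b br flip: mult.assoc)
  show ?thesis
    by (simp add: distrib_left distrib_right left_diff_distrib right_diff_distrib mult.assoc ax ax' aa a b)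
qed

text \<open>As \<open>a\<close> squares to 0, \<open>1 + x * a\<close> behaves like the exponential
  of \<open>x * a\<close>; the parameter \<open>- x\<close> gives the inverse.\<close>

lemma one_plus_mult:
  fixes a x y :: "'a::ring_1"
  assumes y: "\<And>z. z * y = y * z" and a: "a * a = 0"
  shows "(1 + x * a) * (1 + y * a) = 1 + (x + y) * a"
proof -
  have "x * a * (y * a) = 0"
  proof -
    have "x * a * (y * a) = x * (a * y) * a" by (simp add: mult.assoc)
    also have "\<dots> = x * (y * a) * a" by (simp only: y)
    also have "\<dots> = x * y * (a * a)" by (simp add: mult.assoc)
    finally have "x * a * (y * a) = x * y * (a * a)" .
    then show ?thesis by (simp add: a)
  qed
  then show ?thesis
    by (simp add: algebra_simps)
qed

lemma gen_commute_elem: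
  assumes x: "\<And>z. z * x = x * z" and c: "\<And>b. b \<in> set bs \<Longrightarrow> a * b = b * a"
  shows "gen x bs * a = a * gen x bs"
  using c
proof (induction bs)
  case (Cons b bs)
  have "gen x bs * a = a * gen x bs" "a * b = b * a" using Cons by auto
  moreover have "a * (x * z) = x * (a * z)" "a * (b * z) = b * (a * z)" for z
    using x[of a] \<open>a * b = b * a\<close> by (metis mult.assoc)+
  ultimately show ?case
    by (simp add: distrib_left distrib_right mult.assoc)
qed auto

text \<open>Two letters are handled at a time. Commutation for the tail that begins with
  \<open>b\<close> becomes an exchange rule for \<open>C x * A y\<close>, and the Yang-Baxter
  equation absorbs the factor that this rule produces.\<close>

lemma gen_commute:
  fixes x y :: "'a::ring_1"
  assumes x: "\<And>z. z * x = x * z" and y: "\<And>z. z * y = y * z" and "nil_chain as"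
  shows "gen x as * gen y as = gen y as * gen x as"
  using assms(3)
proof (induction as rule: induct_list012)
  case (2 a)
  then show ?case using one_plus_mult[OF x, of a y] one_plus_mult[OF y, of a x] by (simp add: add.commute)
next
  case (3 a b cs)
  have aa: "a * a = 0" and bb: "b * b = 0" and br: "a * b * a = b * a * b"
    and ac: "\<And>c. c \<in> set cs \<Longrightarrow> a * c = c * a" and ch: "nil_chain (b # cs)"
    using 3 by auto
  have yx: "z * (y - x) = (y - x) * z" for z by (simp add: left_diff_distrib right_diff_distrib x[of z] y[of z])
  define A where "A t = gen t (b # cs)" for t
  define C where "C t = gen t cs" for t
  have IH: "A x * A y = A y * A x" using "3.IH"(2) ch unfolding A_def by blast
  have AC: "A t = (1 + t * b) * C t" for t by (simp add: A_def C_def)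
  have Ca: "C t * (1 + s * a) = (1 + s * a) * C t" if "\<And>z. z * s = s * z" "\<And>z. z * t = t * z" for s t
  proof -
    have "C t * a = a * C t" unfolding C_def using gen_commute_elem[OF that(2)] ac by metis
    moreover have "C t * (s * z) = s * (C t * z)" for z
      using that(1)[of "C t"] by (simp flip: mult.assoc)
    ultimately show ?thesis by (simp add: distrib_left distrib_right mult.assoc)
  qed
  \<comment> \<open>Cancelling the leading factor of \<open>A x\<close> on the left is what turns
    the induction hypothesis into the exchange rule \<open>CA\<close>.\<close>
  have "(1 + (- x) * b) * A x = C x"
    using one_plus_mult[OF x bb, of "- x"] by (simp add: AC flip: mult.assoc)
  then have "C x * A y = (1 + (- x) * b) * A x * A y" by simp
  also have "\<dots> = (1 + (- x) * b) * (A y * A x)" by (simp add: IH mult.assoc)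
  also have "\<dots> = ((1 + (- x) * b) * (1 + y * b)) * C y * A x" by (simp add: AC mult.assoc)
  also have "(1 + (- x) * b) * (1 + y * b) = 1 + (y - x) * b"
    using one_plus_mult[OF y bb, of "- x"] by simp
  finally have CA: "C x * A y = (1 + (y - x) * b) * C y * A x" .
  have "gen x (a # b # cs) * gen y (a # b # cs) = (1 + x * a) * (1 + x * b) * (C x * (1 + y * a)) * A y"
    by (simp add: A_def C_def mult.assoc)
  also have "\<dots> = (1 + x * a) * (1 + x * b) * (1 + y * a) * (C x * A y)"
    by (simp add: Ca[OF y x] mult.assoc)
  also have "\<dots> = (1 + x * a) * ((1 + x * b) * (1 + y * a) * (1 + (y - x) * b)) * C y * A x"
    by (simp add: CA mult.assoc)
  also have "(1 + x * b) * (1 + y * a) * (1 + (y - x) * b) = (1 + (y - x) * a) * (1 + y * b) * (1 + x * a)"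
    by (rule yang_baxter[OF x y bb aa br[symmetric]])
  also have "(1 + x * a) * ((1 + (y - x) * a) * (1 + y * b) * (1 + x * a)) * C y * A x =
      ((1 + x * a) * (1 + (y - x) * a)) * (1 + y * b) * ((1 + x * a) * C y) * A x"
    by (simp add: mult.assoc)
  also have "(1 + x * a) * (1 + (y - x) * a) = 1 + y * a"
    using one_plus_mult[OF yx aa, of x] by simp
  also have "(1 + x * a) * C y = C y * (1 + x * a)" by (simp add: Ca[OF x y])
  also have "(1 + y * a) * (1 + y * b) * (C y * (1 + x * a)) * A x = gen y (a # b # cs) * gen x (a # b # cs)"
    by (simp add: A_def C_def mult.assoc)
  finally show ?case .
qed auto

lemma gen_fps_X: "gen fps_X (map fps_const as) = Abs_fps (esym as)"
proof (induction as)
  case Nil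
  show ?case by (rule fps_ext) simp
next
  case (Cons a as)
  show ?case
    by (rule fps_ext) (auto simp: Cons distrib_right mult.assoc split: nat.split)
qed

lemma nil_chain_map:
  assumes "nil_chain as" "\<And>x y. f (x * y) = f x * f y" "f 0 = 0"
  shows "nil_chain (map f as)"
  using assms(1)
proof (induction as)
  case (Cons a as)
  then show ?case
    by (cases as) (auto simp flip: assms(2) simp: assms(3))
qed auto

text \<open>Comparing coefficients needs two independent central parameters. Power series over power
  series supply them as \<open>fps_X\<close> and \<open>fps_const fps_X\<close>.\<close>

lemma esym_commute:
  assumes "nil_chain as"
  shows "esym as k * esym as l = esym as l * esym as k"
proof -
  define f :: "'a \<Rightarrow> 'a fps fps" where "f a = fps_const (fps_const a)" for a
  have f: "f (x * y) = f x * f y" "f 0 = 0" for x y by (simp_all add: f_def)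
  have x: "z * fps_X = fps_X * z" for z :: "'a fps fps" by (simp add: fps_mult_fps_X_commute)
  have y: "z * fps_const fps_X = fps_const fps_X * z" for z :: "'a fps fps"
    by (rule fps_ext) (simp add: fps_mult_fps_X_commute)
  have gx: "gen fps_X (map f as) = Abs_fps (\<lambda>k. fps_const (esym as k))"
  proof -
    have "gen fps_X (map f as) = Abs_fps (esym (map fps_const as))"
      using gen_fps_X[of "map fps_const as"] by (simp add: f_def[abs_def] comp_def)
    moreover have "esym (map fps_const bs) k = fps_const (esym bs k)" for k and bs :: "'a list"
      by (induction bs arbitrary: k) (simp_all split: nat.split)
    ultimately show ?thesis by presburger
  qed
  have gy: "gen (fps_const fps_X) (map f as) = fps_const (Abs_fps (esym as))"
  proof -
    have "gen (fps_const fps_X) (map f as) = fps_const (gen fps_X (map fps_const as))"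
    proof (induction as)
      case (Cons a as)
      have "fps_const (1 + fps_X * fps_const a) = 1 + fps_const fps_X * f a"
        by (simp add: f_def flip: fps_const_add)
      then show ?case by (simp add: Cons flip: fps_const_mult)
    qed simp
    then show ?thesis by (simp add: gen_fps_X)
  qed
  have "gen fps_X (map f as) * gen (fps_const fps_X) (map f as) =
        gen (fps_const fps_X) (map f as) * gen fps_X (map f as)"
    using gen_commute[OF x y nil_chain_map[OF assms f]] .
  then have "fps_nth (fps_nth (gen fps_X (map f as) * gen (fps_const fps_X) (map f as)) k) l =
        fps_nth (fps_nth (gen (fps_const fps_X) (map f as) * gen fps_X (map f as)) k) l" by simp
  then show ?thesis by (simp add: gx gy)
qed

text \<open>Telescoping of \<open>\<Prod>(1 - x a\<^sub>i) \<cdot> \<Prod>(1 + x a\<^sub>i)\<close>, the first product in reversed order.\<close>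

lemma esym_rev_esym:
  assumes "\<And>a. a \<in> set as \<Longrightarrow> a * a = 0" "k > 0"
  shows "(\<Sum>i\<le>k. (-1) ^ i * esym (rev as) i * esym as (k - i)) = 0"
proof -
  have "gen (- fps_X) (rev bs) * gen fps_X bs = 1" if "\<forall>b\<in>set bs. b * b = 0" for bs :: "'a fps list"
    using that
  proof (induction bs)
    case (Cons b bs)
    have "gen (- fps_X) (rev (b # bs)) = gen (- fps_X) (rev bs) * (1 + (- fps_X) * b)"
      by (simp add: gen_def)
    moreover have "(1 + (- fps_X) * b) * (1 + fps_X * b) = 1"
      using one_plus_mult[of "fps_X" b "- fps_X"] Cons.prems by (simp add: fps_mult_fps_X_commute)
    ultimately have "gen (- fps_X) (rev (b # bs)) * gen fps_X (b # bs) = gen (- fps_X) (rev bs) * 1 * gen fps_X bs"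
      by (simp only: gen_simps mult.assoc) (simp only: flip: mult.assoc)
    then show ?case using Cons by simp
  qed auto
  moreover have "\<forall>b\<in>set (map fps_const as). b * b = 0" using assms by auto
  ultimately have e: "gen (- fps_X) (map fps_const (rev as)) * gen fps_X (map fps_const as) = 1"
    by (metis rev_map)
  have g: "gen (- fps_X) (map fps_const bs) = Abs_fps (\<lambda>i. (-1) ^ i * esym bs i)" for bs :: "'a list"
  proof (induction bs)
    case Nil show ?case by (rule fps_ext) simp
  next
    case (Cons a as)
    have "a * ((-1)^m * z) = (-1)^m * (a * z)" for m and z :: 'a
      by (simp add: minus_one_power_iff)
    then show ?case
      by (intro fps_ext) (auto simp: Cons distrib_right distrib_left left_diff_distrib mult.assoc split: nat.split)
  qed
  have "(\<Sum>i\<le>k. (-1) ^ i * esym (rev as) i * esym as (k - i)) = fps_nth (1 :: 'a fps) k"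
    unfolding e[symmetric] g gen_fps_X by (simp add: fps_mult_nth atLeast0AtMost)
  then show ?thesis using assms by simp
qed

text \<open>Whatever precedes the letter \<open>x\<close> in the second list follows it in the
  first, so \<open>P\<close> admits both orders and \<open>x\<close> commutes past it to the
  front.\<close>

lemma prod_list_sorted_wrt_unique:
  fixes f :: "'i \<Rightarrow> 'a::monoid_mult"
  assumes "sorted_wrt P xs" "sorted_wrt P ys" "set xs = set ys" "\<And>x. x \<in> set xs \<Longrightarrow> \<not> P x x"
    and "\<And>x y. x \<in> set xs \<Longrightarrow> y \<in> set xs \<Longrightarrow> P x y \<Longrightarrow> P y x \<Longrightarrow> f x * f y = f y * f x"
  shows "prod_list (map f xs) = prod_list (map f ys)"
  using assms
proof (induction xs arbitrary: ys)
  case (Cons x xs)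
  obtain ys1 ys2 where ys: "ys = ys1 @ x # ys2"
    using Cons.prems(3) by (metis list.set_intros(1) split_list)
  have notin: "x \<notin> set xs" "x \<notin> set (ys1 @ ys2)"
    using Cons.prems ys by (auto simp: sorted_wrt_append)
  then have sub: "set xs = set (ys1 @ ys2)" using Cons.prems(3) ys by auto
  have "f x * f y = f y * f x" if "y \<in> set ys1" for y
    using that Cons.prems sub ys by (auto simp: sorted_wrt_append)
  then have "f x * prod_list (map f ys1) = prod_list (map f ys1) * f x"
  proof (induction ys1)
    case (Cons y zs)
    have "f x * f y = f y * f x" "f x * prod_list (map f zs) = prod_list (map f zs) * f x"
      using Cons by auto
    then have "f x * f y * prod_list (map f zs) = f y * (prod_list (map f zs) * f x)"
      by (simp add: mult.assoc)
    then show ?case by (simp add: mult.assoc)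
  qed auto
  moreover have "prod_list (map f xs) = prod_list (map f (ys1 @ ys2))"
    using Cons.prems sub ys by (intro Cons.IH) (auto simp: sorted_wrt_append)
  ultimately show ?case by (simp add: ys) (simp flip: mult.assoc)
qed auto

lemma alternating_sum_Pow:
  assumes "finite L" "L \<noteq> {}"
  shows "(\<Sum>T\<in>Pow L. (-1) ^ card T) = (0 :: 'a::ring_1)"
proof -
  obtain x M where L: "L = insert x M" "x \<notin> M" using assms by (metis all_not_in_conv mk_disjoint_insert)
  have fin: "finite M" using assms L by auto
  have "(\<Sum>T\<in>insert x ` Pow M. (-1) ^ card T) = (\<Sum>T\<in>Pow M. (-1 :: 'a) ^ card (insert x T))"
    using L by (subst sum.reindex) (auto simp: inj_on_def)
  also have "\<dots> = (\<Sum>T\<in>Pow M. - ((-1) ^ card T))"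
    using L fin by (intro sum.cong refl) (subst card_insert_disjoint, auto intro: finite_subset)
  finally have "(\<Sum>T\<in>insert x ` Pow M. (-1 :: 'a) ^ card T) = - (\<Sum>T\<in>Pow M. (-1) ^ card T)"
    by (simp add: sum_negf)
  moreover have "(\<Sum>T\<in>Pow L. (-1 :: 'a) ^ card T) =
      (\<Sum>T\<in>Pow M. (-1) ^ card T) + (\<Sum>T\<in>insert x ` Pow M. (-1) ^ card T)"
    unfolding L(1) Pow_insert using L fin by (intro sum.union_disjoint) auto
  ultimately show ?thesis by simp
qed

section \<open>Cyclically decreasing words\<close>

definition dec_word :: "nat \<Rightarrow> nat list \<Rightarrow> bool" where
  "dec_word n is \<longleftrightarrow> sorted_wrt (\<lambda>x y. x \<noteq> y \<and> y \<noteq> Suc x mod n) is"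

lemma mod_add_neq:
  fixes a b n p :: nat
  assumes "a < b" "b - a < n"
  shows "(p + a) mod n \<noteq> (p + b) mod n"
proof
  assume "(p + a) mod n = (p + b) mod n"
  then have "n dvd (p + b) - (p + a)" using assms mod_eq_dvd_iff_nat[of "p + a" "p + b" n] by simp
  then show False using assms by (auto dest: dvd_imp_le)
qed

lemma Suc_mod_neq:
  assumes "2 \<le> n" "i < n"
  shows "Suc i mod n \<noteq> i"
  using mod_add_neq[of 0 1 n i] assms by auto

text \<open>The form by \<open>sorted_wrt\<close> is the convenient one: it passes to sublists and
  splits over concatenations.\<close>

lemma cyclically_decreasing_iff:
  assumes "2 \<le> n" "A \<subseteq> {..<n}"
  shows "cyclically_decreasing n A is \<longleftrightarrow> set is = A \<and> dec_word n is"
proof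
  assume c: "cyclically_decreasing n A is"
  then show "set is = A \<and> dec_word n is"
    unfolding cyclically_decreasing_def dec_word_def sorted_wrt_iff_nth_less
    by (auto simp: nth_eq_iff_index_eq) (meson less_trans not_less_iff_gr_or_eq)
next
  assume c: "set is = A \<and> dec_word n is"
  have d: "is ! p \<noteq> is ! q \<and> is ! q \<noteq> Suc (is ! p) mod n" if "p < q" "q < length is" for p q
    using c that unfolding dec_word_def sorted_wrt_iff_nth_less by blast
  have "distinct is"
    unfolding distinct_conv_nth using d by (metis linorder_neqE_nat)
  moreover have "p < q" if "p < length is" "q < length is" "is ! p = Suc (is ! q) mod n" for p q
  proof -
    have "is ! q < n" using c that assms by (metis lessThan_iff nth_mem subsetD)
    then have "p \<noteq> q" using that Suc_mod_neq[OF assms(1)] by metis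
    then show ?thesis using d that by (metis linorder_neqE_nat)
  qed
  ultimately show "cyclically_decreasing n A is"
    using c unfolding cyclically_decreasing_def by blast
qed

text \<open>The cycle cut open at \<open>p\<close>: the letters run from \<open>p - 1\<close> down
  to \<open>p + 1\<close> modulo \<open>n\<close>.\<close>

definition cyc_chain :: "nat \<Rightarrow> nat \<Rightarrow> nat list" where
  "cyc_chain n p = map (\<lambda>k. (p + k) mod n) (rev [1..<n])"

lemma dec_word_cyc_chain: "dec_word n (cyc_chain n p)"
proof -
  have "(p + a) mod n \<noteq> (p + b) mod n" "(p + b) mod n \<noteq> Suc ((p + a) mod n) mod n"
    if "1 \<le> b" "b < a" "a < n" for a b
  proof -
    have "a - b < n" "Suc a - b < n" using that by linarith+
    then show "(p + a) mod n \<noteq> (p + b) mod n" "(p + b) mod n \<noteq> Suc ((p + a) mod n) mod n"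
      using mod_add_neq[of b a n p] mod_add_neq[of b "Suc a" n p] that by (auto simp: mod_Suc_eq)
  qed
  then show ?thesis
    unfolding dec_word_def cyc_chain_def sorted_wrt_map sorted_wrt_rev
    by (intro sorted_wrt_mono_rel[OF _ sorted_wrt_upt]) auto
qed

lemma set_cyc_chain:
  assumes "p < n"
  shows "set (cyc_chain n p) = {..<n} - {p}"
proof
  show "set (cyc_chain n p) \<subseteq> {..<n} - {p}"
    unfolding cyc_chain_def using mod_add_neq[of 0 _ n p] assms by fastforce
  show "{..<n} - {p} \<subseteq> set (cyc_chain n p)"
  proof
    fix x assume x: "x \<in> {..<n} - {p}"
    define k where "k = (if p < x then x - p else x + n - p)"
    have "x = (p + k) mod n" "1 \<le> k" "k < n" using x assms by (auto simp: k_def)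
    then show "x \<in> set (cyc_chain n p)" unfolding cyc_chain_def by auto
  qed
qed

lemma dec_word_filter: "dec_word n is \<Longrightarrow> dec_word n (filter P is)"
  unfolding dec_word_def by (rule sorted_wrt_filter)

lemma dec_word_exists:
  assumes "A \<subset> {..<n}"
  shows "\<exists>is. set is = A \<and> dec_word n is"
proof -
  obtain p where p: "p < n" "p \<notin> A" using assms by auto
  have "set (filter (\<lambda>i. i \<in> A) (cyc_chain n p)) = A"
    using set_cyc_chain[OF p(1)] p assms by auto
  then show ?thesis using dec_word_filter[OF dec_word_cyc_chain] by blast
qed

text \<open>The same choice as in \<open>u_set_act\<close>, so that both agree by unfolding.\<close>

definition dec_word_of :: "nat \<Rightarrow> nat set \<Rightarrow> nat list" where
  "dec_word_of n A = (SOME is. cyclically_decreasing n A is)"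

lemma dec_word_of:
  assumes "2 \<le> n" "A \<subset> {..<n}"
  shows "set (dec_word_of n A) = A" "dec_word n (dec_word_of n A)" "distinct (dec_word_of n A)"
    "length (dec_word_of n A) = card A"
proof -
  have "\<exists>is. cyclically_decreasing n A is"
    using dec_word_exists[OF assms(2)] cyclically_decreasing_iff[of n A] assms by auto
  then have c: "cyclically_decreasing n A (dec_word_of n A)"
    unfolding dec_word_of_def by (rule someI_ex)
  then show "set (dec_word_of n A) = A" "dec_word n (dec_word_of n A)"
    using cyclically_decreasing_iff[of n A] assms by auto
  show "distinct (dec_word_of n A)" using c by (simp add: cyclically_decreasing_def)
  then show "length (dec_word_of n A) = card A"
    using c distinct_card by (fastforce simp: cyclically_decreasing_def)
qed

section \<open>Elementary symmetric functions as sums over subsets\<close>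

lemma subsets_card_Suc_insert:
  assumes "x \<notin> S" "finite S"
  shows "{A. A \<subseteq> insert x S \<and> card A = k} =
    {A. A \<subseteq> S \<and> card A = k} \<union> insert x ` {A. A \<subseteq> S \<and> Suc (card A) = k}" (is "?L = ?R")
proof
  show "?L \<subseteq> ?R"
  proof
    fix A assume A: "A \<in> ?L"
    show "A \<in> ?R"
    proof (cases "x \<in> A")
      case True
      have fin: "finite A" using A assms(2) finite_subset[of A "insert x S"] by simp
      have "A = insert x (A - {x})" "A - {x} \<subseteq> S" using True A by blast+
      moreover have "Suc (card (A - {x})) = k" using card_Suc_Diff1[OF fin True] A by simp
      ultimately show ?thesis by blast
    next
      case False
      then have "A \<subseteq> S" using A by blast
      then show ?thesis using A by blast
    qed
  qed
  show "?R \<subseteq> ?L"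
  proof
    fix A assume "A \<in> ?R"
    then consider "A \<subseteq> S" "card A = k" | B where "A = insert x B" "B \<subseteq> S" "Suc (card B) = k" by blast
    then show "A \<in> ?L"
    proof cases
      case (2 B)
      then have "finite B" "x \<notin> B" using assms finite_subset[of B S] by auto
      then show ?thesis using 2 by auto
    qed auto
  qed
qed

lemma esym_map:
  fixes f :: "'i \<Rightarrow> 'a::ring_1"
  assumes "distinct xs"
  shows "esym (map f xs) k = (\<Sum>A | A \<subseteq> set xs \<and> card A = k. prod_list (map f (filter (\<lambda>i. i \<in> A) xs)))"
  using assms
proof (induction xs arbitrary: k)
  case Nil
  have "{A. A = {} \<and> card A = k} = (if k = 0 then {{}} else ({} :: 'i set set))" by auto
  then show ?case by simp
next
  case (Cons x xs)
  let ?g = "\<lambda>A. prod_list (map f (filter (\<lambda>i. i \<in> A) (x # xs)))"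
  let ?S = "set xs"
  have x: "x \<notin> ?S" using Cons by auto
  have 1: "(\<Sum>A | A \<subseteq> ?S \<and> card A = k. ?g A) = esym (map f xs) k"
    using Cons x by (auto intro!: sum.cong)
  have "(\<Sum>A\<in>insert x ` {A. A \<subseteq> ?S \<and> Suc (card A) = k}. ?g A) =
      (\<Sum>A | A \<subseteq> ?S \<and> Suc (card A) = k. ?g (insert x A))"
    using x by (subst sum.reindex) (auto simp: inj_on_def)
  also have "\<dots> = (\<Sum>A | A \<subseteq> ?S \<and> Suc (card A) = k. f x * prod_list (map f (filter (\<lambda>i. i \<in> A) xs)))"
  proof (intro sum.cong refl)
    fix A
    have "filter (\<lambda>i. i \<in> insert x A) xs = filter (\<lambda>i. i \<in> A) xs"
      using x by (intro filter_cong) auto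
    then show "?g (insert x A) = f x * prod_list (map f (filter (\<lambda>i. i \<in> A) xs))" by simp
  qed
  also have "\<dots> = (case k of 0 \<Rightarrow> 0 | Suc j \<Rightarrow> f x * esym (map f xs) j)"
    using Cons by (auto split: nat.split simp: sum_distrib_left)
  finally have 2: "(\<Sum>A\<in>insert x ` {A. A \<subseteq> ?S \<and> Suc (card A) = k}. ?g A) =
     (case k of 0 \<Rightarrow> 0 | Suc j \<Rightarrow> f x * esym (map f xs) j)" .
  have "(\<Sum>A | A \<subseteq> set (x # xs) \<and> card A = k. ?g A) =
     (\<Sum>A | A \<subseteq> ?S \<and> card A = k. ?g A) + (\<Sum>A\<in>insert x ` {A. A \<subseteq> ?S \<and> Suc (card A) = k}. ?g A)"
    unfolding list.set(2) subsets_card_Suc_insert[OF x finite_set] using x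
    by (intro sum.union_disjoint) auto
  then show ?case using 1 2 by simp
qed

text \<open>Setting letters to 0 has the effect of deleting them but keeps their places in the list,
  so \<open>nil_chain\<close> can be proved for the full chain whatever gaps \<open>R\<close>
  has.\<close>

lemma esym_restrict:
  "esym (map (\<lambda>i. if i \<in> R then f i else 0) xs) k = esym (map f (filter (\<lambda>i. i \<in> R) xs)) k"
  by (induction xs arbitrary: k) (auto split: nat.split)

subsection \<open>Cyclic products in nilCoxeter algebras\<close>

lemma hook_subset_image:
  assumes "finite R" "C \<inter> R = {}" "finite C"
  shows "{A. C \<subseteq> A \<and> A \<subseteq> C \<union> R \<and> card A = k} =
     (if card C \<le> k then (\<union>) C ` {A. A \<subseteq> R \<and> card A = k - card C} else {})" (is "?L = ?R")
proof
  show "?L \<subseteq> ?R"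
  proof
    fix A assume A: "A \<in> ?L"
    then have fin: "finite A" using assms finite_subset[of A "C \<union> R"] by simp
    have "card C \<le> k" using A fin card_mono[of A C] by auto
    moreover have "A = C \<union> (A - C)" "A - C \<subseteq> R" using A by blast+
    moreover have "card (A - C) = k - card C" using A assms(3) by (simp add: card_Diff_subset)
    ultimately show "A \<in> ?R" by auto
  qed
  show "?R \<subseteq> ?L"
  proof
    fix A assume "A \<in> ?R"
    then obtain B where B: "A = C \<union> B" "B \<subseteq> R" "card B = k - card C" "card C \<le> k"
      by (auto split: if_splits)
    have "card A = card C + card B"
      unfolding B(1) using assms B(2) finite_subset[of B R] by (intro card_Un_disjoint) auto
    then show "A \<in> ?L" using B by auto
  qed
qed

section \<open>Cyclic intervals and cuts\<close>

definition cyc_dist :: "nat \<Rightarrow> nat \<Rightarrow> nat \<Rightarrow> nat" where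
  "cyc_dist n i q = (q + n - i) mod n"

lemma cyc_dist:
  assumes "i < n" "q < n"
  shows "(i + cyc_dist n i q) mod n = q" "cyc_dist n i q < n"
  using assms by (auto simp: cyc_dist_def mod_add_right_eq)

lemma cyc_dist_add:
  assumes "i < n" "t < n"
  shows "cyc_dist n i ((i + t) mod n) = t"
proof -
  have "cyc_dist n i ((i + t) mod n) = ((i + t) mod n + (n - i)) mod n"
    using assms by (simp add: cyc_dist_def)
  also have "\<dots> = (i + t + (n - i)) mod n" by (simp add: mod_add_left_eq)
  finally show ?thesis using assms by simp
qed

text \<open>The arc from \<open>i\<close> to \<open>q\<close> without its last index;
  \<open>cutB\<close> is the same arc without its first. Both are empty for
  \<open>i = q\<close>.\<close>

definition cutA :: "nat \<Rightarrow> nat \<times> nat \<Rightarrow> nat set" where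
  "cutA n = (\<lambda>(i, q). {(i + t) mod n | t. t < cyc_dist n i q})"

definition cutB :: "nat \<Rightarrow> nat \<times> nat \<Rightarrow> nat set" where
  "cutB n = (\<lambda>(i, q). {(i + t) mod n | t. 0 < t \<and> t \<le> cyc_dist n i q})"

text \<open>A cut of a pair \<open>(A, B)\<close> is a cyclic interval from \<open>i\<close> to \<open>q\<close> whose letters can be moved to
  the far left of \<open>u\<^sub>A\<close> and to the far right of \<open>u\<^sub>B\<close>; an index outside \<open>A \<union> B\<close> is the special case
  \<open>i = q\<close>.\<close>

definition is_cut :: "nat \<Rightarrow> nat set \<Rightarrow> nat set \<Rightarrow> nat \<times> nat \<Rightarrow> bool" where
  "is_cut n A B c \<longleftrightarrow> cutA n c \<subseteq> A \<and> snd c \<notin> A \<and> cutB n c \<subseteq> B \<and> fst c \<notin> B"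

text \<open>Take an index outside \<open>B\<close> and an index outside \<open>A\<close> at minimal
  cyclic distance. An index of \<open>cutA\<close> missing from \<open>A\<close>, or one of
  \<open>cutB\<close> missing from \<open>B\<close>, would give a closer pair.\<close>

lemma cut_exists:
  assumes "A \<subset> {..<n}" "B \<subset> {..<n}"
  shows "\<exists>c\<in>{..<n} \<times> {..<n}. is_cut n A B c"
proof -
  let ?P = "\<lambda>c. fst c \<in> {..<n} - B \<and> snd c \<in> {..<n} - A"
  obtain c0 where "?P c0" using assms by (metis Diff_eq_empty_iff all_not_in_conv fst_conv psubsetE snd_conv subset_antisym)
  define c where "c = arg_min (\<lambda>c. cyc_dist n (fst c) (snd c)) ?P"
  have P: "?P c" and min: "\<And>c'. ?P c' \<Longrightarrow> cyc_dist n (fst c) (snd c) \<le> cyc_dist n (fst c') (snd c')"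
    using arg_min_nat_lemma[of ?P c0 "\<lambda>c. cyc_dist n (fst c) (snd c)"] \<open>?P c0\<close> unfolding c_def by auto
  obtain i q where c: "c = (i, q)" by fastforce
  have iq: "i < n" "q < n" "i \<notin> B" "q \<notin> A" using P c by auto
  define d where "d = cyc_dist n i q"
  have d: "(i + d) mod n = q" "d < n" using cyc_dist iq by (auto simp: d_def)
  have "(i + t) mod n \<in> A" if "t < d" for t
  proof (rule ccontr)
    assume "(i + t) mod n \<notin> A"
    then show False
      using min[of "(i, (i + t) mod n)"] iq that d cyc_dist_add[of i n t] by (auto simp: c d_def)
  qed
  moreover have "(i + t) mod n \<in> B" if "0 < t" "t \<le> d" for t
  proof (rule ccontr)
    assume *: "(i + t) mod n \<notin> B"
    have "((i + t) mod n + (d - t)) mod n = (i + t + (d - t)) mod n"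
      by (simp only: mod_add_left_eq)
    then have "((i + t) mod n + (d - t)) mod n = q"
      using d that by simp
    then have "cyc_dist n ((i + t) mod n) q = d - t"
      using cyc_dist_add[of "(i + t) mod n" n "d - t"] d iq by simp
    then show False
      using min[of "((i + t) mod n, q)"] iq that * by (auto simp: c d_def)
  qed
  ultimately have "is_cut n A B c"
    unfolding is_cut_def c cutA_def cutB_def using iq by (auto simp: d_def)
  then show ?thesis using iq c by blast
qed

lemma cut_arc:
  assumes "i < n" "q < n"
  shows "cutA n (i, q) \<union> {q} = cutB n (i, q) \<union> {i}"
proof -
  define d where "d = cyc_dist n i q"
  have d: "(i + d) mod n = q" "d < n" using cyc_dist assms by (auto simp: d_def)
  have "cutA n (i, q) \<union> {q} = (\<lambda>t. (i + t) mod n) ` {..d}"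
    using d unfolding cutA_def by (auto simp: d_def[symmetric] image_iff) (metis le_neq_implies_less)
  moreover have "cutB n (i, q) \<union> {i} = (\<lambda>t. (i + t) mod n) ` ({0<..d} \<union> {0})"
    using assms unfolding cutB_def image_Un by (auto simp: d_def[symmetric])
  moreover have "{0<..d} \<union> {0} = {..d}" by auto
  ultimately show ?thesis by (simp only:)
qed

text \<open>A letter only has to stay behind its successor. Here the successor is again in the arc
  or is \<open>q\<close>, which a cut keeps out of \<open>A\<close>; hence \<open>cutA\<close> can
  be moved to the front of the word of \<open>A\<close>.\<close>

lemma cutA_closed:
  assumes "i < n" "q < n" "x \<in> cutA n (i, q)"
  shows "Suc x mod n \<in> cutA n (i, q) \<union> {q}"
proof -
  define d where "d = cyc_dist n i q"
  have d: "(i + d) mod n = q" "d < n" using cyc_dist assms by (auto simp: d_def)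
  obtain t where t: "x = (i + t) mod n" "t < d" using assms unfolding cutA_def d_def by auto
  then have e: "Suc x mod n = (i + Suc t) mod n" by (simp add: mod_Suc_eq)
  show ?thesis
  proof (cases "Suc t = d")
    case True
    then show ?thesis using e d by simp
  next
    case False
    then have "Suc t < d" using t by simp
    then have "(i + Suc t) mod n \<in> cutA n (i, q)" unfolding cutA_def d_def by blast
    then show ?thesis using e by simp
  qed
qed

text \<open>Dually, a predecessor lies in \<open>cutB\<close> or is \<open>i\<close>, which a cut
  keeps out of \<open>B\<close>; hence \<open>cutB\<close> can be moved to the end of the word of
  \<open>B\<close>.\<close>

lemma cutB_closed:
  assumes "i < n" "q < n" "x < n" "Suc x mod n \<in> cutB n (i, q)"
  shows "x \<in> cutB n (i, q) \<union> {i}"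
proof -
  define d where "d = cyc_dist n i q"
  have d: "(i + d) mod n = q" "d < n" using cyc_dist assms by (auto simp: d_def)
  obtain t where t: "Suc x mod n = (i + t) mod n" "0 < t" "t \<le> d" using assms unfolding cutB_def d_def by auto
  then obtain s where s: "t = Suc s" using gr0_implies_Suc by blast
  have "Suc x mod n = Suc ((i + s) mod n) mod n" using t s by (simp add: mod_Suc_eq)
  then have "x = (i + s) mod n"
    using assms(3) by (auto simp: mod_Suc split: if_splits)
  then show ?thesis using t s assms(1) unfolding cutB_def by (cases "s = 0") (auto simp: d_def)
qed

section \<open>Products over subsets of the cycle\<close>

locale nil_coxeter =
  fixes n :: nat and u :: "nat \<Rightarrow> 'a::ring_1"
  assumes n3: "3 \<le> n"
    and square: "i < n \<Longrightarrow> u i * u i = 0"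
    and braid: "i < n \<Longrightarrow> u i * u (Suc i mod n) * u i = u (Suc i mod n) * u i * u (Suc i mod n)"
    and commute: "\<lbrakk>i < n; j < n; j \<noteq> Suc i mod n; i \<noteq> Suc j mod n\<rbrakk> \<Longrightarrow> u i * u j = u j * u i"
begin

definition "uprod is = prod_list (map u is)"

definition "u_dec A = uprod (dec_word_of n A)"
definition "u_inc A = uprod (rev (dec_word_of n A))"

definition "h k = (\<Sum>A | A \<subset> {..<n} \<and> card A = k. u_dec A)"
definition "e k = (\<Sum>A | A \<subset> {..<n} \<and> card A = k. u_inc A)"

lemma uprod_unique:
  assumes "dec_word n xs" "dec_word n ys" "set xs = set ys" "set xs \<subseteq> {..<n}"
  shows "uprod xs = uprod ys" "uprod (rev xs) = uprod (rev ys)"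
proof -
  show "uprod xs = uprod ys"
    unfolding uprod_def using assms
    by (intro prod_list_sorted_wrt_unique[of "\<lambda>x y. x \<noteq> y \<and> y \<noteq> Suc x mod n"])
       (auto simp: dec_word_def intro!: commute)
  show "uprod (rev xs) = uprod (rev ys)"
    unfolding uprod_def using assms
    by (intro prod_list_sorted_wrt_unique[of "\<lambda>y x. x \<noteq> y \<and> y \<noteq> Suc x mod n"])
       (auto simp: dec_word_def sorted_wrt_rev intro!: commute)
qed

lemma word_of:
  assumes "A \<subset> {..<n}"
  shows "set (dec_word_of n A) = A" "dec_word n (dec_word_of n A)" "distinct (dec_word_of n A)"
    "length (dec_word_of n A) = card A"
  using dec_word_of[OF _ assms] n3 by simp_all

lemma u_dec_eq: "dec_word n is \<Longrightarrow> set is = A \<Longrightarrow> A \<subset> {..<n} \<Longrightarrow> u_dec A = uprod is"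
  unfolding u_dec_def using word_of[of A] by (intro uprod_unique(1)) auto

lemma u_inc_eq: "dec_word n is \<Longrightarrow> set is = A \<Longrightarrow> A \<subset> {..<n} \<Longrightarrow> u_inc A = uprod (rev is)"
  unfolding u_inc_def using word_of[of A] by (intro uprod_unique(2)) auto

lemma dec_word_distinct: "dec_word n is \<Longrightarrow> distinct is"
  unfolding dec_word_def distinct_conv_nth sorted_wrt_iff_nth_less by (metis linorder_neqE_nat)

definition "h_on R k = (\<Sum>A | A \<subseteq> R \<and> card A = k. u_dec A)"
definition "e_on R k = (\<Sum>A | A \<subseteq> R \<and> card A = k. u_inc A)"

lemma h_on_eq:
  assumes "dec_word n is" "set is = R" "R \<subset> {..<n}"
  shows "h_on R k = esym (map u is) k"
  unfolding h_on_def esym_map[OF dec_word_distinct[OF assms(1)]] assms(2)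
proof (intro sum.cong refl)
  fix A assume "A \<in> {A. A \<subseteq> R \<and> card A = k}"
  then show "u_dec A = prod_list (map u (filter (\<lambda>i. i \<in> A) is))"
    using u_dec_eq[OF dec_word_filter[OF assms(1)], of "\<lambda>i. i \<in> A" A] assms by (force simp: uprod_def)
qed

lemma e_on_eq:
  assumes "dec_word n is" "set is = R" "R \<subset> {..<n}"
  shows "e_on R k = esym (map u (rev is)) k"
proof -
  have "distinct (rev is)" using dec_word_distinct[OF assms(1)] by simp
  then show ?thesis
    unfolding e_on_def esym_map[OF \<open>distinct (rev is)\<close>] set_rev assms(2)
  proof (intro sum.cong refl)
    fix A assume "A \<in> {A. A \<subseteq> R \<and> card A = k}"
    then show "u_inc A = prod_list (map u (filter (\<lambda>i. i \<in> A) (rev is)))"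
      using u_inc_eq[OF dec_word_filter[OF assms(1)], of "\<lambda>i. i \<in> A" A] assms
      by (force simp: uprod_def simp flip: rev_filter)
  qed
qed

text \<open>Since \<open>p\<close> is left out, the chain does not close up: letters that are not
  adjacent in the list are not adjacent on the cycle either.\<close>

lemma nil_chain_cyc_chain:
  assumes "m \<le> n"
  shows "nil_chain (map (\<lambda>i. if i \<in> R then u i else 0) (map (\<lambda>k. (p + k) mod n) (rev [1..<m])))"
  using assms
proof (induction m)
  case (Suc m)
  let ?u = "\<lambda>i. if i \<in> R then u i else 0"
  show ?case
  proof (cases "m \<ge> 1")
    case True
    have 1: "?u ((p + m) mod n) * ?u ((p + m) mod n) = 0" using square[of "(p + m) mod n"] n3 by auto
    have 2: "?u ((p + m) mod n) * ?u ((p + k) mod n) = ?u ((p + k) mod n) * ?u ((p + m) mod n)"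
      if "k \<in> set (tl (rev [1..<m]))" for k
    proof -
      have "1 \<le> k" "Suc k < m"
      proof -
        have "rev [1..<m] = (if m = 1 then [] else (m - 1) # rev [1..<m - 1])"
          using True by (cases m) auto
        then show "1 \<le> k" "Suc k < m" using that by (auto split: if_splits)
      qed
      then have "(p + k) mod n \<noteq> Suc ((p + m) mod n) mod n" "(p + m) mod n \<noteq> Suc ((p + k) mod n) mod n"
      proof -
        have "Suc m - k < n" "m - Suc k < n" using \<open>1 \<le> k\<close> \<open>Suc k < m\<close> Suc.prems by linarith+
        then show "(p + k) mod n \<noteq> Suc ((p + m) mod n) mod n" "(p + m) mod n \<noteq> Suc ((p + k) mod n) mod n"
          using mod_add_neq[of k "Suc m" n p] mod_add_neq[of "Suc k" m n p] \<open>Suc k < m\<close>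
          by (auto simp: mod_Suc_eq)
      qed
      then show ?thesis using commute[of "(p + m) mod n" "(p + k) mod n"] n3 by auto
    qed
    have 3: "?u ((p + m) mod n) * ?u ((p + (m - 1)) mod n) * ?u ((p + m) mod n) =
       ?u ((p + (m - 1)) mod n) * ?u ((p + m) mod n) * ?u ((p + (m - 1)) mod n)"
      using braid[of "(p + (m - 1)) mod n"] n3 True by (auto simp: mod_Suc_eq)
    define g where "g k = ?u ((p + k) mod n)" for k
    have "rev [1..<Suc m] = m # rev [1..<m]" using True by simp
    moreover have "1 < m" if "rev [1..<m] \<noteq> []" using that by simp
    moreover have "hd (rev [1..<m]) = m - 1" if "rev [1..<m] \<noteq> []"
    proof -
      obtain j where "m = Suc j" "1 \<le> j" using \<open>rev [1..<m] \<noteq> []\<close> by (cases m) (auto split: if_splits)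
      then show ?thesis by simp
    qed
    moreover have "nil_chain (map g (rev [1..<m]))" using Suc by (simp add: g_def[abs_def] comp_def)
    ultimately have "nil_chain (map g (rev [1..<Suc m]))"
      using 1 2 3 unfolding g_def[symmetric] by (auto simp: hd_map map_tl[symmetric] simp del: upt_Suc)
    then show ?thesis by (simp add: g_def[abs_def] comp_def del: upt_Suc)
  qed simp
qed simp

lemma proper_word:
  assumes "R \<subset> {..<n}"
  obtains p where "p < n" "p \<notin> R" "set (filter (\<lambda>i. i \<in> R) (cyc_chain n p)) = R"
    "dec_word n (filter (\<lambda>i. i \<in> R) (cyc_chain n p))"
proof -
  obtain p where p: "p < n" "p \<notin> R" using assms by auto
  have "set (filter (\<lambda>i. i \<in> R) (cyc_chain n p)) = R"
    using set_cyc_chain[OF p(1)] p assms by auto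
  then show ?thesis using dec_word_filter[OF dec_word_cyc_chain] p that by blast
qed

lemma h_on_commute:
  assumes "R \<subset> {..<n}"
  shows "h_on R k * h_on R l = h_on R l * h_on R k"
proof -
  obtain p where p: "set (filter (\<lambda>i. i \<in> R) (cyc_chain n p)) = R"
    "dec_word n (filter (\<lambda>i. i \<in> R) (cyc_chain n p))" using proper_word[OF assms] by metis
  have "h_on R k = esym (map (\<lambda>i. if i \<in> R then u i else 0) (cyc_chain n p)) k" for k
    unfolding esym_restrict using h_on_eq[OF p(2,1) assms] .
  moreover have "nil_chain (map (\<lambda>i. if i \<in> R then u i else 0) (cyc_chain n p))"
    unfolding cyc_chain_def by (rule nil_chain_cyc_chain) simp
  ultimately show ?thesis using esym_commute by metis
qed

text \<open>No letter of \<open>R\<close> is the successor of a letter of \<open>A0\<close>, so each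
  of these words can be arranged to begin with \<open>A0\<close>.\<close>

lemma h_on_shift:
  assumes "A0 \<inter> R = {}" "A0 \<union> R \<subset> {..<n}" "\<And>x. x \<in> A0 \<Longrightarrow> Suc x mod n \<notin> R"
  shows "(\<Sum>A | A0 \<subseteq> A \<and> A \<subseteq> A0 \<union> R \<and> card A = k. u_dec A) =
     (if card A0 \<le> k then u_dec A0 * h_on R (k - card A0) else 0)"
proof -
  have fin: "finite A0" "finite R" using assms by (meson finite_Un finite_lessThan finite_subset psubset_imp_subset)+
  have "(\<Sum>A\<in>(\<union>) A0 ` {A. A \<subseteq> R \<and> card A = k - card A0}. u_dec A) =
      (\<Sum>A | A \<subseteq> R \<and> card A = k - card A0. u_dec (A0 \<union> A))"
    using assms by (subst sum.reindex) (auto simp: inj_on_def)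
  also have "\<dots> = u_dec A0 * h_on R (k - card A0)"
    unfolding h_on_def sum_distrib_left
  proof (intro sum.cong refl)
    fix A assume A: "A \<in> {A. A \<subseteq> R \<and> card A = k - card A0}"
    have s: "A0 \<subset> {..<n}" "A \<subset> {..<n}" "A0 \<union> A \<subset> {..<n}" using A assms by auto
    let ?w = "dec_word_of n A0 @ dec_word_of n A"
    have "dec_word n ?w"
      using word_of[OF s(1)] word_of[OF s(2)] assms A unfolding dec_word_def sorted_wrt_append by blast
    then have "u_dec (A0 \<union> A) = uprod ?w"
      using word_of[OF s(1)] word_of[OF s(2)] s(3) by (intro u_dec_eq) auto
    then show "u_dec (A0 \<union> A) = u_dec A0 * u_dec A" by (simp add: uprod_def u_dec_def)
  qed
  finally show ?thesis unfolding hook_subset_image[OF fin(2) assms(1) fin(1)] by simp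
qed

text \<open>The mirror image: no letter of \<open>B0\<close> is the successor of a letter of
  \<open>R\<close>, so \<open>B0\<close> can close the word.\<close>

lemma h_on_shift':
  assumes "B0 \<inter> R = {}" "B0 \<union> R \<subset> {..<n}" "\<And>x. x \<in> R \<Longrightarrow> Suc x mod n \<notin> B0"
  shows "(\<Sum>A | B0 \<subseteq> A \<and> A \<subseteq> B0 \<union> R \<and> card A = k. u_dec A) =
     (if card B0 \<le> k then h_on R (k - card B0) * u_dec B0 else 0)"
proof -
  have fin: "finite B0" "finite R" using assms by (meson finite_Un finite_lessThan finite_subset psubset_imp_subset)+
  have "(\<Sum>A\<in>(\<union>) B0 ` {A. A \<subseteq> R \<and> card A = k - card B0}. u_dec A) =
      (\<Sum>A | A \<subseteq> R \<and> card A = k - card B0. u_dec (B0 \<union> A))"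
    using assms by (subst sum.reindex) (auto simp: inj_on_def)
  also have "\<dots> = h_on R (k - card B0) * u_dec B0"
    unfolding h_on_def sum_distrib_right
  proof (intro sum.cong refl)
    fix A assume A: "A \<in> {A. A \<subseteq> R \<and> card A = k - card B0}"
    have s: "B0 \<subset> {..<n}" "A \<subset> {..<n}" "B0 \<union> A \<subset> {..<n}" using A assms by auto
    let ?w = "dec_word_of n A @ dec_word_of n B0"
    have "dec_word n ?w"
      using word_of[OF s(1)] word_of[OF s(2)] assms A unfolding dec_word_def sorted_wrt_append by blast
    then have "u_dec (B0 \<union> A) = uprod ?w"
      using word_of[OF s(1)] word_of[OF s(2)] s(3) by (intro u_dec_eq) auto
    then show "u_dec (B0 \<union> A) = u_dec A * u_dec B0" by (simp add: uprod_def u_dec_def)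
  qed
  finally show ?thesis unfolding hook_subset_image[OF fin(2) assms(1) fin(1)] by simp
qed

section \<open>Commutation on the whole cycle\<close>

lemma finite_proper: "finite {A. A \<subset> {..<n} \<and> P A}"
  by (rule finite_subset[of _ "Pow {..<n}"]) auto

text \<open>The condition that all members of \<open>T\<close> are cuts splits into one on
  \<open>A\<close> and one on \<open>B\<close>, so the double sum is a product. With
  \<open>R\<close> the complement of all arcs, each factor is a fixed outer product times a sum over
  subsets of \<open>R\<close>. The two outer products have the same number of letters, so exchanging
  \<open>k\<close> and \<open>l\<close> only exchanges the inner sums.\<close>

lemma cut_sum_commute:
  assumes T: "T \<subseteq> {..<n} \<times> {..<n}" "T \<noteq> {}"
  defines "S \<equiv> \<lambda>k l. \<Sum>A | A \<subset> {..<n} \<and> card A = k. \<Sum>B | B \<subset> {..<n} \<and> card B = l.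
    if \<forall>c\<in>T. is_cut n A B c then u_dec A * u_dec B else 0"
  shows "S k l = S l k"
proof -
  let ?CA = "\<Union>(cutA n ` T)" and ?QA = "snd ` T" and ?CB = "\<Union>(cutB n ` T)" and ?IB = "fst ` T"
  define R where "R = {..<n} - (?CA \<union> ?QA)"
  have in_n: "fst c < n" "snd c < n" if "c \<in> T" for c using T that by auto
  have subn: "?CA \<subseteq> {..<n}" "?QA \<subseteq> {..<n}" "?CB \<subseteq> {..<n}" "?IB \<subseteq> {..<n}"
    using in_n n3 unfolding cutA_def cutB_def by (auto simp: case_prod_beta)
  have arc: "cutA n c \<union> {snd c} = cutB n c \<union> {fst c}" if "c \<in> T" for c
    using cut_arc in_n[OF that] by (metis prod.collapse)
  have K: "?CA \<union> ?QA = ?CB \<union> ?IB"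
  proof -
    have "?CA \<union> ?QA = (\<Union>c\<in>T. cutA n c \<union> {snd c})" by auto
    also have "\<dots> = (\<Union>c\<in>T. cutB n c \<union> {fst c})" using arc by simp
    finally show ?thesis by auto
  qed
  have char: "(\<forall>c\<in>T. is_cut n A B c) \<longleftrightarrow> (?CA \<subseteq> A \<and> ?QA \<inter> A = {}) \<and> (?CB \<subseteq> B \<and> ?IB \<inter> B = {})" for A B
  proof -
    have "?QA \<inter> A = {} \<longleftrightarrow> (\<forall>c\<in>T. snd c \<notin> A)" "?IB \<inter> B = {} \<longleftrightarrow> (\<forall>c\<in>T. fst c \<notin> B)"
      by blast+
    then show ?thesis unfolding is_cut_def ball_conj_distrib UN_subset_iff by (simp only: conj_assoc)
  qed
  have S: "S k l = (\<Sum>A | (A \<subset> {..<n} \<and> card A = k) \<and> ?CA \<subseteq> A \<and> ?QA \<inter> A = {}. u_dec A) *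
      (\<Sum>B | (B \<subset> {..<n} \<and> card B = l) \<and> ?CB \<subseteq> B \<and> ?IB \<inter> B = {}. u_dec B)" for k l
  proof -
    have "S k l = (\<Sum>A | A \<subset> {..<n} \<and> card A = k. \<Sum>B | B \<subset> {..<n} \<and> card B = l.
      (if ?CA \<subseteq> A \<and> ?QA \<inter> A = {} then u_dec A else 0) * (if ?CB \<subseteq> B \<and> ?IB \<inter> B = {} then u_dec B else 0))"
      unfolding S_def char by (intro sum.cong refl) auto
    also have "\<dots> = (\<Sum>A | A \<subset> {..<n} \<and> card A = k. if ?CA \<subseteq> A \<and> ?QA \<inter> A = {} then u_dec A else 0) *
      (\<Sum>B | B \<subset> {..<n} \<and> card B = l. if ?CB \<subseteq> B \<and> ?IB \<inter> B = {} then u_dec B else 0)"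
      by (simp only: sum_product)
    also have "(\<Sum>A | A \<subset> {..<n} \<and> card A = k. if ?CA \<subseteq> A \<and> ?QA \<inter> A = {} then u_dec A else 0) =
      (\<Sum>A | (A \<subset> {..<n} \<and> card A = k) \<and> ?CA \<subseteq> A \<and> ?QA \<inter> A = {}. u_dec A)"
      using finite_proper[of "\<lambda>A. card A = k"] by (simp add: sum.inter_filter[symmetric])
    also have "(\<Sum>B | B \<subset> {..<n} \<and> card B = l. if ?CB \<subseteq> B \<and> ?IB \<inter> B = {} then u_dec B else 0) =
      (\<Sum>B | (B \<subset> {..<n} \<and> card B = l) \<and> ?CB \<subseteq> B \<and> ?IB \<inter> B = {}. u_dec B)"
      using finite_proper[of "\<lambda>A. card A = l"] by (simp add: sum.inter_filter[symmetric])
    finally show ?thesis .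
  qed
  show ?thesis
  proof (cases "?CA \<inter> ?QA = {} \<and> ?CB \<inter> ?IB = {}")
    \<comment> \<open>The requirements contradict each other: an index would have to be in and out
      of the same set, so the sums are empty on both sides.\<close>
    case False
    then have "(\<exists>x. x \<in> ?CA \<and> x \<in> ?QA) \<or> (\<exists>x. x \<in> ?CB \<and> x \<in> ?IB)" by blast
    then have "{A. (A \<subset> {..<n} \<and> card A = k) \<and> ?CA \<subseteq> A \<and> ?QA \<inter> A = {}} = {} \<and>
        {A. (A \<subset> {..<n} \<and> card A = l) \<and> ?CA \<subseteq> A \<and> ?QA \<inter> A = {}} = {} \<or>
        {B. (B \<subset> {..<n} \<and> card B = k) \<and> ?CB \<subseteq> B \<and> ?IB \<inter> B = {}} = {} \<and>
        {B. (B \<subset> {..<n} \<and> card B = l) \<and> ?CB \<subseteq> B \<and> ?IB \<inter> B = {}} = {}"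
      by blast
    then show ?thesis unfolding S by (elim disjE conjE) (simp_all only: sum.empty mult_zero_left mult_zero_right)
  next
    case True
    have "R = {..<n} - (?CB \<union> ?IB)" unfolding R_def K ..
    then have dj: "?CA \<inter> R = {}" "?CB \<inter> R = {}" unfolding R_def by blast+
    have "R \<noteq> {..<n}"
    proof -
      obtain c where "c \<in> T" using T by blast
      then have "snd c \<in> {..<n}" "snd c \<notin> R" using in_n by (auto simp: R_def)
      then show ?thesis by blast
    qed
    then have R: "R \<subset> {..<n}" unfolding R_def by blast
    have KR: "?CA \<union> R = {..<n} - ?QA" "?CB \<union> R = {..<n} - ?IB"
    proof -
      show "?CA \<union> R = {..<n} - ?QA" using True subn(1) unfolding R_def by blast
      have "R = {..<n} - (?CB \<union> ?IB)" unfolding R_def K ..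
      then show "?CB \<union> R = {..<n} - ?IB" using True subn(3) by blast
    qed
    obtain c0 where c0: "c0 \<in> T" using T by blast
    have prp: "?CA \<union> R \<subset> {..<n}" "?CB \<union> R \<subset> {..<n}"
    proof -
      have "fst c0 \<in> {..<n}" "snd c0 \<in> {..<n}" using in_n[OF c0] by auto
      then show "?CA \<union> R \<subset> {..<n}" "?CB \<union> R \<subset> {..<n}" unfolding KR using c0 by blast+
    qed
    \<comment> \<open>If two arcs start together, the end of the shorter one lies in the
      \<open>cutA\<close> of the longer; if they end together, the start of the shorter one lies in
      the \<open>cutB\<close> of the longer. Both contradict the disjointness assumed in this
      case.\<close>
    have inj: "inj_on snd T" "inj_on fst T"
    proof -
      have cancel: "a = b" if "(a + i) mod n = (b + i) mod n" "a < n" "b < n" for i a b :: nat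
        using mod_add_neq[of a b n i] mod_add_neq[of b a n i] that
        by (metis add.commute less_imp_diff_less linorder_neqE_nat)
      show "inj_on fst T"
      proof (rule inj_onI, rule ccontr)
        have aux: False if c: "c \<in> T" "c' \<in> T" "fst c = fst c'" "cyc_dist n (fst c) (snd c) < cyc_dist n (fst c') (snd c')" for c c'
        proof -
          have "snd c = (fst c' + cyc_dist n (fst c) (snd c)) mod n"
            using cyc_dist(1)[of "fst c" n "snd c"] in_n[OF c(1)] c(3) by simp
          then have "snd c \<in> cutA n c'" unfolding cutA_def case_prod_beta using c(4) by blast
          then show False using True c by blast
        qed
        fix c c' assume c: "c \<in> T" "c' \<in> T" "fst c = fst c'" "c \<noteq> c'"
        then have "cyc_dist n (fst c) (snd c) \<noteq> cyc_dist n (fst c') (snd c')"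
          using cyc_dist(1) in_n by (metis prod.expand)
        then show False using aux[of c c'] aux[of c' c] c by (metis linorder_neqE_nat)
      qed
      show "inj_on snd T"
      proof (rule inj_onI, rule ccontr)
        have aux: False if c: "c \<in> T" "c' \<in> T" "snd c = snd c'" "fst c \<noteq> fst c'"
          "cyc_dist n (fst c) (snd c) \<le> cyc_dist n (fst c') (snd c')" for c c'
        proof -
          let ?d = "cyc_dist n (fst c) (snd c)" and ?d' = "cyc_dist n (fst c') (snd c')"
          have d: "?d' < n" "(fst c + ?d) mod n = snd c" "(fst c' + ?d') mod n = snd c"
            using cyc_dist in_n c by metis+
          have "((fst c' + (?d' - ?d)) mod n + ?d) mod n = (fst c' + (?d' - ?d) + ?d) mod n"
            by (simp only: mod_add_left_eq)
          also have "\<dots> = snd c" using d c(5) by simp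
          finally have "((fst c' + (?d' - ?d)) mod n + ?d) mod n = (fst c + ?d) mod n" using d by simp
          then have eq: "(fst c' + (?d' - ?d)) mod n = fst c"
            by (rule cancel) (use in_n[OF c(1)] n3 in auto)
          have "?d' \<noteq> ?d" using eq c(4) in_n[OF c(2)] by (metis add.right_neutral diff_self_eq_0 mod_less)
          then have "0 < ?d' - ?d" "?d' - ?d \<le> ?d'" using c(5) by auto
          then have "fst c \<in> cutB n c'"
            unfolding cutB_def case_prod_beta using eq[symmetric] by blast
          then show False using True c by blast
        qed
        fix c c' assume c: "c \<in> T" "c' \<in> T" "snd c = snd c'" "c \<noteq> c'"
        then have "fst c \<noteq> fst c'" by (metis prod.expand)
        then show False using aux[of c c'] aux[of c' c] c by (metis linear)
      qed
    qed
    \<comment> \<open>Either union is completed to the union of all arcs by \<open>card T\<close>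
      end points, on one side the last indices and on the other the first ones.\<close>
    have card: "card ?CA = card ?CB"
    proof -
      have fin: "finite ?CA" "finite ?CB" "finite ?QA" "finite ?IB" by (rule finite_subset[OF subn(1) finite_lessThan] finite_subset[OF subn(2) finite_lessThan]
          finite_subset[OF subn(3) finite_lessThan] finite_subset[OF subn(4) finite_lessThan])+
      have "card ?CA + card ?QA = card (?CA \<union> ?QA)" using True fin by (intro card_Un_disjoint[symmetric]) auto
      moreover have "card ?CB + card ?IB = card (?CB \<union> ?IB)" using True fin by (intro card_Un_disjoint[symmetric]) auto
      moreover have "card ?QA = card ?IB" using inj by (simp add: card_image)
      ultimately show ?thesis using K by simp
    qed
    have setA: "{A. (A \<subset> {..<n} \<and> card A = k) \<and> ?CA \<subseteq> A \<and> ?QA \<inter> A = {}} =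
        {A. ?CA \<subseteq> A \<and> A \<subseteq> ?CA \<union> R \<and> card A = k}" for k
      using prp(1) unfolding KR(1) by blast
    have setB: "{A. (A \<subset> {..<n} \<and> card A = k) \<and> ?CB \<subseteq> A \<and> ?IB \<inter> A = {}} =
        {A. ?CB \<subseteq> A \<and> A \<subseteq> ?CB \<union> R \<and> card A = k}" for k
      using prp(2) unfolding KR(2) by blast
    have clA: "Suc x mod n \<notin> R" if "x \<in> ?CA" for x
    proof -
      obtain c where c: "c \<in> T" "x \<in> cutA n c" using \<open>x \<in> ?CA\<close> by blast
      have "Suc x mod n \<in> cutA n c \<union> {snd c}"
        using cutA_closed[of "fst c" n "snd c" x] in_n[OF c(1)] c by simp
      then show ?thesis using c(1) unfolding R_def by blast
    qed
    have clB: "Suc x mod n \<notin> ?CB" if "x \<in> R" for x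
    proof
      assume "Suc x mod n \<in> ?CB"
      then obtain c where c: "c \<in> T" "Suc x mod n \<in> cutB n c" by blast
      have "x \<in> cutB n c \<union> {fst c}"
        using cutB_closed[of "fst c" n "snd c" x] in_n[OF c(1)] c \<open>x \<in> R\<close> by (simp add: R_def)
      then show False using c(1) \<open>x \<in> R\<close> K unfolding R_def by blast
    qed
    have sumA: "(\<Sum>A | ?CA \<subseteq> A \<and> A \<subseteq> ?CA \<union> R \<and> card A = k. u_dec A) =
        (if card ?CA \<le> k then u_dec ?CA * h_on R (k - card ?CA) else 0)" for k
      by (rule h_on_shift[OF dj(1) prp(1)]) (rule clA)
    have sumB: "(\<Sum>A | ?CB \<subseteq> A \<and> A \<subseteq> ?CB \<union> R \<and> card A = k. u_dec A) =
        (if card ?CA \<le> k then h_on R (k - card ?CA) * u_dec ?CB else 0)" for k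
      unfolding card by (rule h_on_shift'[OF dj(2) prp(2)]) (rule clB)
    have "S k l = (if card ?CA \<le> k then u_dec ?CA * h_on R (k - card ?CA) else 0) *
        (if card ?CA \<le> l then h_on R (l - card ?CA) * u_dec ?CB else 0)" for k l
      unfolding S setA setB card[symmetric] sumA sumB ..
    then have "S k l = (if card ?CA \<le> k \<and> card ?CA \<le> l then
        u_dec ?CA * (h_on R (k - card ?CA) * h_on R (l - card ?CA)) * u_dec ?CB else 0)" for k l
      by (simp add: mult.assoc)
    then show ?thesis using h_on_commute[OF R] by auto
  qed
qed

text \<open>Inclusion-exclusion over the cuts reduces commutation to proper subsets of the cycle.\<close>

theorem h_commute: "h k * h l = h l * h k"
proof -
  let ?C = "{..<n} \<times> {..<n}"
  define S where "S T k l = (\<Sum>A | A \<subset> {..<n} \<and> card A = k. \<Sum>B | B \<subset> {..<n} \<and> card B = l.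
    if \<forall>c\<in>T. is_cut n A B c then u_dec A * u_dec B else 0)" for T k l
  have alt: "(\<Sum>T\<in>Pow ?C. (-1) ^ card T * S T k l) = 0" for k l
  proof -
    have "(\<Sum>T\<in>Pow ?C. (-1) ^ card T * S T k l) =
      (\<Sum>T\<in>Pow ?C. \<Sum>A | A \<subset> {..<n} \<and> card A = k. \<Sum>B | B \<subset> {..<n} \<and> card B = l.
        (-1) ^ card T * (if \<forall>c\<in>T. is_cut n A B c then u_dec A * u_dec B else 0))"
      unfolding S_def sum_distrib_left ..
    also have "\<dots> = (\<Sum>A | A \<subset> {..<n} \<and> card A = k. \<Sum>B | B \<subset> {..<n} \<and> card B = l. \<Sum>T\<in>Pow ?C.
        (-1) ^ card T * (if \<forall>c\<in>T. is_cut n A B c then u_dec A * u_dec B else 0))"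
      by (subst sum.swap, rule sum.cong[OF refl], subst sum.swap) rule
    also have "\<dots> = 0"
    proof (rule sum.neutral, rule ballI, rule sum.neutral, rule ballI)
      fix A B assume AB: "A \<in> {A. A \<subset> {..<n} \<and> card A = k}" "B \<in> {B. B \<subset> {..<n} \<and> card B = l}"
      let ?L = "{c \<in> ?C. is_cut n A B c}"
      \<comment> \<open>Every pair has a cut, so the signed count of sets of cuts vanishes pair by
        pair.\<close>
      have "?L \<noteq> {}" using cut_exists[of A n B] AB by blast
      have "(\<Sum>T\<in>Pow ?C. (-1) ^ card T * (if \<forall>c\<in>T. is_cut n A B c then u_dec A * u_dec B else 0)) =
         (\<Sum>T\<in>Pow ?L. (-1) ^ card T * (u_dec A * u_dec B))"
        by (intro sum.mono_neutral_cong_right) auto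
      also have "\<dots> = 0"
        unfolding sum_distrib_right[symmetric] using \<open>?L \<noteq> {}\<close> by (subst alternating_sum_Pow) auto
      finally show "(\<Sum>T\<in>Pow ?C. (-1) ^ card T * (if \<forall>c\<in>T. is_cut n A B c then u_dec A * u_dec B else 0)) = 0" .
    qed
    finally show ?thesis .
  qed
  \<comment> \<open>The empty set imposes no condition and yields the full product;
    \<open>cut_sum_commute\<close> applies to all other terms.\<close>
  have e1: "S {} k l = - (\<Sum>T\<in>Pow ?C - {{}}. (-1) ^ card T * S T k l)" for k l
  proof -
    have "(\<Sum>T\<in>Pow ?C. (-1) ^ card T * S T k l) = S {} k l + (\<Sum>T\<in>Pow ?C - {{}}. (-1) ^ card T * S T k l)"
      by (subst sum.remove[of _ "{}"]) auto
    then show ?thesis using alt by (simp add: eq_neg_iff_add_eq_0)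
  qed
  have e2: "(\<Sum>T\<in>Pow ?C - {{}}. (-1) ^ card T * S T k l) = (\<Sum>T\<in>Pow ?C - {{}}. (-1) ^ card T * S T l k)"
    using cut_sum_commute unfolding S_def by (intro sum.cong refl) (auto simp del: One_nat_def)
  have e3: "S {} k l = h k * h l" for k l
    unfolding S_def h_def sum_product by simp
  show ?thesis unfolding e3[symmetric] e1[of k l] e1[of l k] e2 ..
qed

section \<open>The relation between increasing and decreasing products\<close>

lemma e_h_on:
  assumes "R \<subset> {..<n}" "k > 0"
  shows "(\<Sum>i\<le>k. (-1) ^ i * e_on R i * h_on R (k - i)) = 0"
proof -
  obtain w where w: "set w = R" "dec_word n w" using proper_word[OF assms(1)] by metis
  have sq: "a * a = 0" if a: "a \<in> set (map u w)" for a
  proof -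
    from a obtain i where "i \<in> R" "a = u i" unfolding set_map w(1) by (rule imageE)
    then show ?thesis using square[of i] assms(1) by auto
  qed
  show ?thesis
    unfolding h_on_eq[OF w(2,1) assms(1)] e_on_eq[OF w(2,1) assms(1)] rev_map[symmetric]
    by (rule esym_rev_esym[OF sq assms(2)])
qed

text \<open>Together \<open>A\<close> and \<open>B\<close> have at most \<open>k < n\<close>
  letters, so some letter is missing from both. Inclusion-exclusion over the sets of missing letters
  leaves only sums over proper parts of the cycle, which vanish by \<open>e_h_on\<close>.\<close>

lemma e_h:
  assumes "0 < k" "k < n"
  shows "(\<Sum>i\<le>k. (-1) ^ i * e i * h (k - i)) = 0"
proof -
  define S where "S T = (\<Sum>i\<le>k. \<Sum>A | A \<subset> {..<n} \<and> card A = i. \<Sum>B | B \<subset> {..<n} \<and> card B = k - i.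
    if T \<subseteq> {..<n} - (A \<union> B) then (-1) ^ i * u_inc A * u_dec B else 0)" for T
  have "(\<Sum>T\<in>Pow {..<n}. (-1) ^ card T * S T) =
      (\<Sum>T\<in>Pow {..<n}. \<Sum>i\<le>k. \<Sum>A | A \<subset> {..<n} \<and> card A = i. \<Sum>B | B \<subset> {..<n} \<and> card B = k - i.
        (-1) ^ card T * (if T \<subseteq> {..<n} - (A \<union> B) then (-1) ^ i * u_inc A * u_dec B else 0))"
    unfolding S_def sum_distrib_left ..
  also have "\<dots> = (\<Sum>i\<le>k. \<Sum>A | A \<subset> {..<n} \<and> card A = i. \<Sum>B | B \<subset> {..<n} \<and> card B = k - i.
      \<Sum>T\<in>Pow {..<n}. (-1) ^ card T * (if T \<subseteq> {..<n} - (A \<union> B) then (-1) ^ i * u_inc A * u_dec B else 0))"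
    by (subst sum.swap, rule sum.cong[OF refl], subst sum.swap, rule sum.cong[OF refl], subst sum.swap) rule
  also have "\<dots> = 0"
  proof (rule sum.neutral, rule ballI, rule sum.neutral, rule ballI, rule sum.neutral, rule ballI)
    fix i A B assume AB: "i \<in> {..k}" "A \<in> {A. A \<subset> {..<n} \<and> card A = i}" "B \<in> {B. B \<subset> {..<n} \<and> card B = k - i}"
    let ?L = "{..<n} - (A \<union> B)"
    have "card (A \<union> B) \<le> k" using AB card_Un_le[of A B] by simp
    have "?L \<noteq> {}"
    proof
      assume "?L = {}"
      moreover have "A \<union> B \<subseteq> {..<n}" using AB(2,3) by (simp add: psubset_imp_subset)
      ultimately have "A \<union> B = {..<n}" by blast
      then have "card (A \<union> B) = n" by simp
      then show False using \<open>card (A \<union> B) \<le> k\<close> assms(2) by linarith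
    qed
    have "(\<Sum>T\<in>Pow {..<n}. (-1) ^ card T * (if T \<subseteq> ?L then (-1) ^ i * u_inc A * u_dec B else 0)) =
       (\<Sum>T\<in>Pow ?L. (-1) ^ card T * ((-1) ^ i * u_inc A * u_dec B))"
      by (intro sum.mono_neutral_cong_right) auto
    also have "\<dots> = 0"
      unfolding sum_distrib_right[symmetric] using \<open>?L \<noteq> {}\<close> by (subst alternating_sum_Pow) auto
    finally show "(\<Sum>T\<in>Pow {..<n}. (-1) ^ card T * (if T \<subseteq> ?L then (-1) ^ i * u_inc A * u_dec B else 0)) = 0" .
  qed
  finally have "(\<Sum>T\<in>Pow {..<n}. (-1) ^ card T * S T) = 0" .
  moreover have "(\<Sum>T\<in>Pow {..<n}. (-1) ^ card T * S T) = S {} + (\<Sum>T\<in>Pow {..<n} - {{}}. (-1) ^ card T * S T)"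
    by (subst sum.remove[of _ "{}"]) auto
  moreover have "S T = 0" if T: "T \<in> Pow {..<n} - {{}}" for T
  proof -
    let ?R = "{..<n} - T"
    have R: "?R \<subset> {..<n}" using T by blast
    have "S T = (\<Sum>i\<le>k. (-1) ^ i * ((\<Sum>A | A \<subset> {..<n} \<and> card A = i. if A \<inter> T = {} then u_inc A else 0) *
       (\<Sum>B | B \<subset> {..<n} \<and> card B = k - i. if B \<inter> T = {} then u_dec B else 0)))"
    proof -
      have "S T = (\<Sum>i\<le>k. \<Sum>A | A \<subset> {..<n} \<and> card A = i. \<Sum>B | B \<subset> {..<n} \<and> card B = k - i.
        (-1) ^ i * ((if A \<inter> T = {} then u_inc A else 0) * (if B \<inter> T = {} then u_dec B else 0)))"
      proof -
        have "T \<subseteq> {..<n} - (A \<union> B) \<longleftrightarrow> A \<inter> T = {} \<and> B \<inter> T = {}" for A B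
          using T by blast
        then show ?thesis unfolding S_def by (intro sum.cong refl) (simp add: mult.assoc)
      qed
      then show ?thesis unfolding sum_product unfolding sum_distrib_left .
    qed
    also have "\<dots> = (\<Sum>i\<le>k. (-1) ^ i * (e_on ?R i * h_on ?R (k - i)))"
    proof -
      have s: "{A. (A \<subset> {..<n} \<and> card A = j) \<and> A \<inter> T = {}} = {A. A \<subseteq> ?R \<and> card A = j}"
        "{A. A \<subset> {..<n} \<and> card A = j \<and> A \<inter> T = {}} = {A. A \<subseteq> ?R \<and> card A = j}" for j
        using T by blast+
      have "(\<Sum>A | A \<subset> {..<n} \<and> card A = j. if A \<inter> T = {} then f A else 0) =
          (\<Sum>A | A \<subseteq> ?R \<and> card A = j. f A)" for j and f :: "nat set \<Rightarrow> 'a"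
        using finite_proper[of "\<lambda>A. card A = j"] by (simp add: sum.inter_filter[symmetric] s)
      then show ?thesis by (simp add: e_on_def h_on_def)
    qed
    finally show ?thesis using e_h_on[OF R assms(1)] by (simp add: mult.assoc)
  qed
  ultimately have "S {} = 0" by simp
  moreover have "S {} = (\<Sum>i\<le>k. (-1) ^ i * e i * h (k - i))"
  proof -
    have "S {} = (\<Sum>i\<le>k. \<Sum>A | A \<subset> {..<n} \<and> card A = i. \<Sum>B | B \<subset> {..<n} \<and> card B = k - i.
        (-1) ^ i * (u_inc A * u_dec B))"
      unfolding S_def by (simp add: mult.assoc)
    also have "\<dots> = (\<Sum>i\<le>k. (-1) ^ i * (e i * h (k - i)))"
      unfolding e_def h_def sum_product unfolding sum_distrib_left ..
    finally show ?thesis by (simp add: mult.assoc)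
  qed
  ultimately show ?thesis by simp
qed

text \<open>A linear relation between affine Stanley functions is a relation between coefficients of
  monomials in the \<open>h\<^sub>k\<close>, so it extends to this additive group, which contains the \<open>e\<^sub>k\<close>.\<close>

inductive_set hspan :: "'a set" where
  hspan_mono: "set as \<subseteq> {..<n} \<Longrightarrow> prod_list (map h as) \<in> hspan"
| hspan_diff: "a \<in> hspan \<Longrightarrow> b \<in> hspan \<Longrightarrow> a - b \<in> hspan"

lemma h_0 [simp]: "h 0 = 1" and e_0 [simp]: "e 0 = 1"
proof -
  have "0 \<in> {..<n}" using n3 by simp
  then have "{} \<subset> {..<n}" by blast
  have "{A. A \<subset> {..<n} \<and> card A = 0} = {{}}"
  proof
    show "{A. A \<subset> {..<n} \<and> card A = 0} \<subseteq> {{}}"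
    proof
      fix A :: "nat set" assume "A \<in> {A. A \<subset> {..<n} \<and> card A = 0}"
      then have "finite A" "card A = 0" by (auto intro: finite_subset[of A "{..<n}"] simp: psubset_eq)
      then show "A \<in> {{}}" by simp
    qed
    show "{{}} \<subseteq> {A. A \<subset> {..<n} \<and> card A = 0}"
      using \<open>{} \<subset> {..<n}\<close> by (simp only: singleton_iff subset_iff mem_Collect_eq card.empty) simp
  qed
  moreover have "dec_word_of n {} = []" using word_of(1)[OF \<open>{} \<subset> {..<n}\<close>] by simp
  ultimately show "h 0 = 1" "e 0 = 1" by (simp_all add: h_def e_def u_dec_def u_inc_def uprod_def)
qed

lemma hspan_1: "1 \<in> hspan" using hspan_mono[of "[]"] by simp
lemma hspan_0: "0 \<in> hspan" using hspan_diff[OF hspan_1 hspan_1] by simp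
lemma hspan_minus: "a \<in> hspan \<Longrightarrow> - a \<in> hspan" using hspan_diff[OF hspan_0] by fastforce
lemma hspan_add: "a \<in> hspan \<Longrightarrow> b \<in> hspan \<Longrightarrow> a + b \<in> hspan"
  using hspan_diff[OF _ hspan_minus, of a b] by simp

lemma hspan_mult:
  assumes "a \<in> hspan" "b \<in> hspan"
  shows "a * b \<in> hspan"
  using assms(1)
proof induction
  case a: (hspan_mono as)
  show ?case using assms(2)
  proof induction
    case (hspan_mono bs)
    then show ?case using hspan.hspan_mono[of "as @ bs"] a by simp
  next
    case (hspan_diff x y)
    then show ?case using hspan.hspan_diff by (simp add: right_diff_distrib)
  qed
next
  case (hspan_diff x y)
  then show ?case using hspan.hspan_diff by (simp add: left_diff_distrib)
qed

lemma hspan_sum: "(\<And>i. i \<in> I \<Longrightarrow> f i \<in> hspan) \<Longrightarrow> sum f I \<in> hspan"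
  by (induction I rule: infinite_finite_induct) (auto intro: hspan_0 hspan_add)

lemma hspan_h: "k < n \<Longrightarrow> h k \<in> hspan"
  using hspan_mono[of "[k]"] by simp

lemma hspan_sign: "a \<in> hspan \<Longrightarrow> (-1) ^ k * a \<in> hspan"
  by (cases "even k") (auto intro: hspan_minus)

text \<open>The term \<open>i = k\<close> of \<open>e_h\<close> is \<open>e k\<close> up to sign,
  because \<open>h 0 = 1\<close>; the relation can be solved for it.\<close>

lemma hspan_e: "k < n \<Longrightarrow> e k \<in> hspan"
proof (induction k rule: less_induct)
  case (less k)
  show ?case
  proof (cases "k = 0")
    case False
    have "(\<Sum>i\<in>{..<k}. (-1) ^ i * e i * h (k - i)) + (-1) ^ k * e k = 0"
      using e_h[of k] False less.prems by (simp add: lessThan_Suc_atMost[symmetric])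
    then have "(-1) ^ k * e k = - (\<Sum>i<k. (-1) ^ i * e i * h (k - i))"
      by (simp add: eq_neg_iff_add_eq_0 add.commute)
    moreover have "(\<Sum>i<k. (-1) ^ i * e i * h (k - i)) \<in> hspan"
      using less False by (intro hspan_sum hspan_mult[OF hspan_sign] hspan_h) auto
    ultimately have "(-1) ^ k * e k \<in> hspan" using hspan_minus by simp
    then have "(-1) ^ k * ((-1) ^ k * e k) \<in> hspan" by (rule hspan_sign)
    then show ?thesis by (simp flip: mult.assoc power_add)
  qed (simp add: hspan_1)
qed

lemma hspan_prod_e: "set as \<subseteq> {..<n} \<Longrightarrow> prod_list (map e as) \<in> hspan"
  by (induction as) (auto intro: hspan_1 hspan_mult hspan_e)

end

subsection \<open>Affine permutations and codes\<close>

text \<open>HOL-Algebra claims the notation \<open>inv\<close>.\<close>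

abbreviation (input) iv :: "(int \<Rightarrow> int) \<Rightarrow> int \<Rightarrow> int" where
  "iv w \<equiv> inv_into UNIV w"

text \<open>The code as a function on all integers: periodicity then replaces the choice of a
  window.\<close>

definition code_at :: "(int \<Rightarrow> int) \<Rightarrow> int \<Rightarrow> nat" where
  "code_at x m = card {j. m < j \<and> x j < x m}"

lemma dvd_consecutive:
  fixes d x :: int
  assumes "3 \<le> d" "d dvd x"
  shows "\<not> d dvd x + 1" "\<not> d dvd x - 1" "\<not> d dvd x + 2" "\<not> d dvd x - 2"
proof -
  have "\<not> d dvd 1" "\<not> d dvd -1" "\<not> d dvd 2" "\<not> d dvd -2" using assms by (auto dest: zdvd_imp_le)
  then show "\<not> d dvd x + 1" "\<not> d dvd x - 1" "\<not> d dvd x + 2" "\<not> d dvd x - 2"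
    using dvd_diff[OF _ assms(2), of "x + 1"] dvd_diff[OF _ assms(2), of "x - 1"]
      dvd_diff[OF _ assms(2), of "x + 2"] dvd_diff[OF _ assms(2), of "x - 2"] by auto
qed

locale affine =
  fixes n :: nat
  assumes n3: "3 \<le> n"
begin

abbreviation "S \<equiv> simple_refl n"
abbreviation "AP \<equiv> affine_perms n"

lemma n3': "3 \<le> int n" using n3 by simp

section \<open>Simple reflections as maps on the integers\<close>

lemma S_eq: "S i j = (if int n dvd j - int i then j + 1 else if int n dvd j - int i - 1 then j - 1 else j)"
  unfolding simple_refl_def mod_eq_dvd_iff by (simp add: algebra_simps)

lemma S_S [simp]: "S i (S i j) = j"
proof -
  consider "int n dvd j - int i" | "int n dvd j - int i - 1" "\<not> int n dvd j - int i"
    | "\<not> int n dvd j - int i" "\<not> int n dvd j - int i - 1" by blast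
  then show ?thesis
  proof cases
    case 1
    then have "\<not> int n dvd (j + 1) - int i"
      using dvd_consecutive(1)[OF n3' 1] by (simp add: algebra_simps)
    then show ?thesis using 1 S_eq[of i j] S_eq[of i "j + 1"] by (simp add: algebra_simps)
  next
    case 2
    then have "S i j = j - 1" by (simp add: S_eq)
    moreover have "S i (j - 1) = j" using 2 by (simp add: S_eq algebra_simps)
    ultimately show ?thesis by simp
  next
    case 3
    then show ?thesis using S_eq[of i j] by simp
  qed
qed

lemma S_comp [simp]: "S i \<circ> S i = id" by (simp add: fun_eq_iff comp_apply)

lemma S_shift: "S i (j + int n) = S i j + int n"
proof -
  have "int n dvd j + int n - a \<longleftrightarrow> int n dvd j - a" for a
    by (metis add_diff_eq diff_add_eq dvd_add_triv_right_iff)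
  then show ?thesis unfolding S_eq by (simp add: diff_diff_eq)
qed

lemma S_dvd: "int n dvd S i m - (int i + 1) \<longleftrightarrow> int n dvd m - int i"
proof -
  consider "int n dvd m - int i" | "int n dvd m - int i - 1" "\<not> int n dvd m - int i"
    | "\<not> int n dvd m - int i" "\<not> int n dvd m - int i - 1" by blast
  then show ?thesis
  proof cases
    case 1
    then have "S i m = m + 1" by (simp add: S_eq)
    then show ?thesis using 1 by simp
  next
    case 2
    then have "S i m = m - 1" by (simp add: S_eq)
    then show ?thesis using 2 dvd_consecutive(2)[OF n3' 2(1)] by (simp add: diff_diff_eq)
  next
    case 3
    then have "S i m = m" by (simp add: S_eq)
    then show ?thesis using 3 by (simp add: diff_diff_eq)
  qed
qed

lemma S_less:
  assumes "a < b" "\<not> (int n dvd a - int i \<and> b = a + 1)"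
  shows "S i a < S i b"
proof -
  have "S i a \<noteq> S i b" using assms by (metis S_S less_irrefl)
  moreover have "S i a \<le> S i b"
  proof (cases "b = a + 1")
    case True
    then show ?thesis using assms unfolding S_eq by (auto simp: algebra_simps)
  next
    case False
    then show ?thesis using assms unfolding S_eq by auto
  qed
  ultimately show ?thesis by simp
qed

lemma S_less_iff:
  "S i a < S i b \<longleftrightarrow> (a < b \<and> \<not> (int n dvd a - int i \<and> b = a + 1)) \<or> (int n dvd b - int i \<and> a = b + 1)"
proof (cases a b rule: linorder_cases)
  case less
  have "\<not> S i a < S i b" if "int n dvd a - int i" "b = a + 1"
    using that dvd_consecutive[OF n3', of "a - int i"] unfolding S_eq by (auto simp: algebra_simps)
  then show ?thesis using S_less[OF less] less by auto
next
  case greater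
  have "S i a < S i b" if "int n dvd b - int i" "a = b + 1"
    using that dvd_consecutive[OF n3', of "b - int i"] unfolding S_eq by (auto simp: algebra_simps)
  then show ?thesis using S_less[OF greater, of i] greater
    by (cases "int n dvd b - int i \<and> a = b + 1") auto
qed simp

section \<open>Residue systems and closure properties of the group\<close>

definition ressys :: "int set \<Rightarrow> bool" where
  "ressys W \<longleftrightarrow> inj_on (\<lambda>i. i mod int n) W \<and> card W = n"

lemma periodic_mult:
  assumes "\<And>i. g (i + int n) = g i"
  shows "g (i + q * int n) = g i"
proof -
  have nat: "g (i + int k * int n) = g i" for i k
  proof (induction k)
    case (Suc k)
    then show ?case using assms[of "i + int k * int n"] by (simp add: algebra_simps)
  qed simp
  show ?thesis
  proof (cases "q \<ge> 0")
    case True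
    then show ?thesis using nat[of i "nat q"] by simp
  next
    case False
    then show ?thesis using nat[of "i + q * int n" "nat (- q)"] by simp
  qed
qed

lemma periodic_mod:
  assumes "\<And>i. g (i + int n) = g i"
  shows "g (i mod int n) = g i"
  using periodic_mult[of g "i mod int n" "i div int n", OF assms] by simp

text \<open>Reduction modulo \<open>n\<close> carries any residue system onto
  \<open>0, ..., n - 1\<close> without changing a periodic function. Together with
  \<open>AP_ressys\<close> this lets sums over one period be shifted and permuted by affine
  permutations.\<close>

lemma sum_ressys:
  assumes "ressys W" "\<And>i. g (i + int n) = g i"
  shows "sum g W = (\<Sum>k<n. g (int k))"
proof -
  note gmod = periodic_mod[of g, OF assms(2)]
  have "finite W" using assms n3 unfolding ressys_def by (metis card.infinite not_numeral_le_zero)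
  have im: "(\<lambda>i. i mod int n) ` W = {0..<int n}"
  proof (rule card_subset_eq)
    show "(\<lambda>i. i mod int n) ` W \<subseteq> {0..<int n}" using n3 by auto
    show "card ((\<lambda>i. i mod int n) ` W) = card {0..<int n}"
      using assms unfolding ressys_def by (simp add: card_image)
  qed simp
  have "sum g W = (\<Sum>i\<in>W. g (i mod int n))" by (simp add: gmod)
  also have "\<dots> = sum g ((\<lambda>i. i mod int n) ` W)"
    using assms unfolding ressys_def by (subst sum.reindex) auto
  also have "\<dots> = sum g (int ` {..<n})" unfolding im by (simp add: image_int_atLeastLessThan lessThan_atLeast0)
  also have "\<dots> = (\<Sum>k<n. g (int k))" by (subst sum.reindex) auto
  finally show ?thesis .
qed

lemma ressys_interval: "ressys {a..<a + int n}"
  unfolding ressys_def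
proof
  show "inj_on (\<lambda>i. i mod int n) {a..<a + int n}"
  proof (rule inj_onI)
    fix x y assume xy: "x \<in> {a..<a + int n}" "y \<in> {a..<a + int n}" "x mod int n = y mod int n"
    then have "int n dvd x - y" by (simp add: mod_eq_dvd_iff)
    then show "x = y" using xy zdvd_imp_le[of "int n" "x - y"] zdvd_imp_le[of "int n" "y - x"]
      by (cases x y rule: linorder_cases) (auto simp: dvd_diff_commute)
  qed
qed simp

lemma window_eq: "{1..int n} = {1..<1 + int n}" by auto

lemma nat_window: "int ` {..<n} = {0..<0 + int n}" by (simp add: image_int_atLeastLessThan lessThan_atLeast0)

lemma ressys_nat: "ressys (int ` {..<n})" unfolding nat_window by (rule ressys_interval)

lemma AP_iff: "w \<in> AP \<longleftrightarrow> bij w \<and> (\<forall>i. w (i + int n) = w i + int n) \<and> (\<Sum>k<n. w (int k) - int k) = 0"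
proof -
  have "(\<Sum>i\<in>{1..int n}. w i) = (\<Sum>i\<in>{1..int n}. i) \<longleftrightarrow> (\<Sum>i\<in>{1..int n}. w i - i) = 0"
    by (simp add: sum_subtractf)
  moreover have "(\<Sum>i\<in>{1..int n}. w i - i) = (\<Sum>k<n. w (int k) - int k)" if "\<forall>i. w (i + int n) = w i + int n"
    unfolding window_eq using that by (intro sum_ressys ressys_interval) simp
  ultimately show ?thesis unfolding affine_perms_def by auto
qed

lemma AP_bij: "w \<in> AP \<Longrightarrow> bij w" by (simp add: AP_iff)
lemma AP_shift: "w \<in> AP \<Longrightarrow> w (i + int n) = w i + int n" by (simp add: AP_iff)

lemma AP_shift_mult:
  assumes "w \<in> AP"
  shows "w (i + k * int n) = w i + k * int n"
proof -
  have "w (i + k * int n) - (i + k * int n) = w i - i"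
    by (rule periodic_mult[of "\<lambda>i. w i - i"]) (simp add: AP_shift[OF assms])
  then show ?thesis by simp
qed

lemma AP_ressys:
  assumes "w \<in> AP" "ressys W"
  shows "ressys (w ` W)"
  unfolding ressys_def
proof
  have inj: "inj w" using AP_bij[OF assms(1)] bij_is_inj by blast
  show "card (w ` W) = n" using assms(2) inj by (simp add: ressys_def card_image inj_on_subset)
  show "inj_on (\<lambda>i. i mod int n) (w ` W)"
  proof (rule inj_onI)
    fix x y assume "x \<in> w ` W" "y \<in> w ` W" and eq: "x mod int n = y mod int n"
    then obtain a b where ab: "a \<in> W" "b \<in> W" "x = w a" "y = w b" by blast
    obtain k where "x - y = int n * k" using eq unfolding mod_eq_dvd_iff by blast
    then have "w a = w (b + k * int n)" unfolding AP_shift_mult[OF assms(1)] by (simp add: ab algebra_simps)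
    then have "a = b + k * int n" using inj by (simp add: inj_eq)
    then have "a mod int n = b mod int n" by simp
    then show "x = y" using ab assms(2) by (auto simp: ressys_def dest: inj_onD)
  qed
qed

lemma sum_AP:
  fixes g :: "int \<Rightarrow> 'b::comm_monoid_add"
  assumes "w \<in> AP" "\<And>i. g (i + int n) = g i"
  shows "(\<Sum>k<n. g (w (int k))) = (\<Sum>k<n. g (int k))"
proof -
  have "inj w" using AP_bij[OF assms(1)] bij_is_inj by blast
  have "(\<Sum>k<n. g (w (int k))) = sum g (w ` int ` {..<n})"
    using \<open>inj w\<close> by (simp add: sum.reindex inj_on_subset)
  also have "\<dots> = (\<Sum>k<n. g (int k))"
    using assms ressys_nat by (intro sum_ressys AP_ressys)
  finally show ?thesis .
qed

lemma AP_id [simp]: "id \<in> AP" by (simp add: AP_iff)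

lemma AP_comp [simp]:
  assumes "v \<in> AP" "w \<in> AP"
  shows "v \<circ> w \<in> AP"
proof -
  have "(\<Sum>k<n. v (w (int k)) - int k) = (\<Sum>k<n. v (w (int k)) - w (int k)) + (\<Sum>k<n. w (int k) - int k)"
    by (simp flip: sum.distrib)
  also have "(\<Sum>k<n. v (w (int k)) - w (int k)) = (\<Sum>k<n. v (int k) - int k)"
    using sum_AP[OF assms(2), of "\<lambda>j. v j - j"] AP_shift[OF assms(1)] by simp
  finally show ?thesis using assms by (auto simp: AP_iff bij_comp)
qed

lemma AP_inv [simp]:
  assumes "w \<in> AP"
  shows "iv w \<in> AP"
proof -
  have b: "bij w" using AP_bij assms by blast
  have w: "iv w (w i) = i" "w (iv w i) = i" for i
    using b by (simp_all add: bij_is_inj bij_is_surj surj_f_inv_f)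
  have sh: "iv w (i + int n) = iv w i + int n" for i
    using AP_shift[OF assms, of "iv w i"] w by metis
  have "(\<Sum>k<n. iv w (int k) - int k) = (\<Sum>k<n. iv w (w (int k)) - w (int k))"
    using sum_AP[OF assms, of "\<lambda>j. iv w j - j"] sh by simp
  also have "\<dots> = - (\<Sum>k<n. w (int k) - int k)" by (simp add: w sum_negf[symmetric])
  finally show ?thesis using assms sh b by (simp add: AP_iff bij_imp_bij_inv)
qed

lemma AP_S [simp]: "S i \<in> AP"
proof -
  have "bij (S i)" by (rule o_bij[of "S i"]) simp_all
  moreover have "(\<Sum>k<n. S i (int k) - int k) = 0"
  proof -
    have "(\<Sum>k<n. S i (int k) - int k) = (\<Sum>j\<in>{int i..<int i + int n}. S i j - j)"
      by (rule sum_ressys[symmetric, OF ressys_interval]) (simp add: S_shift)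
    also have "{int i..<int i + int n} = {int i, int i + 1} \<union> {int i + 2..<int i + int n}" using n3 by auto
    also have "(\<Sum>j\<in>{int i, int i + 1} \<union> {int i + 2..<int i + int n}. S i j - j) =
        (\<Sum>j\<in>{int i, int i + 1}. S i j - j) + (\<Sum>j\<in>{int i + 2..<int i + int n}. S i j - j)"
      by (intro sum.union_disjoint) auto
    also have "(\<Sum>j\<in>{int i + 2..<int i + int n}. S i j - j) = 0"
    proof (intro sum.neutral ballI)
      fix j assume "j \<in> {int i + 2..<int i + int n}"
      then have "\<not> int n dvd j - int i" "\<not> int n dvd j - int i - 1" by (auto dest: zdvd_imp_le)
      then show "S i j - j = 0" by (simp add: S_eq)
    qed
    also have "(\<Sum>j\<in>{int i, int i + 1}. S i j - j) = 0"
      using n3 by (auto simp: S_eq)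
    finally show ?thesis by simp
  qed
  ultimately show ?thesis by (simp add: AP_iff S_shift)
qed

lemma inv_S [simp]: "iv (S i) = S i" by (rule inv_unique_comp) simp_all

lemma inv_AP_simps [simp]:
  assumes "w \<in> AP"
  shows "iv w (w j) = j" "w (iv w j) = j" "iv w \<circ> w = id" "w \<circ> iv w = id" "iv (iv w) = w"
proof -
  have b: "bij w" using AP_bij assms by blast
  then show "iv w (w j) = j" "w (iv w j) = j" "iv w \<circ> w = id" "w \<circ> iv w = id" "iv (iv w) = w"
    by (simp_all add: bij_is_inj bij_is_surj surj_f_inv_f inv_inv_eq fun_eq_iff)
qed

lemma inv_comp_AP:
  assumes "v \<in> AP" "w \<in> AP"
  shows "iv (v \<circ> w) = iv w \<circ> iv v"
  using assms AP_bij by (simp add: o_inv_distrib)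

lemma inv_S_comp: "w \<in> AP \<Longrightarrow> iv (S i \<circ> w) = iv w \<circ> S i"
  by (subst inv_comp_AP) auto

lemma AP_bounded:
  assumes "x \<in> AP"
  obtains K where "\<And>j. \<bar>x j - j\<bar> \<le> K"
proof -
  let ?K = "\<Sum>k<n. \<bar>x (int k) - int k\<bar>"
  have "\<bar>x j - j\<bar> \<le> ?K" for j
  proof -
    define r where "r = j mod int n"
    have r: "0 \<le> r" "r < int n" using n3 by (simp_all add: r_def)
    have j: "j = r + (j div int n) * int n" by (simp add: r_def)
    have "x j - j = x r - r" using AP_shift_mult[OF assms, of r "j div int n"] j by simp
    moreover have "\<bar>x (int (nat r)) - int (nat r)\<bar> \<le> ?K"
      using r by (intro member_le_sum) auto
    ultimately show ?thesis using r by simp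
  qed
  then show ?thesis using that by blast
qed

section \<open>Codes and inversions\<close>

lemma finite_code:
  assumes "x \<in> AP"
  shows "finite {j. m < j \<and> x j < x m}"
proof -
  obtain K where K: "\<And>j. \<bar>x j - j\<bar> \<le> K" using AP_bounded[OF assms] by metis
  have "{j. m < j \<and> x j < x m} \<subseteq> {m..x m + K}"
  proof
    fix j assume "j \<in> {j. m < j \<and> x j < x m}"
    then show "j \<in> {m..x m + K}" using K[of j] by auto
  qed
  then show ?thesis by (rule finite_subset) simp
qed

lemma code_at_shift:
  assumes "x \<in> AP"
  shows "code_at x (m + int n) = code_at x m"
proof -
  have "{j. m + int n < j \<and> x j < x (m + int n)} = (\<lambda>j. j + int n) ` {j. m < j \<and> x j < x m}"
  proof (intro equalityI subsetI)
    fix j assume "j \<in> {j. m + int n < j \<and> x j < x (m + int n)}"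
    then have "j - int n \<in> {j. m < j \<and> x j < x m}"
      using AP_shift[OF assms, of "j - int n"] AP_shift[OF assms, of m] by auto
    then show "j \<in> (\<lambda>j. j + int n) ` {j. m < j \<and> x j < x m}" by (rule rev_image_eqI) simp
  qed (auto simp: AP_shift[OF assms])
  then show ?thesis unfolding code_at_def by (simp add: card_image)
qed

text \<open>An ascent turns into a descent: the two entries of the code trade places, and the new
  inversion is counted at its left position.\<close>

lemma code_at_S:
  assumes "x \<in> AP" "x (int i) < x (int i + 1)"
  shows "code_at (x \<circ> S i) m = code_at x (S i m) + (if int n dvd m - int i then 1 else 0)"
proof -
  have asc: "x a < x (a + 1)" if "int n dvd a - int i" for a
  proof -
    obtain k where "a - int i = int n * k" using \<open>int n dvd a - int i\<close> by blast
    then have a: "a = int i + k * int n" "a + 1 = int i + 1 + k * int n" by (simp_all add: algebra_simps)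
    have "x a = x (int i) + k * int n" "x (a + 1) = x (int i + 1) + k * int n"
      unfolding a(2) AP_shift_mult[OF assms(1)] unfolding a(1) AP_shift_mult[OF assms(1)] by (rule refl)+
    then show ?thesis using assms(2) by simp
  qed
  define M where "M = S i m"
  have m: "m = S i M" by (simp add: M_def)
  have "bij_betw (S i) {j. m < j \<and> x (S i j) < x (S i m)} {j. S i M < S i j \<and> x j < x M}"
    by (rule bij_betw_byWitness[of _ "S i"]) (auto simp: m)
  then have c: "code_at (x \<circ> S i) m = card {j. S i M < S i j \<and> x j < x M}"
    unfolding code_at_def by (simp add: bij_betw_same_card)
  show ?thesis
  proof (cases "int n dvd m - int i")
    case True
    then have M: "M = m + 1" by (simp add: M_def S_eq)
    have nd: "\<not> int n dvd M - int i"
      using dvd_consecutive(1)[OF n3' True] by (simp add: M algebra_simps)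
    have "{j. S i M < S i j \<and> x j < x M} = insert m {j. M < j \<and> x j < x M}"
      unfolding S_less_iff using nd True asc[OF True] M by auto
    then show ?thesis unfolding c using True finite_code[OF assms(1), of M]
      by (simp add: code_at_def M_def[symmetric]) (simp add: M card_insert_if)
  next
    case False
    have "{j. S i M < S i j \<and> x j < x M} = {j. M < j \<and> x j < x M}"
    proof -
      have "\<not> (int n dvd j - int i \<and> M = j + 1)" for j
      proof
        assume j: "int n dvd j - int i \<and> M = j + 1"
        then have "S i M = j" using dvd_consecutive(1)[OF n3', of "j - int i"] unfolding S_eq by (auto simp: algebra_simps)
        then show False using False j m by simp
      qed
      moreover have "\<not> x (M + 1) < x M" if "int n dvd M - int i" using asc[OF that] by simp
      ultimately show ?thesis unfolding S_less_iff by auto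
    qed
    then show ?thesis unfolding c using False by (simp add: code_at_def M_def)
  qed
qed

lemma code_at_mono:
  assumes "x \<in> AP" "x i < x (i + 1)"
  shows "code_at x i \<le> code_at x (i + 1)"
  unfolding code_at_def
proof (rule card_mono[OF finite_code[OF assms(1)]])
  show "{j. i < j \<and> x j < x i} \<subseteq> {j. i + 1 < j \<and> x j < x (i + 1)}"
  proof
    fix j assume j: "j \<in> {j. i < j \<and> x j < x i}"
    then have "j \<noteq> i + 1" using assms(2) by auto
    then show "j \<in> {j. i + 1 < j \<and> x j < x (i + 1)}" using j assms(2) by auto
  qed
qed

lemma AP_neq: "x \<in> AP \<Longrightarrow> i \<noteq> j \<Longrightarrow> x i \<noteq> x j"
  using AP_bij bij_is_inj by (metis inj_eq)

lemma code_descent: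
  assumes "x \<in> AP" "code_at x (i + 1) < code_at x i"
  shows "x (i + 1) < x i"
  using code_at_mono[OF assms(1), of i] AP_neq[OF assms(1), of i "i + 1"] assms(2) by fastforce

definition ell :: "(int \<Rightarrow> int) \<Rightarrow> nat" where
  "ell x = (\<Sum>k<n. code_at x (int k))"

lemma ell_S:
  assumes "x \<in> AP" "x (int i) < x (int i + 1)"
  shows "ell (x \<circ> S i) = Suc (ell x)"
proof -
  have "ell (x \<circ> S i) = (\<Sum>k<n. code_at x (S i (int k))) + (\<Sum>k<n. if int n dvd int k - int i then 1 else 0)"
    unfolding ell_def code_at_S[OF assms] by (simp add: sum.distrib)
  also have "(\<Sum>k<n. code_at x (S i (int k))) = ell x"
    unfolding ell_def by (rule sum_AP[OF AP_S]) (rule code_at_shift[OF assms(1)])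
  also have "(\<Sum>k<n. if int n dvd int k - int i then 1 else 0) = (\<Sum>k<n. if k = i mod n then 1 else (0::nat))"
  proof (intro sum.cong refl)
    fix k assume "k \<in> {..<n}"
    then have "int n dvd int k - int i \<longleftrightarrow> k = i mod n"
      unfolding mod_eq_dvd_iff[symmetric] by (metis lessThan_iff mod_less of_nat_eq_iff of_nat_mod)
    then show "(if int n dvd int k - int i then 1 else 0) = (if k = i mod n then 1 else (0::nat))" by simp
  qed
  also have "\<dots> = 1" using n3 by simp
  finally have "ell (x \<circ> S i) = ell x + 1" .
  then show ?thesis by linarith
qed

lemma ell_S_desc:
  assumes "x \<in> AP" "x (int i + 1) < x (int i)"
  shows "ell x = Suc (ell (x \<circ> S i))"
proof -
  have "S i (int i) = int i + 1" "S i (int i + 1) = int i" using n3 by (auto simp: S_eq)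
  then have asc: "(x \<circ> S i) (int i) < (x \<circ> S i) (int i + 1)" using assms(2) by simp
  have "(x \<circ> S i) \<circ> S i = x" by (simp add: fun_eq_iff)
  then show ?thesis using ell_S[OF AP_comp[OF assms(1) AP_S] asc] by (simp only:)
qed

lemma S_ascent_iff:
  assumes "x \<in> AP"
  shows "ell (x \<circ> S i) = Suc (ell x) \<longleftrightarrow> x (int i) < x (int i + 1)"
    "ell x = Suc (ell (x \<circ> S i)) \<longleftrightarrow> x (int i + 1) < x (int i)"
    "ell (x \<circ> S i) \<le> Suc (ell x)"
proof -
  have "x (int i) \<noteq> x (int i + 1)" using AP_neq[OF assms] by simp
  then consider "x (int i) < x (int i + 1)" | "x (int i + 1) < x (int i)" by linarith
  then have *: "x (int i) < x (int i + 1) \<and> ell (x \<circ> S i) = Suc (ell x) \<or> x (int i + 1) < x (int i) \<and> ell x = Suc (ell (x \<circ> S i))"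
    using ell_S[OF assms, of i] ell_S_desc[OF assms, of i] by cases auto
  then show "ell (x \<circ> S i) = Suc (ell x) \<longleftrightarrow> x (int i) < x (int i + 1)"
    "ell x = Suc (ell (x \<circ> S i)) \<longleftrightarrow> x (int i + 1) < x (int i)"
    "ell (x \<circ> S i) \<le> Suc (ell x)" by auto
qed

lemma code_at_mod: "x \<in> AP \<Longrightarrow> code_at x (m mod int n) = code_at x m"
  by (rule periodic_mod) (rule code_at_shift)

text \<open>Where \<open>x\<close> attains its minimum over the nonnegative integers, nothing
  smaller stands to the right.\<close>

lemma code_zero_exists:
  assumes "x \<in> AP"
  shows "\<exists>i<n. code_at x (int i) = 0"
proof -
  obtain K where K: "\<And>j. \<bar>x j - j\<bar> \<le> K" using AP_bounded[OF assms] by metis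
  \<comment> \<open>On nonnegative positions \<open>x\<close> is at least \<open>- K\<close>, so
    \<open>nat\<close> truncates nothing.\<close>
  obtain j where j: "0 \<le> j" "\<And>j'. 0 \<le> j' \<Longrightarrow> nat (x j + K) \<le> nat (x j' + K)"
    using ex_has_least_nat[of "\<lambda>j. 0 \<le> j" 0 "\<lambda>j. nat (x j + K)"] by auto
  have "x j \<le> x j'" if "0 \<le> j'" for j'
    using j(2)[OF that] K[of j] K[of j'] that j(1) by (auto simp: abs_le_iff)
  then have "\<not> (j < j' \<and> x j' < x j)" for j' using j(1) by (meson less_imp_le not_less order_trans)
  then have "{j'. j < j' \<and> x j' < x j} = {}" by blast
  then have "code_at x j = 0" unfolding code_at_def by (simp only: card.empty)
  then have "code_at x (int (nat (j mod int n))) = 0" using code_at_mod[OF assms] n3 by simp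
  moreover have "nat (j mod int n) < n" using n3 by (simp add: nat_less_iff)
  ultimately show ?thesis by blast
qed

lemma res_eq:
  assumes "i < n" "j < n"
  shows "int n dvd int j - int i \<longleftrightarrow> j = i" "int n dvd int j - int i - 1 \<longleftrightarrow> j = Suc i mod n"
proof -
  have *: "int n dvd int j - int k \<longleftrightarrow> j = k mod n" for k
  proof -
    have "int n dvd int j - int k \<longleftrightarrow> int (j mod n) = int (k mod n)"
      unfolding mod_eq_dvd_iff[symmetric] by (simp add: of_nat_mod)
    then show ?thesis using assms by simp
  qed
  show "int n dvd int j - int i \<longleftrightarrow> j = i" using *[of i] assms by simp
  show "int n dvd int j - int i - 1 \<longleftrightarrow> j = Suc i mod n" using *[of "Suc i"] by (simp add: algebra_simps)
qed

lemma periodic_dvd: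
  assumes "\<And>i. g (i + int n) = g i" "int n dvd a - b"
  shows "g a = g b"
proof -
  obtain k where "a - b = int n * k" using assms(2) by blast
  then have "a = b + k * int n" by (simp add: algebra_simps)
  then show ?thesis using periodic_mult[of g b k, OF assms(1)] by simp
qed

text \<open>Walk right from a positive entry to the first zero. Periodicity ensures that a zero lies
  ahead and moves the position found back into \<open>0, ..., n - 1\<close>.\<close>

lemma periodic_descent:
  fixes g :: "int \<Rightarrow> nat"
  assumes per: "\<And>i. g (i + int n) = g i" and "g z = 0" "0 < g p"
  shows "\<exists>i<n. 0 < g (int i) \<and> g (int i + 1) = 0"
proof -
  have "g (z + \<bar>p - z\<bar> * int n) = 0" using periodic_mult[of g, OF per] assms(2) by simp
  moreover have "p \<le> z + \<bar>p - z\<bar> * int n"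
  proof -
    have "\<bar>p - z\<bar> * 1 \<le> \<bar>p - z\<bar> * int n" using n3 by (intro mult_left_mono) auto
    then have "\<bar>p - z\<bar> \<le> \<bar>p - z\<bar> * int n" by simp
    then show ?thesis by linarith
  qed
  ultimately have ex: "\<exists>k. g (p + int k) = 0" by (metis zle_iff_zadd)
  define k where "k = (LEAST k. g (p + int k) = 0)"
  have k: "g (p + int k) = 0" unfolding k_def using ex by (rule LeastI_ex)
  then obtain l where l: "k = Suc l" using assms(3) by (cases k) auto
  have "0 < g (p + int l)" using not_less_Least[of l "\<lambda>k. g (p + int k) = 0"] l by (simp add: k_def[symmetric])
  define a where "a = p + int l"
  have a: "0 < g a" "g (a + 1) = 0" using \<open>0 < g (p + int l)\<close> k l by (simp_all add: a_def algebra_simps)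
  define i where "i = nat (a mod int n)"
  have i: "int i = a mod int n" "i < n" using n3 by (simp_all add: i_def nat_less_iff)
  have "int n dvd int i - a" "int n dvd (int i + 1) - (a + 1)"
    unfolding i(1) using dvd_minus_mod[of "int n" a] by (simp_all add: dvd_diff_commute)
  then have "g (int i) = g a" "g (int i + 1) = g (a + 1)" using periodic_dvd[of g, OF per] by metis+
  then show ?thesis using a i(2) by auto
qed

lemma ell_eq_0:
  assumes "x \<in> AP"
  shows "ell x = 0 \<longleftrightarrow> (\<forall>m. code_at x m = 0)"
proof
  assume "ell x = 0"
  then have z: "code_at x (int k) = 0" if "k < n" for k using that by (simp add: ell_def)
  show "\<forall>m. code_at x m = 0"
  proof
    fix m
    have "nat (m mod int n) < n" "int (nat (m mod int n)) = m mod int n" using n3 by (simp_all add: nat_less_iff)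
    then show "code_at x m = 0" using z code_at_mod[OF assms, of m] by metis
  qed
qed (simp add: ell_def)

lemma descent_exists:
  assumes "x \<in> AP" "ell x \<noteq> 0"
  shows "\<exists>i<n. 0 < code_at x (int i) \<and> code_at x (int i + 1) = 0"
proof -
  obtain z where "code_at x (int z) = 0" using code_zero_exists[OF assms(1)] by blast
  moreover obtain p where "0 < code_at x p" using assms ell_eq_0[OF assms(1)] by auto
  ultimately show ?thesis using periodic_descent[of "code_at x"] code_at_shift[OF assms(1)] by blast
qed

text \<open>Without inversions \<open>x\<close> is increasing, so \<open>x i - i\<close> is weakly
  increasing and periodic, hence constant. The normalization of the sum makes the constant
  0.\<close>

lemma AP_code_0:
  assumes "x \<in> AP" "\<And>m. code_at x m = 0"
  shows "x = id"
proof -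
  have asc: "x i < x (i + 1)" for i
  proof (rule ccontr)
    assume "\<not> x i < x (i + 1)"
    then have "x (i + 1) < x i" using AP_neq[OF assms(1), of i "i + 1"] by simp
    then have "i + 1 \<in> {j. i < j \<and> x j < x i}" by simp
    then show False using assms(2)[of i] finite_code[OF assms(1), of i] unfolding code_at_def
      by (simp only: card_0_eq empty_iff)
  qed
  define d where "d i = x i - i" for i
  have step: "d i \<le> d (i + int k)" for i k
  proof (induction k)
    case (Suc k)
    then show ?case using asc[of "i + int k"] by (simp add: d_def algebra_simps)
  qed simp
  have per: "d (i + q * int n) = d i" for i q
    by (simp add: d_def AP_shift_mult[OF assms(1)])
  have mono: "d i \<le> d j" if "i \<le> j" for i j using step[of i "nat (j - i)"] that by simp
  have const: "d i = d 0" for i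
  proof -
    have "\<bar>i\<bar> * 1 \<le> \<bar>i\<bar> * int n" using n3 by (intro mult_left_mono) auto
    then have "i \<le> 0 + \<bar>i\<bar> * int n" "0 + (- \<bar>i\<bar>) * int n \<le> i" by linarith+
    then show ?thesis using mono per by (metis order_antisym)
  qed
  have "(\<Sum>k<n. d (int k)) = 0" using assms(1) by (simp add: AP_iff d_def)
  moreover have "(\<Sum>k<n. d (int k)) = (\<Sum>k<n. d 0)" by (rule sum.cong[OF refl]) (rule const)
  ultimately have "int n * d 0 = 0" by simp
  then have "d i = 0" for i using n3 const[of i] by simp
  then show ?thesis by (auto simp: d_def fun_eq_iff)
qed

section \<open>Words and length\<close>

definition prodw :: "nat list \<Rightarrow> int \<Rightarrow> int" where
  "prodw is = foldr (\<lambda>i v. S i \<circ> v) is id"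

lemma prodw_simps [simp]: "prodw [] = id" "prodw (i # is) = S i \<circ> prodw is"
  by (simp_all add: prodw_def)

lemma prodw_AP [simp]: "prodw is \<in> AP"
  by (induction "is") (simp_all only: prodw_simps AP_id AP_comp AP_S)

lemma prodw_append: "prodw (is @ js) = prodw is \<circ> prodw js"
  by (induction "is") (simp_all add: comp_assoc)

lemma prodw_Cons_comp: "prodw (i # is) \<circ> w = S i \<circ> (prodw is \<circ> w)"
  by (simp only: prodw_simps comp_assoc)

lemma inv_prodw: "iv (prodw is) = prodw (rev is)"
proof (induction "is")
  case Nil
  show ?case by (simp only: prodw_simps rev.simps inv_id)
next
  case (Cons i "is")
  have "iv (prodw (i # is)) = prodw (rev is) \<circ> S i"
    by (simp only: prodw_simps inv_S_comp[OF prodw_AP] Cons)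
  then show ?case by (simp only: prodw_append prodw_simps rev.simps comp_id)
qed

definition "len w = ell (iv w)"

lemma len_S:
  assumes "w \<in> AP"
  shows "len (S i \<circ> w) = Suc (len w) \<or> len w = Suc (len (S i \<circ> w))"
  unfolding len_def inv_S_comp[OF assms]
  using S_ascent_iff(1,2)[of "iv w" i] AP_neq[of "iv w" "int i" "int i + 1"] assms by fastforce

lemma len_S_iff:
  assumes "w \<in> AP"
  shows "len (S i \<circ> w) = Suc (len w) \<longleftrightarrow> iv w (int i) < iv w (int i + 1)"
    "len w = Suc (len (S i \<circ> w)) \<longleftrightarrow> iv w (int i + 1) < iv w (int i)"
  unfolding len_def inv_S_comp[OF assms] using S_ascent_iff[OF AP_inv[OF assms]] by auto

lemma len_prodw_comp:
  assumes "w \<in> AP"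
  shows "len (prodw is \<circ> w) \<le> length is + len w"
proof (induction "is")
  case (Cons i "is")
  show ?case using len_S[OF AP_comp[OF prodw_AP assms], of i "is"] Cons
    unfolding prodw_Cons_comp list.size by linarith
next
  case Nil
  show ?case unfolding prodw_simps id_comp list.size by linarith
qed

lemma len_id [simp]: "len id = 0"
proof -
  have "code_at id m = 0" for m by (simp add: code_at_def)
  then show ?thesis unfolding len_def ell_def inv_id by (simp only: sum.neutral_const)
qed

lemma len_0: "w \<in> AP \<Longrightarrow> len w = 0 \<longleftrightarrow> w = id"
proof -
  assume w: "w \<in> AP"
  have "w = id" if "len w = 0"
  proof -
    have "iv w = id" using that ell_eq_0[of "iv w"] AP_code_0[of "iv w"] w unfolding len_def by simp
    then show "w = id" by (metis inv_AP_simps(5)[OF w] inv_id)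
  qed
  moreover have "len w = 0" if "w = id" unfolding that by (rule len_id)
  ultimately show "len w = 0 \<longleftrightarrow> w = id" by (rule iffI)
qed

lemma reduced_word_exists:
  "w \<in> AP \<Longrightarrow> \<exists>is. set is \<subseteq> {..<n} \<and> length is = len w \<and> w = prodw is"
proof (induction "len w" arbitrary: w)
  case 0
  then have "w = prodw []" unfolding prodw_simps using len_0 by metis
  moreover have "length [] = len w" using 0 by simp
  ultimately show ?case by (metis empty_subsetI list.set(1))
next
  case (Suc k)
  have x: "iv w \<in> AP" using Suc by simp
  obtain i where i: "i < n" "0 < code_at (iv w) (int i)" "code_at (iv w) (int i + 1) = 0"
    using descent_exists[OF x] Suc.hyps(2) by (auto simp: len_def)
  then have "len w = Suc (len (S i \<circ> w))"
    using len_S_iff(2)[OF Suc.prems, of i] code_descent[OF x, of "int i"] by simp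
  then obtain "is" where "is": "set is \<subseteq> {..<n}" "length is = len (S i \<circ> w)" "S i \<circ> w = prodw is"
    using Suc.hyps(1)[of "S i \<circ> w"] Suc.hyps(2) Suc.prems by auto
  have "w = S i \<circ> (S i \<circ> w)" by (simp add: fun_eq_iff comp_apply)
  then have "w = prodw (i # is)" using "is" by simp
  then show ?case using "is" i \<open>len w = Suc (len (S i \<circ> w))\<close> by (intro exI[of _ "i # is"]) simp
qed

text \<open>Each letter changes \<open>len\<close> by exactly one, so no word for \<open>w\<close>
  is shorter than \<open>len w\<close>; removing descents produces a word of that length.\<close>

theorem coxeter_length_eq: "w \<in> AP \<Longrightarrow> coxeter_length n w = len w"
  unfolding coxeter_length_def prodw_def[symmetric]
proof (rule Least_equality)
  assume "w \<in> AP"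
  then show "\<exists>is. length is = len w \<and> set is \<subseteq> {..<n} \<and> w = prodw is"
    using reduced_word_exists by metis
  fix k assume "\<exists>is. length is = k \<and> set is \<subseteq> {..<n} \<and> w = prodw is"
  then show "len w \<le> k" using len_prodw_comp[OF AP_id] by fastforce
qed

lemma len_inv:
  assumes "w \<in> AP"
  shows "len (iv w) = len w"
proof -
  have le: "len (iv w) \<le> len w" if w: "w \<in> AP" for w
  proof -
    obtain "is" where "is": "length is = len w" "w = prodw is" using reduced_word_exists[OF w] by blast
    then have "iv w = prodw (rev is)" by (simp add: inv_prodw)
    then show ?thesis using len_prodw_comp[OF AP_id, of "rev is"] "is" by simp
  qed
  show ?thesis using le[OF assms] le[OF AP_inv[OF assms]] assms by simp
qed

text \<open>A positive entry followed by 0 is a descent visible in the code alone. Removing it from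
  both elements changes both codes in the same way.\<close>

lemma code_inj:
  "\<lbrakk>x \<in> AP; y \<in> AP; \<And>m. code_at x m = code_at y m\<rbrakk> \<Longrightarrow> x = y"
proof (induction "ell x" arbitrary: x y)
  case 0
  then have "\<And>m. code_at x m = 0" using ell_eq_0 by metis
  then show ?case using 0 AP_code_0 by metis
next
  case (Suc k)
  obtain i where i: "i < n" "0 < code_at x (int i)" "code_at x (int i + 1) = 0"
    using descent_exists[OF Suc.prems(1)] Suc.hyps(2) by auto
  have new: "z \<circ> S i \<in> AP \<and> ell z = Suc (ell (z \<circ> S i)) \<and>
      (\<forall>m. code_at (z \<circ> S i) m = code_at x (S i m) - (if int n dvd S i m - int i then 1 else 0))"
    if z: "z \<in> AP" "\<And>m. code_at z m = code_at x m" for z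
  proof -
    have d: "z (int i + 1) < z (int i)" using code_descent[OF z(1), of "int i"] i z(2) by simp
    have a: "(z \<circ> S i) (int i) < (z \<circ> S i) (int i + 1)" using d n3 by (simp add: S_eq)
    have "(z \<circ> S i) \<circ> S i = z" by (simp add: fun_eq_iff comp_apply)
    then have "code_at z m = code_at (z \<circ> S i) (S i m) + (if int n dvd m - int i then 1 else 0)" for m
      using code_at_S[of "z \<circ> S i" i m, OF _ a] z(1) by (simp only: AP_comp AP_S simp_thms)
    from this[of "S i m" for m] have "code_at (z \<circ> S i) m = code_at x (S i m) - (if int n dvd S i m - int i then 1 else 0)" for m
      using z(2) by simp
    then show ?thesis using z(1) ell_S_desc[OF z(1) d] by simp
  qed
  have "x \<circ> S i = y \<circ> S i"
    using new[OF Suc.prems(1)] new[OF Suc.prems(2)] Suc.prems(3) Suc.hyps by (intro Suc.hyps(1)) auto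
  then have "x \<circ> S i \<circ> S i = y \<circ> S i \<circ> S i" by simp
  then show ?case by (simp add: comp_assoc)
qed

text \<open>A pair \<open>c, 0\<close> of consecutive entries with \<open>c > 0\<close> is replaced
  by \<open>0, c - 1\<close>. This lowers the sum and keeps a zero, and multiplying by
  \<open>S i\<close> undoes it by \<open>code_at_S\<close>.\<close>

lemma code_surj:
  fixes g :: "int \<Rightarrow> nat"
  assumes "\<And>i. g (i + int n) = g i" "g z = 0"
  shows "\<exists>x\<in>AP. \<forall>m. code_at x m = g m"
  using assms
proof (induction "\<Sum>k<n. g (int k)" arbitrary: g z rule: less_induct)
  case less
  show ?case
  proof (cases "\<forall>m. g m = 0")
    case True
    then show ?thesis by (intro bexI[of _ id]) (auto simp: code_at_def)
  next
    case False
    then obtain p where "0 < g p" by auto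
    then obtain i where i: "i < n" "0 < g (int i)" "g (int i + 1) = 0"
      using periodic_descent[of g z p] less.prems by blast
    define g' where "g' m = g (S i m) - (if int n dvd m - (int i + 1) then 1 else 0)" for m
    have per: "g' (m + int n) = g' m" for m
    proof -
      have "int n dvd m + int n - (int i + 1) \<longleftrightarrow> int n dvd m - (int i + 1)"
        by (metis add_diff_eq diff_add_eq dvd_add_triv_right_iff)
      then show ?thesis unfolding g'_def S_shift less.prems(1) by simp
    qed
    have Si: "S i (int i) = int i + 1" "S i (int i + 1) = int i" using n3 by (simp_all add: S_eq)
    have z': "g' (int i) = 0" using i Si by (simp add: g'_def)
    have "(\<Sum>k<n. g' (int k)) < (\<Sum>k<n. g (S i (int k)))"
    proof (rule sum_strict_mono_ex1)
      have "Suc i mod n < n" using n3 by simp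
      moreover have "int n dvd int (Suc i mod n) - (int i + 1)"
        using dvd_minus_mod[of "int n" "int i + 1"] by (simp add: of_nat_mod dvd_diff_commute add.commute)
      moreover have "g (S i (int (Suc i mod n))) = g (S i (int i + 1))"
        by (rule periodic_dvd[of "\<lambda>m. g (S i m)", OF _ \<open>int n dvd int (Suc i mod n) - (int i + 1)\<close>])
          (simp add: S_shift less.prems(1))
      ultimately show "\<exists>k\<in>{..<n}. g' (int k) < g (S i (int k))"
        using i(2) Si by (intro bexI[of _ "Suc i mod n"]) (simp_all add: g'_def)
    qed (auto simp: g'_def)
    also have "\<dots> = (\<Sum>k<n. g (int k))" by (rule sum_AP[OF AP_S]) (rule less.prems(1))
    finally obtain x where x: "x \<in> AP" "\<And>m. code_at x m = g' m"
      using less.hyps[of g' "int i"] per z' by blast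
    have asc: "x (int i) < x (int i + 1)"
    proof (rule ccontr)
      assume "\<not> x (int i) < x (int i + 1)"
      then have "x (int i + 1) < x (int i)" using AP_neq[OF x(1), of "int i" "int i + 1"] by simp
      then have "int i + 1 \<in> {j. int i < j \<and> x j < x (int i)}" by simp
      moreover have "card {j. int i < j \<and> x j < x (int i)} = 0" using x(2)[of "int i"] z' by (simp only: code_at_def)
      ultimately show False using finite_code[OF x(1), of "int i"] by (simp only: card_0_eq empty_iff)
    qed
    have "code_at (x \<circ> S i) m = g m" for m
    proof -
      have "int n dvd S i m - (int i + 1) \<longleftrightarrow> int n dvd m - int i" by (rule S_dvd)
      moreover have "0 < g m" if "int n dvd m - int i"
        using periodic_dvd[of g, OF less.prems(1) that] i by simp
      ultimately show ?thesis unfolding code_at_S[OF x(1) asc] x(2) g'_def by auto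
    qed
    then show ?thesis using x(1) by (intro bexI[of _ "x \<circ> S i"]) auto
  qed
qed

section \<open>Codes under cyclically decreasing products\<close>

definition inA :: "int \<Rightarrow> nat set \<Rightarrow> bool" where
  "inA m A \<longleftrightarrow> nat (m mod int n) \<in> A"

lemma inA_insert:
  assumes "i < n"
  shows "inA m (insert i A) \<longleftrightarrow> int n dvd m - int i \<or> inA m A"
proof -
  have "nat (m mod int n) = i \<longleftrightarrow> m mod int n = int i mod int n"
    using assms n3 by auto
  then show ?thesis by (auto simp: inA_def mod_eq_dvd_iff)
qed

lemma inA_cong: "int n dvd m - m' \<Longrightarrow> inA m A = inA m' A"
  by (simp add: inA_def mod_eq_dvd_iff[symmetric])

lemma inA_nat [simp]: "i < n \<Longrightarrow> inA (int i) A \<longleftrightarrow> i \<in> A"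
  by (simp add: inA_def)

lemma inA_Suc: "inA (int i + 1) A \<longleftrightarrow> Suc i mod n \<in> A"
  by (simp add: inA_def nat_mod_distrib) (simp add: nat_mod_as_int add.commute)

text \<open>Up to permutation, the code is thus a sum of 0-1 vectors, one for each cyclically decreasing
  factor; this is the source of the dominance bound.\<close>

lemma code_dec_word:
  assumes "dec_word n is" "set is \<subseteq> {..<n}" "w \<in> AP" "len (prodw is \<circ> w) = length is + len w"
  shows "code_at (iv (prodw is \<circ> w)) m = code_at (iv w) (iv (prodw is) m) + (if inA m (set is) then 1 else 0)"
  using assms
proof (induction "is" arbitrary: m)
  case Nil
  show ?case unfolding prodw_simps id_comp inv_id id_apply by (simp add: inA_def)
next
  case (Cons i "is")
  let ?v = "prodw is \<circ> w"
  have v: "?v \<in> AP" using Cons by simp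
  have len: "len ?v = length is + len w" "len (S i \<circ> ?v) = Suc (len ?v)"
    using Cons.prems(4) len_prodw_comp[OF Cons.prems(3), of "is"] len_S[OF v, of i]
    unfolding prodw_Cons_comp list.size by linarith+
  have IH: "code_at (iv ?v) m = code_at (iv w) (iv (prodw is) m) + (if inA m (set is) then 1 else 0)" for m
    by (rule Cons.IH[OF _ _ Cons.prems(3) len(1)]) (use Cons.prems(1,2) in \<open>auto simp: dec_word_def\<close>)
  have asc: "iv ?v (int i) < iv ?v (int i + 1)" using len_S_iff(1)[OF v] len by simp
  have i: "i < n" "i \<notin> set is" "Suc i mod n \<notin> set is" using Cons.prems by (auto simp: dec_word_def)
  have "code_at (iv (prodw (i # is) \<circ> w)) m = code_at (iv ?v \<circ> S i) m"
    unfolding prodw_Cons_comp inv_S_comp[OF v] ..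
  also have "\<dots> = code_at (iv ?v) (S i m) + (if int n dvd m - int i then 1 else 0)"
    by (rule code_at_S[OF AP_inv[OF v] asc])
  also have "\<dots> = code_at (iv w) (iv (prodw is) (S i m)) +
     ((if inA (S i m) (set is) then 1 else 0) + (if int n dvd m - int i then 1 else 0))"
    by (simp add: IH)
  \<comment> \<open>Neither \<open>i\<close> nor its successor occurs in \<open>is\<close>, so
    \<open>S i\<close> does not move the marked positions, and the residue of \<open>i\<close> is
    newly marked.\<close>
  also have "(if inA (S i m) (set is) then 1 else 0) + (if int n dvd m - int i then 1 else 0) =
     (if inA m (set (i # is)) then 1 else (0::nat))"
  proof -
    consider "int n dvd m - int i" | "int n dvd m - int i - 1" "\<not> int n dvd m - int i"
      | "\<not> int n dvd m - int i" "\<not> int n dvd m - int i - 1" by blast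
    then show ?thesis
    proof cases
      case 1
      then have "S i m = m + 1" by (simp add: S_eq)
      then have "inA (S i m) (set is) = inA (int i + 1) (set is)" using 1 by (intro inA_cong) simp
      then show ?thesis using 1 i by (simp add: inA_insert inA_Suc)
    next
      case 2
      then have "S i m = m - 1" by (simp add: S_eq)
      moreover have "m - 1 - int i = m - int i - 1" by simp
      ultimately have "int n dvd S i m - int i" using 2(1) by (simp only:)
      then have "inA (S i m) (set is) = inA (int i) (set is)" by (rule inA_cong)
      moreover have "inA m (set is) = inA (int i + 1) (set is)" using 2(1) by (intro inA_cong) (simp add: diff_diff_eq)
      ultimately show ?thesis using 2 i by (simp add: inA_insert inA_Suc)
    next
      case 3
      then show ?thesis using i by (simp add: inA_insert S_eq)
    qed
  qed
  also have "iv (prodw is) (S i m) = iv (prodw (i # is)) m"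
    unfolding prodw_simps inv_S_comp[OF prodw_AP] comp_apply ..
  finally show ?case .
qed

text \<open>Letters are removed in word order. A letter \<open>i\<close> can go when its entry is
  positive and the next one is 0; its removal leaves 0 at position \<open>i\<close>, which is what
  the predecessor of \<open>i\<close> requires when its turn comes.\<close>

lemma peel_dec_word:
  assumes "dec_word n is" "set is \<subseteq> {..<n}" "w \<in> AP"
    and "\<And>i. i \<in> set is \<Longrightarrow> 0 < code_at (iv w) (int i)"
    and "\<And>i. i \<in> set is \<Longrightarrow> Suc i mod n \<in> set is \<or> code_at (iv w) (int i + 1) = 0"
  shows "len w = length is + len (prodw (rev is) \<circ> w)"
  using assms
proof (induction "is" arbitrary: w)
  case (Cons i "is")
  let ?x = "iv w"
  have x: "?x \<in> AP" using Cons by simp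
  have i: "i < n" "i \<notin> set is" "Suc i mod n \<notin> set is" using Cons.prems by (auto simp: dec_word_def)
  then have "Suc i mod n \<notin> set (i # is)" using Suc_mod_neq[of n i] n3 by auto
  then have ci: "0 < code_at ?x (int i)" "code_at ?x (int i + 1) = 0" using Cons.prems(4,5)[of i] by auto
  then have d: "?x (int i + 1) < ?x (int i)" using code_descent[OF x, of "int i"] by simp
  have len: "len w = Suc (len (S i \<circ> w))" using len_S_iff(2)[OF Cons.prems(3)] d by simp
  have a: "(?x \<circ> S i) (int i) < (?x \<circ> S i) (int i + 1)" using d n3 by (simp add: S_eq)
  have e: "(?x \<circ> S i) \<circ> S i = ?x" by (simp add: fun_eq_iff comp_apply)
  have code: "code_at (?x \<circ> S i) m = code_at ?x (S i m) - (if int n dvd S i m - int i then 1 else 0)" for m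
    using code_at_S[of "?x \<circ> S i" i "S i m", OF AP_comp[OF x AP_S] a] unfolding e by simp
  have "len (S i \<circ> w) = length is + len (prodw (rev is) \<circ> (S i \<circ> w))"
  proof (rule Cons.IH)
    show "dec_word n is" "set is \<subseteq> {..<n}" "S i \<circ> w \<in> AP" using Cons.prems by (auto simp: dec_word_def)
    fix j assume j: "j \<in> set is"
    have jn: "j < n" "j \<noteq> i" "j \<noteq> Suc i mod n" using j Cons.prems i by (auto simp: dec_word_def)
    then have "S i (int j) = int j" "\<not> int n dvd int j - int i" using res_eq[OF i(1) jn(1)] by (simp_all add: S_eq)
    then show "0 < code_at (iv (S i \<circ> w)) (int j)"
      unfolding inv_S_comp[OF Cons.prems(3)] code using Cons.prems(4)[of j] j by simp
    show "Suc j mod n \<in> set is \<or> code_at (iv (S i \<circ> w)) (int j + 1) = 0"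
      unfolding inv_S_comp[OF Cons.prems(3)] code
    proof -
      consider "Suc j mod n \<in> set is" | "Suc j mod n = i" | "Suc j mod n \<noteq> i" "code_at ?x (int j + 1) = 0"
        using Cons.prems(5)[of j] j by auto
      then show "Suc j mod n \<in> set is \<or>
         code_at ?x (S i (int j + 1)) - (if int n dvd S i (int j + 1) - int i then 1 else 0) = 0"
      proof cases
        \<comment> \<open>Position \<open>i\<close> now carries the former entry of position
          \<open>i + 1\<close>, which is 0.\<close>
        case 2
        then have "int n dvd int j + 1 - int i"
          using res_eq(2)[OF jn(1) i(1)] dvd_diff_commute[of "int n" "int i" "int j + 1"] by (simp add: diff_diff_eq)
        then have "S i (int j + 1) = int j + 2" by (simp add: S_eq)
        moreover have "int n dvd int j + 2 - (int i + 1)"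

          by (rule back_subst[of "\<lambda>z. int n dvd z", OF \<open>int n dvd int j + 1 - int i\<close>]) simp
        ultimately have "code_at ?x (S i (int j + 1)) = code_at ?x (int i + 1)"
          using periodic_dvd[of "code_at ?x" "int j + 2" "int i + 1"] code_at_shift[OF x] by simp
        then show ?thesis using ci by simp
      next
        case 3
        have "\<not> int n dvd int j + 1 - int i"
          using 3 res_eq(2)[OF jn(1) i(1)] dvd_diff_commute[of "int n" "int i" "int j + 1"] by (simp add: diff_diff_eq)
        moreover have "\<not> int n dvd int j + 1 - int i - 1" using res_eq(1)[OF i(1) jn(1)] jn by simp
        ultimately have "S i (int j + 1) = int j + 1" by (simp add: S_eq)
        then show ?thesis using 3 by simp
      qed simp
    qed
  qed
  then show ?case using len unfolding rev.simps prodw_append prodw_simps comp_id comp_assoc list.size by linarith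
next
  case Nil
  show ?case unfolding rev.simps prodw_simps id_comp list.size by linarith
qed

subsection \<open>Factorizations and dominance\<close>

abbreviation "lkp \<equiv> Poly_Mapping.lookup"

section \<open>The operators in coordinates\<close>

lemma coxeter_length_outside:
  assumes "w \<notin> AP"
  shows "coxeter_length n w = (LEAST k. False)"
proof -
  have "\<not> (\<exists>is. length is = k \<and> set is \<subseteq> {..<n} \<and> w = foldr (\<lambda>i v. S i \<circ> v) is id)" for k
    using assms prodw_AP unfolding prodw_def by blast
  then show ?thesis unfolding coxeter_length_def by (simp only:)
qed

lemma AP_S_comp_iff: "S i \<circ> w \<in> AP \<longleftrightarrow> w \<in> AP"
proof
  assume "S i \<circ> w \<in> AP"
  then have "S i \<circ> (S i \<circ> w) \<in> AP" by (rule AP_comp[OF AP_S])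
  moreover have "S i \<circ> (S i \<circ> w) = w" by (simp add: fun_eq_iff)
  ultimately show "w \<in> AP" by (simp only:)
qed (rule AP_comp[OF AP_S])

lemma lookup_u_act_raw:
  "lkp (u_act n i f) w = (if coxeter_length n (S i \<circ> w) < coxeter_length n w then lkp f (S i \<circ> w) else 0)"
proof -
  have inv: "S i \<circ> (S i \<circ> w) = w" by (simp add: fun_eq_iff)
  have eq: "S i \<circ> v = w \<longleftrightarrow> v = S i \<circ> w" for v by (auto simp: fun_eq_iff) (metis S_S)
  have "lkp (u_act n i f) w = (\<Sum>v\<in>Poly_Mapping.keys f. if v = S i \<circ> w then
      (if coxeter_length n (S i \<circ> w) < coxeter_length n w then lkp f (S i \<circ> w) else 0) else 0)"
    unfolding u_act_def lookup_sum
  proof (intro sum.cong refl)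
    fix v
    show "lkp (if coxeter_length n v < coxeter_length n (S i \<circ> v)
         then Poly_Mapping.single (S i \<circ> v) (lkp f v) else 0) w =
        (if v = S i \<circ> w then
          (if coxeter_length n (S i \<circ> w) < coxeter_length n w then lkp f (S i \<circ> w) else 0) else 0)"
    proof (cases "v = S i \<circ> w")
      case True
      show ?thesis unfolding True inv by (simp add: lookup_single)
    next
      case False
      then have "S i \<circ> v \<noteq> w" using eq by blast
      then show ?thesis using False by (auto simp: lookup_single)
    qed
  qed
  also have "\<dots> = (if coxeter_length n (S i \<circ> w) < coxeter_length n w then lkp f (S i \<circ> w) else 0)"
    by (subst sum.delta) (auto simp: Poly_Mapping.in_keys_iff)
  finally show ?thesis .
qed

text \<open>The type of vectors also has basis elements outside the group. For these
  \<open>LEAST\<close> ranges over the empty set and gives one common value, so no step counts as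
  increasing the length and \<open>u_act\<close> kills them.\<close>

lemma lookup_u_act:
  "lkp (u_act n i f) w = (if w \<in> AP \<and> len w = Suc (len (S i \<circ> w)) then lkp f (S i \<circ> w) else 0)"
proof (cases "w \<in> AP")
  case True
  have e: "len (S i \<circ> w) < len w \<longleftrightarrow> len w = Suc (len (S i \<circ> w))" using len_S[OF True, of i] by linarith
  have t: "w \<in> AP \<longleftrightarrow> True" using True by (rule eqTrueI)
  show ?thesis
    unfolding lookup_u_act_raw coxeter_length_eq[OF True] coxeter_length_eq[OF AP_comp[OF AP_S True]] e t simp_thms ..
next
  case False
  then have F: "S i \<circ> w \<notin> AP" using AP_S_comp_iff by blast
  have t: "w \<in> AP \<longleftrightarrow> False" using False by (simp only: simp_thms)
  show ?thesis
    unfolding lookup_u_act_raw coxeter_length_outside[OF False] coxeter_length_outside[OF F] t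
    by (simp only: less_irrefl simp_thms if_False)
qed

lemma u_act_add: "u_act n i (f + g) = u_act n i f + u_act n i g"
  by (rule poly_mapping_eqI) (simp add: lookup_u_act lookup_add)

lemma prodw_rev_Cons_comp: "prodw (rev (i # is)) \<circ> w = prodw (rev is) \<circ> (S i \<circ> w)"
  unfolding rev.simps prodw_append prodw_simps comp_id comp_assoc ..

lemma prodw_cancel:
  "prodw is \<circ> (prodw (rev is) \<circ> w) = w" "prodw (rev is) \<circ> (prodw is \<circ> w) = w"
proof -
  have "prodw is \<circ> prodw (rev is) = id" for "is"
    unfolding inv_prodw[symmetric] by (rule inv_AP_simps(4)[OF prodw_AP])
  from this[of "is"] this[of "rev is"]
  show "prodw is \<circ> (prodw (rev is) \<circ> w) = w" "prodw (rev is) \<circ> (prodw is \<circ> w) = w"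
    unfolding comp_assoc[symmetric] rev_rev_ident by (simp_all only: id_comp)
qed

text \<open>One letter lowers the length by at most one, so the total drop equals the number of
  letters exactly if every step is a descent.\<close>

lemma lookup_word_act:
  assumes "w \<in> AP"
  shows "lkp (foldr (u_act n) is f) w =
    (if len w = length is + len (prodw (rev is) \<circ> w) then lkp f (prodw (rev is) \<circ> w) else 0)"
  using assms
proof (induction "is" arbitrary: w)
  case Nil
  show ?case unfolding rev.simps prodw_simps id_comp by simp
next
  case (Cons i "is")
  let ?p = "prodw (rev is) \<circ> (S i \<circ> w)"
  have Sw: "S i \<circ> w \<in> AP" using Cons.prems by (rule AP_comp[OF AP_S])
  have "len (S i \<circ> w) \<le> length is + len ?p"
    using len_prodw_comp[OF AP_comp[OF prodw_AP Sw], of "is" "rev is"] unfolding prodw_cancel .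
  then have e: "len w = length (i # is) + len ?p \<longleftrightarrow>
      len w = Suc (len (S i \<circ> w)) \<and> len (S i \<circ> w) = length is + len ?p"
    using len_S[OF Cons.prems, of i] unfolding list.size by linarith
  have "lkp (foldr (u_act n) (i # is) f) w =
     (if len w = Suc (len (S i \<circ> w)) then lkp (foldr (u_act n) is f) (S i \<circ> w) else 0)"
  proof -
    have t: "w \<in> AP \<longleftrightarrow> True" using Cons.prems by (rule eqTrueI)
    show ?thesis unfolding foldr.simps comp_apply lookup_u_act t simp_thms ..
  qed
  also have "\<dots> = (if len w = length (i # is) + len ?p then lkp f ?p else 0)"
    unfolding Cons.IH[OF Sw] e by presburger
  finally show ?case unfolding prodw_rev_Cons_comp .
qed

lemma h_act_eq: "h_act n k f = (\<Sum>A | A \<subset> {..<n} \<and> card A = k. foldr (u_act n) (dec_word_of n A) f)"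
  unfolding h_act_def u_set_act_def dec_word_of_def ..

lemmas word_of = dec_word_of[OF order_trans[OF _ n3], simplified]

text \<open>The number of length-additive factorizations of \<open>w\<close> into cyclically
  decreasing factors of the given lengths. The last entry acts last and so belongs to the leftmost
  factor.\<close>

definition fac :: "(int \<Rightarrow> int) \<Rightarrow> nat list \<Rightarrow> complex" where
  "fac w as = lkp (fold (h_act n) as (Poly_Mapping.single id 1)) w"

abbreviation strip :: "nat set \<Rightarrow> (int \<Rightarrow> int) \<Rightarrow> int \<Rightarrow> int" where
  "strip A w \<equiv> prodw (rev (dec_word_of n A)) \<circ> w"

lemma fac_Nil: "fac w [] = (if w = id then 1 else 0)"
  by (simp add: fac_def lookup_single when_def eq_commute)

lemma fac_snoc:
  assumes "w \<in> AP"
  shows "fac w (as @ [k]) = (\<Sum>A | A \<subset> {..<n} \<and> card A = k.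
    if len w = k + len (strip A w) then fac (strip A w) as else 0)"
proof -
  have "fac w (as @ [k]) = (\<Sum>A | A \<subset> {..<n} \<and> card A = k.
     lkp (foldr (u_act n) (dec_word_of n A) (fold (h_act n) as (Poly_Mapping.single id 1))) w)"
    by (simp add: fac_def h_act_eq lookup_sum)
  also have "\<dots> = (\<Sum>A | A \<subset> {..<n} \<and> card A = k.
    if len w = k + len (strip A w) then fac (strip A w) as else 0)"
  proof (intro sum.cong refl)
    fix A assume "A \<in> {A. A \<subset> {..<n} \<and> card A = k}"
    then have "length (dec_word_of n A) = k" using word_of(4) by auto
    then show "lkp (foldr (u_act n) (dec_word_of n A) (fold (h_act n) as (Poly_Mapping.single id 1))) w =
        (if len w = k + len (strip A w) then fac (strip A w) as else 0)"
      unfolding lookup_word_act[OF assms] fac_def by (simp only:)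
  qed
  finally show ?thesis .
qed

lemma strip_code:
  assumes "w \<in> AP" "A \<subset> {..<n}" "len w = card A + len (strip A w)"
  shows "code_at (iv w) m =
    code_at (iv (strip A w)) (iv (prodw (dec_word_of n A)) m) + (if inA m A then 1 else 0)"
proof -
  have "len (prodw (dec_word_of n A) \<circ> strip A w) = length (dec_word_of n A) + len (strip A w)"
    using assms(3) word_of(4)[OF assms(2)] unfolding prodw_cancel by (simp only:)
  from code_dec_word[OF word_of(2)[OF assms(2)] _ AP_comp[OF prodw_AP assms(1)] this, of m]
  show ?thesis using assms(2) word_of(1)[OF assms(2)] unfolding prodw_cancel by auto
qed

text \<open>The sum of the first \<open>k\<close> parts of \<open>shape n w\<close>, read off the
  code without conjugating.\<close>

definition cap :: "(int \<Rightarrow> int) \<Rightarrow> nat \<Rightarrow> nat" where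
  "cap w k = (\<Sum>i<n. min (code_at (iv w) (int i)) k)"

lemma cap_strip:
  assumes "w \<in> AP" "A \<subset> {..<n}" "len w = card A + len (strip A w)"
  shows "cap (strip A w) k \<le> cap w k" "cap (strip A w) k + card A \<le> cap w (Suc k)"
proof -
  let ?c = "code_at (iv (strip A w))" and ?s = "iv (prodw (dec_word_of n A))"
  have sAP: "strip A w \<in> AP" by (rule AP_comp[OF prodw_AP assms(1)])
  have s: "?s \<in> AP" by (rule AP_inv[OF prodw_AP])
  have c: "cap (strip A w) k = (\<Sum>i<n. min (?c (?s (int i))) k)"
    unfolding cap_def
    by (rule sum_AP[OF s, of "\<lambda>m. min (?c m) k", symmetric]) (simp only: code_at_shift[OF AP_inv[OF sAP]])
  show "cap (strip A w) k \<le> cap w k"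
    unfolding c unfolding cap_def strip_code[OF assms] by (intro sum_mono) simp
  have "finite A" using assms(2) finite_subset by fastforce
  have "A \<inter> {..<n} = A" using assms(2) by auto
  then have "card A = (\<Sum>i<n. if inA (int i) A then 1 else 0)"
    by (simp add: sum.If_cases Int_def conj_commute)
  then have "cap (strip A w) k + card A = (\<Sum>i<n. min (?c (?s (int i))) k + (if inA (int i) A then 1 else 0))"
    unfolding c by (simp only: sum.distrib)
  also have "\<dots> \<le> cap w (Suc k)"
    unfolding cap_def strip_code[OF assms] by (intro sum_mono) (auto simp: min_def)
  finally show "cap (strip A w) k + card A \<le> cap w (Suc k)" .
qed

text \<open>Each factor raises an entry of the code by at most one, so \<open>k\<close> factors
  contribute at most \<open>min c k\<close> to a final entry \<open>c\<close>. The exponents need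
  not be sorted for this.\<close>

lemma fac_nonzero:
  assumes "w \<in> AP" "fac w as \<noteq> 0"
  shows "sum_list as = len w \<and> (\<forall>k. sum_list (take k as) \<le> cap w k)"
  using assms
proof (induction as arbitrary: w rule: rev_induct)
  case Nil
  then have "w = id" by (simp add: fac_Nil split: if_splits)
  then have "len w = 0" by (simp only: len_id)
  then show ?case by simp
next
  case (snoc a as)
  obtain A where "A \<in> {A. A \<subset> {..<n} \<and> card A = a}"
    and ne: "(if len w = a + len (strip A w) then fac (strip A w) as else 0) \<noteq> 0"
    using snoc.prems(2)[unfolded fac_snoc[OF snoc.prems(1)]] by (rule sum.not_neutral_contains_not_neutral)
  moreover from ne have "len w = a + len (strip A w)" "fac (strip A w) as \<noteq> 0"
    by (auto simp only: split: if_splits)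
  ultimately have A: "A \<subset> {..<n}" "card A = a" "len w = a + len (strip A w)" "fac (strip A w) as \<noteq> 0"
    by simp_all
  have IH: "sum_list as = len (strip A w)" "\<And>k. sum_list (take k as) \<le> cap (strip A w) k"
    using snoc.IH[OF AP_comp[OF prodw_AP snoc.prems(1)] A(4)] by (blast, blast)
  note cs = cap_strip[OF snoc.prems(1) A(1), unfolded A(2), OF A(3)]
  have "sum_list (take k (as @ [a])) \<le> cap w k" for k
  proof (cases "k \<le> length as")
    case True
    then show ?thesis using IH(2)[of k] cs(1)[of k] by simp
  next
    case False
    then obtain l where l: "k = Suc l" "length as \<le> l" by (cases k) auto
    have "sum_list (take k (as @ [a])) = sum_list (take l as) + a" using l by simp
    also have "\<dots> \<le> cap (strip A w) l + a" by (rule add_right_mono[OF IH(2)])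
    finally show ?thesis using cs(2)[of l] l(1) by simp
  qed
  then show ?case using IH(1) A(3) by simp
qed

section \<open>The shape in terms of the code\<close>

definition cnt :: "(int \<Rightarrow> int) \<Rightarrow> nat \<Rightarrow> nat" where
  "cnt w j = card {i. i < n \<and> j \<le> code_at (iv w) (int i)}"

lemma affine_group_simps [simp]:
  "carrier (affine_group n) = AP" "x \<otimes>\<^bsub>affine_group n\<^esub> y = x \<circ> y" "\<one>\<^bsub>affine_group n\<^esub> = id"
  by (simp_all add: affine_group_def)

lemma group_affine: "Group.group (affine_group n)"
proof (rule groupI)
  fix x assume "x \<in> carrier (affine_group n)"
  then have "iv x \<in> carrier (affine_group n)" "iv x \<otimes>\<^bsub>affine_group n\<^esub> x = \<one>\<^bsub>affine_group n\<^esub>"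
    unfolding affine_group_simps by (rule AP_inv, rule inv_AP_simps)
  then show "\<exists>y\<in>carrier (affine_group n). y \<otimes>\<^bsub>affine_group n\<^esub> x = \<one>\<^bsub>affine_group n\<^esub>" by blast
qed (unfold affine_group_simps, rule AP_comp, assumption+, rule AP_id, rule comp_assoc, rule id_comp)

lemma group_inv: "w \<in> AP \<Longrightarrow> inv\<^bsub>affine_group n\<^esub> w = iv w"
proof -
  assume w: "w \<in> AP"
  have "iv w \<otimes>\<^bsub>affine_group n\<^esub> w = \<one>\<^bsub>affine_group n\<^esub>"
    unfolding affine_group_simps by (rule inv_AP_simps(3)[OF w])
  then show ?thesis
    using group.inv_equality[OF group_affine] w AP_inv[OF w] unfolding affine_group_simps by metis
qed

lemma code_eq: "code n x = map (\<lambda>i. code_at x (int i)) [1..<Suc n]"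
  unfolding code_def code_at_def ..

lemma sum_window:
  assumes "\<And>i. g (i + int n) = (g i :: nat)"
  shows "(\<Sum>i\<in>{1..<Suc n}. g (int i)) = (\<Sum>i<n. g (int i))"
proof -
  have "(\<Sum>i\<in>{1..<Suc n}. g (int i)) = sum g (int ` {1..<Suc n})" by (simp add: sum.reindex)
  also have "int ` {1..<Suc n} = {1..<1 + int n}" by (simp add: image_int_atLeastLessThan)
  also have "sum g \<dots> = (\<Sum>i<n. g (int i))" using assms by (intro sum_ressys ressys_interval)
  finally show ?thesis .
qed

lemma card_as_sum: "finite I \<Longrightarrow> card {i \<in> I. Q i} = (\<Sum>i\<in>I. if Q i then 1 else 0)"
  by (simp add: sum.If_cases Int_def)

lemma length_filter_code:
  assumes "x \<in> AP"
  shows "length (filter Q (code n x)) = card {i. i < n \<and> Q (code_at x (int i))}"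
proof -
  have "length (filter Q (code n x)) = card {i \<in> {1..<Suc n}. Q (code_at x (int i))}"
    unfolding code_eq filter_map length_map comp_def
    by (subst distinct_card[symmetric]) (auto intro!: arg_cong[of _ _ card])
  also have "\<dots> = (\<Sum>i\<in>{1..<Suc n}. if Q (code_at x (int i)) then 1 else 0)" by (rule card_as_sum) simp
  also have "\<dots> = (\<Sum>i<n. if Q (code_at x (int i)) then 1 else 0)"
    by (rule sum_window[of "\<lambda>m. if Q (code_at x m) then 1 else 0"]) (simp only: code_at_shift[OF assms])
  also have "\<dots> = card {i \<in> {..<n}. Q (code_at x (int i))}" by (rule card_as_sum[symmetric]) simp
  finally show ?thesis by simp
qed

lemma length_filter_sorted:
  assumes "1 \<le> (j::nat)"
  shows "length (filter (\<lambda>x. j \<le> x) (filter (\<lambda>x. 0 < x) (rev (sort C)))) = length (filter (\<lambda>x. j \<le> x) C)"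
proof -
  have "filter (\<lambda>x. j \<le> x) (filter (\<lambda>x. 0 < x) (rev (sort C))) = filter (\<lambda>x. j \<le> x) (rev (sort C))"
    unfolding filter_filter using assms by (intro filter_cong refl) linarith
  moreover have "mset (filter (\<lambda>x. j \<le> x) (rev (sort C))) = mset (filter (\<lambda>x. j \<le> x) C)"
    by (simp only: mset_filter mset_rev mset_sort)
  ultimately show ?thesis by (metis size_mset)
qed

text \<open>Sorting and dropping zeros do not change how many entries are at least \<open>j\<close>
  when \<open>j\<close> is positive, and periodicity identifies the window \<open>1..n\<close> of
  \<open>code\<close> with the window \<open>0..n - 1\<close> of \<open>cnt\<close>.\<close>

lemma shape_eqI:
  assumes "w \<in> AP" "\<And>j. 1 \<le> j \<Longrightarrow> 0 < cnt w j \<longleftrightarrow> j \<le> M"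
  shows "shape n w = map (cnt w) [1..<Suc M]"
proof -
  let ?C = "code n (iv w)"
  let ?l = "filter (\<lambda>x. 0 < x) (rev (sort ?C))"
  let ?M = "Max (insert 0 (set ?l))"
  have f: "length (filter (\<lambda>x. j \<le> x) ?l) = cnt w j" if "1 \<le> j" for j
    using length_filter_sorted[OF that, of ?C] length_filter_code[OF AP_inv[OF assms(1)], of "\<lambda>x. j \<le> x"]
    by (simp only: cnt_def)
  have "j \<le> ?M \<longleftrightarrow> j \<le> M" if "1 \<le> j" for j
  proof -
    have "j \<le> ?M \<longleftrightarrow> (\<exists>x\<in>set ?l. j \<le> x)" using that by (subst Max_ge_iff) auto
    also have "\<dots> \<longleftrightarrow> 0 < length (filter (\<lambda>x. j \<le> x) ?l)" by (auto simp: filter_empty_conv)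
    also have "\<dots> \<longleftrightarrow> j \<le> M" unfolding f[OF that] by (rule assms(2)[OF that])
    finally show ?thesis .
  qed
  from this[of M] this[of ?M] have "?M = M"
    by (cases "M = 0"; cases "?M = 0") (auto intro: order_antisym)
  have "shape n w = map (\<lambda>j. length (filter (\<lambda>x. j \<le> x) ?l)) [1..<Suc ?M]"
    unfolding shape_def conjugate_def group_inv[OF assms(1)] ..
  also have "\<dots> = map (cnt w) [1..<Suc M]"
    unfolding \<open>?M = M\<close> using f by (intro map_cong) auto
  finally show ?thesis .
qed

lemma cnt_antimono: "j \<le> k \<Longrightarrow> cnt w k \<le> cnt w j"
  unfolding cnt_def by (intro card_mono) auto

lemma shape_exists:
  assumes "w \<in> AP"
  obtains M where "shape n w = map (cnt w) [1..<Suc M]" "\<And>j. 1 \<le> j \<Longrightarrow> 0 < cnt w j \<longleftrightarrow> j \<le> M"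
proof -
  define M where "M = Max (insert 0 ((\<lambda>i. code_at (iv w) (int i)) ` {..<n}))"
  have "0 < cnt w j \<longleftrightarrow> j \<le> M" if "1 \<le> j" for j
  proof -
    have "j \<le> M \<longleftrightarrow> (\<exists>i<n. j \<le> code_at (iv w) (int i))"
      unfolding M_def using that by (subst Max_ge_iff) auto
    then show ?thesis unfolding cnt_def card_gt_0_iff by auto
  qed
  then show ?thesis using shape_eqI[OF assms] that by blast
qed

text \<open>An entry \<open>c\<close> reaches exactly \<open>min c k\<close> of the thresholds
  \<open>1, ..., k\<close>.\<close>

lemma sum_cnt: "(\<Sum>j\<in>{1..<Suc k}. cnt w j) = cap w k"
proof (induction k)
  case (Suc k)
  have "cap w k + cnt w (Suc k) = (\<Sum>i<n. min (code_at (iv w) (int i)) k + (if Suc k \<le> code_at (iv w) (int i) then 1 else 0))"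
    unfolding cap_def cnt_def sum.distrib using card_as_sum[of "{..<n}" "\<lambda>i. Suc k \<le> code_at (iv w) (int i)"] by simp
  also have "\<dots> = cap w (Suc k)" unfolding cap_def by (intro sum.cong) auto
  finally show ?case using Suc by simp
qed (simp add: cap_def)

lemma sum_take_shape:
  assumes "w \<in> AP"
  shows "sum_list (take k (shape n w)) = cap w k"
proof -
  obtain M where M: "shape n w = map (cnt w) [1..<Suc M]" "\<And>j. 1 \<le> j \<Longrightarrow> 0 < cnt w j \<longleftrightarrow> j \<le> M"
    using shape_exists[OF assms] by metis
  have "take k (shape n w) = map (cnt w) [1..<Suc (min k M)]"
    unfolding M(1) take_map by (cases "k \<le> M") (simp_all add: take_upt min_def del: upt_Suc)
  then have "sum_list (take k (shape n w)) = (\<Sum>j\<in>{1..<Suc (min k M)}. cnt w j)"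
    by (simp add: sum_list_distinct_conv_sum_set del: upt_Suc)
  also have "\<dots> = (\<Sum>j\<in>{1..<Suc k}. cnt w j)"
  proof (rule sum.mono_neutral_left)
    show "\<forall>i\<in>{1..<Suc k} - {1..<Suc (min k M)}. cnt w i = 0"
    proof
      fix i assume "i \<in> {1..<Suc k} - {1..<Suc (min k M)}"
      then have "1 \<le> i" "\<not> i \<le> M" by auto
      then show "cnt w i = 0" using M(2)[of i] by simp
    qed
  qed auto
  finally show ?thesis using sum_cnt by simp
qed

lemma sum_shape:
  assumes "w \<in> AP"
  shows "sum_list (shape n w) = len w"
proof -
  let ?K = "length (shape n w) + len w"
  have "cap w ?K = len w"
    unfolding cap_def len_def ell_def
  proof (intro sum.cong refl)
    fix i assume "i \<in> {..<n}"
    then have "code_at (iv w) (int i) \<le> (\<Sum>k<n. code_at (iv w) (int k))" by (intro member_le_sum) auto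
    then show "min (code_at (iv w) (int i)) (length (shape n w) + (\<Sum>k<n. code_at (iv w) (int k))) = code_at (iv w) (int i)"
      by simp
  qed
  then show ?thesis using sum_take_shape[OF assms, of ?K] by simp
qed

text \<open>A zero entry of the code keeps every column count at or below
  \<open>n - 1\<close>.\<close>

lemma shape_Par:
  assumes "w \<in> AP"
  shows "shape n w \<in> Par n"
proof -
  obtain M where M: "shape n w = map (cnt w) [1..<Suc M]" "\<And>j. 1 \<le> j \<Longrightarrow> 0 < cnt w j \<longleftrightarrow> j \<le> M"
    using shape_exists[OF assms] by metis
  obtain z where z: "z < n" "code_at (iv w) (int z) = 0" using code_zero_exists[OF AP_inv[OF assms]] by blast
  have "cnt w j \<le> n - 1" if "1 \<le> j" for j
  proof -
    have "cnt w j \<le> card ({..<n} - {z})" unfolding cnt_def using z that by (intro card_mono) auto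
    then show ?thesis using z by simp
  qed
  moreover have "1 \<le> cnt w j" if "1 \<le> j" "j \<le> M" for j using M(2)[OF that(1)] that(2) by simp
  moreover have "sorted_wrt (\<lambda>x y. y \<le> x) (map (cnt w) [1..<Suc M])"
    unfolding sorted_wrt_map by (rule sorted_wrt_mono_rel[OF _ sorted_wrt_upt]) (simp add: cnt_antimono)
  ultimately show ?thesis unfolding Par_def M(1) by (auto simp del: upt_Suc)
qed

lemma fac_dominated:
  assumes "w \<in> AP" "fac w as \<noteq> 0"
  shows "dominated as (shape n w)"
  using fac_nonzero[OF assms] unfolding dominated_def sum_take_shape[OF assms(1)] sum_shape[OF assms(1)] by blast

section \<open>The extremal factorization\<close>

definition supp :: "(int \<Rightarrow> int) \<Rightarrow> nat set" where
  "supp w = {i. i < n \<and> 0 < code_at (iv w) (int i)}"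

lemma supp_proper:
  assumes "w \<in> AP"
  shows "supp w \<subset> {..<n}"
proof -
  obtain z where "z < n" "code_at (iv w) (int z) = 0" using code_zero_exists[OF AP_inv[OF assms]] by blast
  then have "z \<in> {..<n}" "z \<notin> supp w" by (simp_all add: supp_def)
  moreover have "supp w \<subseteq> {..<n}" by (auto simp: supp_def)
  ultimately show ?thesis by blast
qed

text \<open>A successor outside the support has entry 0 by definition, which is the condition of
  \<open>peel_dec_word\<close>: all nonzero entries can be lowered at once.\<close>

lemma len_strip_supp:
  assumes "w \<in> AP"
  shows "len w = card (supp w) + len (strip (supp w) w)"
proof -
  note p = supp_proper[OF assms]
  have "len w = length (dec_word_of n (supp w)) + len (strip (supp w) w)"
  proof (rule peel_dec_word)
    show "dec_word n (dec_word_of n (supp w))" "set (dec_word_of n (supp w)) \<subseteq> {..<n}" "w \<in> AP"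
      using word_of[OF p] p assms by auto
    fix i assume "i \<in> set (dec_word_of n (supp w))"
    then have i: "i \<in> supp w" using word_of(1)[OF p] by simp
    then show "0 < code_at (iv w) (int i)" by (simp add: supp_def)
    have "code_at (iv w) (int (Suc i mod n)) = code_at (iv w) (int i + 1)"
      using code_at_mod[OF AP_inv[OF assms], of "int i + 1"] by (simp add: of_nat_mod add.commute)
    moreover have "Suc i mod n < n" using n3 by simp
    ultimately show "Suc i mod n \<in> set (dec_word_of n (supp w)) \<or> code_at (iv w) (int i + 1) = 0"
      unfolding word_of(1)[OF p] by (auto simp: supp_def)
  qed
  then show ?thesis using word_of(4)[OF p] by simp
qed

lemma shape_strip_supp:
  assumes "w \<in> AP" "supp w \<noteq> {}"
  shows "shape n w = card (supp w) # shape n (strip (supp w) w)"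
proof -
  note p = supp_proper[OF assms(1)]
  let ?w = "strip (supp w) w" and ?s = "iv (prodw (dec_word_of n (supp w)))"
  have wAP: "?w \<in> AP" by (rule AP_comp[OF prodw_AP assms(1)])
  have sAP: "?s \<in> AP" by (rule AP_inv[OF prodw_AP])
  have c: "code_at (iv w) (int i) = code_at (iv ?w) (?s (int i)) + (if i \<in> supp w then 1 else 0)" if "i < n" for i
    using strip_code[OF assms(1) p len_strip_supp[OF assms(1)], of "int i"] that by simp
  have cnt: "cnt ?w j = cnt w (Suc j)" if "1 \<le> j" for j
  proof -
    have "cnt ?w j = (\<Sum>i<n. if j \<le> code_at (iv ?w) (int i) then 1 else 0)"
      unfolding cnt_def using card_as_sum[of "{..<n}" "\<lambda>i. j \<le> code_at (iv ?w) (int i)"] by simp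
    also have "\<dots> = (\<Sum>i<n. if j \<le> code_at (iv ?w) (?s (int i)) then 1 else 0)"
      by (rule sum_AP[OF sAP, of "\<lambda>m. if j \<le> code_at (iv ?w) m then 1 else 0", symmetric])
        (simp only: code_at_shift[OF AP_inv[OF wAP]])
    also have "\<dots> = (\<Sum>i<n. if Suc j \<le> code_at (iv w) (int i) then 1 else 0)"
    proof (intro sum.cong refl)
      fix i assume "i \<in> {..<n}"
      then have i: "i < n" by simp
      have "j \<le> code_at (iv ?w) (?s (int i)) \<longleftrightarrow> Suc j \<le> code_at (iv w) (int i)"
        using c[OF i] i that by (cases "i \<in> supp w") (auto simp: supp_def)
      then show "(if j \<le> code_at (iv ?w) (?s (int i)) then 1 else 0) =
          (if Suc j \<le> code_at (iv w) (int i) then 1 else (0::nat))" by (simp only:)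
    qed
    also have "\<dots> = cnt w (Suc j)"
      unfolding cnt_def using card_as_sum[of "{..<n}" "\<lambda>i. Suc j \<le> code_at (iv w) (int i)"] by simp
    finally show ?thesis .
  qed
  have cnt1: "cnt w 1 = card (supp w)"
    unfolding cnt_def supp_def by (rule arg_cong[of _ _ card]) auto
  then have pos: "0 < cnt w 1" using assms(2) by (auto simp: card_gt_0_iff supp_def)
  obtain M where M: "shape n ?w = map (cnt ?w) [1..<Suc M]" "\<And>j. 1 \<le> j \<Longrightarrow> 0 < cnt ?w j \<longleftrightarrow> j \<le> M"
    using shape_exists[OF wAP] by metis
  have "0 < cnt w j \<longleftrightarrow> j \<le> Suc M" if j1: "1 \<le> j" for j
  proof (cases "j = 1")
    case True
    then show ?thesis using pos by simp
  next
    case False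
    then obtain l where "j = Suc l" "1 \<le> l" using j1 by (cases j) auto
    then show ?thesis using M(2)[of l] cnt[of l] by simp
  qed
  then have "shape n w = map (cnt w) [1..<Suc (Suc M)]" by (rule shape_eqI[OF assms(1)])
  also have "[1..<Suc (Suc M)] = 1 # map Suc [1..<Suc M]" by (simp add: map_Suc_upt upt_conv_Cons del: upt_Suc)
  also have "map (cnt w) (1 # map Suc [1..<Suc M]) = cnt w 1 # map (\<lambda>j. cnt w (Suc j)) [1..<Suc M]"
    by (simp add: comp_def del: upt_Suc)
  also have "map (\<lambda>j. cnt w (Suc j)) [1..<Suc M] = shape n ?w"
    unfolding M(1) using cnt by (intro map_cong refl) auto
  finally show ?thesis unfolding cnt1 .
qed

text \<open>The reversal makes the largest part the factor that is stripped first. A factor can only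
  be stripped at nonzero entries, so its content lies in the support; having the same cardinality it
  equals the support, and one term remains.\<close>

lemma fac_rev_shape: "w \<in> AP \<Longrightarrow> fac w (rev (shape n w)) = 1"
proof (induction "len w" arbitrary: w rule: less_induct)
  case less
  show ?case
  proof (cases "supp w = {}")
    case True
    then have "cnt w j = 0" if "1 \<le> j" for j using that by (force simp: cnt_def supp_def)
    then have "shape n w = []" using shape_eqI[OF less.prems, of 0] by simp
    moreover have "len w = 0" unfolding len_def ell_def using True by (auto simp: supp_def)
    then have "w = id" using len_0[OF less.prems] by blast
    ultimately show ?thesis by (simp add: fac_Nil)
  next
    case False
    note p = supp_proper[OF less.prems]
    let ?w = "strip (supp w) w"
    have wAP: "?w \<in> AP" by (rule AP_comp[OF prodw_AP less.prems])
    have fs: "finite (supp w)" using p finite_subset by fastforce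
    have lt: "len ?w < len w" using len_strip_supp[OF less.prems] False fs by (simp add: card_gt_0_iff)
    have "rev (shape n w) = rev (shape n ?w) @ [card (supp w)]"
      unfolding shape_strip_supp[OF less.prems False] by (rule rev.simps)
    then have "fac w (rev (shape n w)) = (\<Sum>A | A \<subset> {..<n} \<and> card A = card (supp w).
        if len w = card (supp w) + len (strip A w) then fac (strip A w) (rev (shape n ?w)) else 0)"
      using fac_snoc[OF less.prems] by (simp only:)
    also have "\<dots> = (\<Sum>A | A \<subset> {..<n} \<and> card A = card (supp w). if A = supp w then 1 else 0)"
    proof (intro sum.cong refl)
      fix A assume A: "A \<in> {A. A \<subset> {..<n} \<and> card A = card (supp w)}"
      show "(if len w = card (supp w) + len (strip A w) then fac (strip A w) (rev (shape n ?w)) else 0) =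
          (if A = supp w then 1 else 0)"
      proof (cases "A = supp w")
        case True
        then show ?thesis using len_strip_supp[OF less.prems] less.hyps[OF lt wAP] by simp
      next
        case False
        have "len w \<noteq> card (supp w) + len (strip A w)"
        proof
          assume l: "len w = card (supp w) + len (strip A w)"
          have "A \<subseteq> supp w"
          proof
            fix i assume i: "i \<in> A"
            then have "i < n" using A by auto
            then show "i \<in> supp w"
              using strip_code[OF less.prems, of A "int i"] A l i by (simp add: supp_def)
          qed
          then show False using card_subset_eq[OF fs] A False by simp
        qed
        then show ?thesis using False by simp
      qed
    qed
    also have "\<dots> = 1" using p by (subst sum.delta) (auto intro: finite_subset[of _ "Pow {..<n}"])
    finally show ?thesis .
  qed
qed

subsection \<open>Grassmannian elements and the involution\<close>

declare upt_Suc [simp del]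

lemma len_S_comp_less:
  assumes "w \<in> AP" "iv w (int i + 1) < iv w (int i)"
  shows "len (S i \<circ> w) < len w"
  using len_S_iff(2)[OF assms(1), of i] assms(2) by linarith

section \<open>Minimal coset representatives\<close>

definition ascending :: "(int \<Rightarrow> int) \<Rightarrow> bool" where
  "ascending x \<longleftrightarrow> (\<forall>i\<in>{1..<n}. x (int i) < x (int i + 1))"

lemma ascendingD: "ascending x \<Longrightarrow> 1 \<le> i \<Longrightarrow> i < n \<Longrightarrow> x (int i) < x (int i + 1)"
  by (simp add: ascending_def)

abbreviation "H \<equiv> finite_subgroup n"

lemma S_window: "i \<in> {1..<n} \<Longrightarrow> S i ` {1..int n} \<subseteq> {1..int n}"
proof
  fix k assume i: "i \<in> {1..<n}" and "k \<in> S i ` {1..int n}"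
  then obtain j where j: "1 \<le> j" "j \<le> int n" "k = S i j" by auto
  have "j = int i" if "int n dvd j - int i"
  proof (rule ccontr)
    assume "j \<noteq> int i"
    then have "int n \<le> \<bar>j - int i\<bar>" using dvd_imp_le_int[OF _ that] by simp
    then show False using i j by auto
  qed
  moreover have "j = int i + 1" if "int n dvd j - int i - 1"
  proof (rule ccontr)
    assume "j \<noteq> int i + 1"
    then have "int n \<le> \<bar>j - int i - 1\<bar>" using dvd_imp_le_int[OF _ that] by simp
    then show False using i j by auto
  qed
  ultimately show "k \<in> {1..int n}" using i j(1,2) unfolding j(3) S_eq by auto
qed

lemma H_props:
  assumes "h \<in> H"
  shows "h \<in> AP \<and> h ` {1..int n} = {1..int n}"
  using assms unfolding finite_subgroup_def
proof induction
  case one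
  show ?case unfolding affine_group_simps by (rule conjI[OF AP_id]) simp
next
  case (incl h)
  then obtain i where i: "i \<in> {1..<n}" "h = S i" by blast
  have "{1..int n} = S i ` S i ` {1..int n}" by (simp add: image_image)
  also have "\<dots> \<subseteq> S i ` {1..int n}" using S_window[OF i(1)] by (rule image_mono)
  finally show ?case using S_window[OF i(1)] AP_S unfolding i(2) by blast
next
  case (inv h)
  then obtain i where i: "i \<in> {1..<n}" "h = S i" by blast
  have "{1..int n} = S i ` S i ` {1..int n}" by (simp add: image_image)
  also have "\<dots> \<subseteq> S i ` {1..int n}" using S_window[OF i(1)] by (rule image_mono)
  finally show ?case using S_window[OF i(1)] AP_S unfolding i(2) group_inv[OF AP_S] inv_S by blast
next
  case (eng h1 h2)
  then show ?case unfolding affine_group_simps image_comp[symmetric] using AP_comp by metis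
qed

lemma coset_iff: "v \<in> H #>\<^bsub>affine_group n\<^esub> w \<longleftrightarrow> (\<exists>h\<in>H. v = h \<circ> w)"
  unfolding r_coset_def affine_group_simps by blast

lemma H_id: "id \<in> H"
  unfolding finite_subgroup_def using generate.one[of "affine_group n"] unfolding affine_group_simps .

lemma H_S_comp:
  assumes "i \<in> {1..<n}" "h \<in> H"
  shows "S i \<circ> h \<in> H"
proof -
  have "S i \<in> generate (affine_group n) (S ` {1..<n})" using assms(1) by (intro generate.incl) auto
  from generate.eng[OF this assms(2)[unfolded finite_subgroup_def]]
  show ?thesis unfolding finite_subgroup_def affine_group_simps .
qed

text \<open>A finite set has only one increasing enumeration, and the values on a window determine
  an affine permutation.\<close>

lemma ascending_unique:
  assumes "x \<in> AP" "y \<in> AP" "ascending x" "ascending y" "x ` {1..int n} = y ` {1..int n}"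
  shows "x = y"
proof -
  let ?l = "\<lambda>x. map (\<lambda>k. x (int k)) [1..<Suc n]"
  have srt: "sorted_wrt (<) (?l x)" if "ascending x" for x
  proof -
    have *: "x (int i) < x (int i + int (Suc d))" if "1 \<le> i" "i + Suc d \<le> n" for i d
      using that
    proof (induction d)
      case 0
      then show ?case using \<open>ascending x\<close> by (auto simp: ascending_def)
    next
      case (Suc d)
      have "x (int (i + Suc d)) < x (int (i + Suc d) + 1)"
        by (rule ascendingD[OF \<open>ascending x\<close>]) (use Suc.prems in auto)
      moreover have "int (i + Suc d) + 1 = int i + int (Suc (Suc d))" "int (i + Suc d) = int i + int (Suc d)" by simp_all
      moreover have "x (int i) < x (int i + int (Suc d))" using Suc by simp
      ultimately show ?case by (metis less_trans)
    qed
    have lt: "x (int i) < x (int j)" if "1 \<le> i" "i < j" "j \<le> n" for i j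
      using *[of i "j - i - 1"] that by (simp add: of_nat_diff)
    show ?thesis
      unfolding sorted_wrt_iff_nth_less
    proof (intro allI impI)
      fix i j assume ij: "i < j" "j < length (?l x)"
      then have "?l x ! i = x (int (Suc i))" "?l x ! j = x (int (Suc j))" by (simp_all del: upt_Suc)
      moreover have "x (int (Suc i)) < x (int (Suc j))" using ij by (intro lt) auto
      ultimately show "?l x ! i < ?l x ! j" by (simp only:)
    qed
  qed
  have set: "set (?l x) = x ` {1..int n}" for x :: "int \<Rightarrow> int"
  proof -
    have "set (?l x) = x ` int ` {1..<Suc n}" by (simp add: image_image del: upt_Suc)
    also have "int ` {1..<Suc n} = {1..int n}" by (auto simp: image_int_atLeastLessThan)
    finally show ?thesis .
  qed
  have "?l x = ?l y"
    using srt[OF assms(3)] srt[OF assms(4)] set assms(5)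
    by (intro sorted_distinct_set_unique) (simp_all only: strict_sorted_iff)
  then have eq: "x (int k) = y (int k)" if "k \<in> {1..<Suc n}" for k using that by (simp del: upt_Suc)
  show ?thesis
  proof
    fix m
    define k where "k = nat ((m - 1) mod int n) + 1"
    have k: "int k = (m - 1) mod int n + 1" "k \<in> {1..<Suc n}"
      using n3 pos_mod_bound[of "int n" "m - 1"] by (simp_all add: k_def nat_less_iff)
    then have "m = int k + ((m - 1) div int n) * int n" by simp
    then show "x m = y m"
      using AP_shift_mult[OF assms(1), of "int k" "(m - 1) div int n"]
        AP_shift_mult[OF assms(2), of "int k" "(m - 1) div int n"] eq[OF k(2)] by simp
  qed
qed

text \<open>A descent of \<open>iv w\<close> between positions of the window yields a shorter
  element of the coset. Conversely a shortest element \<open>z\<close> of the coset is ascending for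
  this reason; the subgroup permutes the window, so \<open>iv z\<close> and \<open>iv w\<close> have
  the same image of it and coincide.\<close>

theorem grassmannian_iff: "grassmannian n w \<longleftrightarrow> w \<in> AP \<and> ascending (iv w)"
proof
  assume g: "grassmannian n w"
  then have w: "w \<in> AP" by (simp add: grassmannian_def)
  have min: "\<not> coxeter_length n y < coxeter_length n w" if "y \<in> H #>\<^bsub>affine_group n\<^esub> w" for y
    using g that unfolding grassmannian_def is_arg_min_def by blast
  have "iv w (int i) < iv w (int i + 1)" if i: "i \<in> {1..<n}" for i
  proof (rule ccontr)
    assume "\<not> iv w (int i) < iv w (int i + 1)"
    then have "iv w (int i + 1) < iv w (int i)"
      using AP_neq[OF AP_inv[OF w], of "int i" "int i + 1"] by simp
    then have "len (S i \<circ> w) < len w" by (rule len_S_comp_less[OF w])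
    moreover have "S i \<circ> w \<in> H #>\<^bsub>affine_group n\<^esub> w"
      unfolding coset_iff using H_S_comp[OF i H_id] unfolding comp_id by blast
    ultimately show False
      using min[of "S i \<circ> w"] unfolding coxeter_length_eq[OF w] coxeter_length_eq[OF AP_comp[OF AP_S w]] by blast
  qed
  then show "w \<in> AP \<and> ascending (iv w)" using w by (simp add: ascending_def)
next
  assume a: "w \<in> AP \<and> ascending (iv w)"
  then have w: "w \<in> AP" and asc: "ascending (iv w)" by auto
  have "\<exists>h\<in>H. w = h \<circ> w" by (rule bexI[OF _ H_id]) (simp only: id_comp)
  from ex_has_least_nat[of "\<lambda>v. \<exists>h\<in>H. v = h \<circ> w", OF this, of len]
  obtain z where z1: "\<exists>h\<in>H. z = h \<circ> w" and z2: "\<forall>y. (\<exists>h\<in>H. y = h \<circ> w) \<longrightarrow> len z \<le> len y" by blast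
  obtain h where h: "h \<in> H" "z = h \<circ> w" using z1 by blast
  have min: "len z \<le> len (h' \<circ> w)" if "h' \<in> H" for h' using z2 that by blast
  have z: "z \<in> AP" unfolding h(2) using H_props[OF h(1)] w AP_comp by blast
  have hAP: "h \<in> AP" and hw: "h ` {1..int n} = {1..int n}" using H_props[OF h(1)] by auto
  have "iv z (int i) < iv z (int i + 1)" if i: "i \<in> {1..<n}" for i
  proof (rule ccontr)
    assume "\<not> iv z (int i) < iv z (int i + 1)"
    then have "iv z (int i + 1) < iv z (int i)"
      using AP_neq[OF AP_inv[OF z], of "int i" "int i + 1"] by simp
    then have "len (S i \<circ> z) < len z" by (rule len_S_comp_less[OF z])
    moreover have "len z \<le> len (S i \<circ> z)"
      using min[OF H_S_comp[OF i h(1)]] unfolding h(2) comp_assoc .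
    ultimately show False by simp
  qed
  then have ascz: "ascending (iv z)" by (simp add: ascending_def)
  have "iv h ` {1..int n} = {1..int n}"
  proof -
    have "iv h ` h ` {1..int n} = {1..int n}" unfolding image_image using inv_AP_simps(1)[OF hAP] by simp
    then show ?thesis unfolding hw .
  qed
  then have "iv z ` {1..int n} = iv w ` {1..int n}"
    unfolding h(2) inv_comp_AP[OF hAP w] image_comp[symmetric] by (simp only:)
  then have "iv z = iv w" using ascending_unique[OF AP_inv[OF z] AP_inv[OF w] ascz asc] by blast
  then have "z = w" using inv_AP_simps(5)[OF z] inv_AP_simps(5)[OF w] by metis
  then have min': "len w \<le> len (h' \<circ> w)" if "h' \<in> H" for h' using min[OF that] by (simp only:)
  show "grassmannian n w"
    unfolding grassmannian_def is_arg_min_def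
  proof (intro conjI notI w)
    show "w \<in> H #>\<^bsub>affine_group n\<^esub> w" unfolding coset_iff using H_id id_comp by metis
    assume "\<exists>y. y \<in> H #>\<^bsub>affine_group n\<^esub> w \<and> coxeter_length n y < coxeter_length n w"
    then obtain h' where h': "h' \<in> H" "coxeter_length n (h' \<circ> w) < coxeter_length n w" unfolding coset_iff by blast
    have "h' \<circ> w \<in> AP" using H_props[OF h'(1)] w AP_comp by blast
    then show False using h'(2) min'[OF h'(1)] unfolding coxeter_length_eq[OF w] using coxeter_length_eq by simp
  qed
qed

section \<open>Grassmannian elements and partitions\<close>

lemma code_at_strict:
  assumes "x \<in> AP" "x (i + 1) < x i"
  shows "code_at x (i + 1) < code_at x i"
  unfolding code_at_def
proof (rule psubset_card_mono[OF finite_code[OF assms(1)]])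
  have "i + 1 \<in> {j. i < j \<and> x j < x i}" using assms(2) by simp
  moreover have "i + 1 \<notin> {j. i + 1 < j \<and> x j < x (i + 1)}" by simp
  moreover have "{j. i + 1 < j \<and> x j < x (i + 1)} \<subseteq> {j. i < j \<and> x j < x i}"
  proof
    fix j assume "j \<in> {j. i + 1 < j \<and> x j < x (i + 1)}"
    then show "j \<in> {j. i < j \<and> x j < x i}" using assms(2) by auto
  qed
  ultimately show "{j. i + 1 < j \<and> x j < x (i + 1)} \<subset> {j. i < j \<and> x j < x i}" by blast
qed

lemma ascending_code:
  assumes "x \<in> AP"
  shows "ascending x \<longleftrightarrow> (\<forall>i\<in>{1..<n}. code_at x (int i) \<le> code_at x (int i + 1))"
proof -
  have "x i < x (i + 1) \<longleftrightarrow> code_at x i \<le> code_at x (i + 1)" for i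
    using code_at_mono[OF assms, of i] code_at_strict[OF assms, of i] AP_neq[OF assms, of i "i + 1"] by fastforce
  then show ?thesis unfolding ascending_def by simp
qed

lemma sorted_code:
  assumes "x \<in> AP" "ascending x"
  shows "sorted (code n x)"
  unfolding code_eq sorted_iff_nth_Suc
proof (intro allI impI)
  fix i assume i: "Suc i < length (map (\<lambda>i. code_at x (int i)) [1..<Suc n])"
  then have "code_at x (int (Suc i)) \<le> code_at x (int (Suc i) + 1)"
    by (intro code_at_mono[OF assms(1)] ascendingD[OF assms(2)]) auto
  then show "map (\<lambda>i. code_at x (int i)) [1..<Suc n] ! i \<le> map (\<lambda>i. code_at x (int i)) [1..<Suc n] ! Suc i"
    using i by (simp add: algebra_simps del: upt_Suc)
qed

lemma filter_length_determines_mset: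
  fixes xs ys :: "nat list"
  assumes "\<And>j. length (filter (\<lambda>x. j \<le> x) xs) = length (filter (\<lambda>x. j \<le> x) ys)"
  shows "mset xs = mset ys"
proof (rule multiset_eqI)
  have "length (filter (\<lambda>x. a \<le> x) zs) = count (mset zs) a + length (filter (\<lambda>x. Suc a \<le> x) zs)" for a zs
    by (induction zs) auto
  then show "count (mset xs) a = count (mset ys) a" for a
    using assms[of a] assms[of "Suc a"] by (metis add_right_cancel)
qed

text \<open>Prefix sums of the shape give \<open>cap\<close>, their differences give
  \<open>cnt\<close>, and these determine the multiset of the code. For a Grassmannian element the
  code is sorted, hence known as a list.\<close>

theorem shape_inj:
  assumes "grassmannian n v" "grassmannian n w" "shape n v = shape n w"
  shows "v = w"
proof -
  have v: "v \<in> AP" "ascending (iv v)" and w: "w \<in> AP" "ascending (iv w)"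
    using assms grassmannian_iff by auto
  have cap: "cap v k = cap w k" for k
    using sum_take_shape[OF v(1), of k] sum_take_shape[OF w(1), of k] assms(3) by simp
  have cnt: "cnt v j = cnt w j" for j
  proof (cases j)
    case 0
    then show ?thesis by (simp add: cnt_def)
  next
    case (Suc k)
    have "cap z (Suc k) = cap z k + cnt z (Suc k)" for z
      using sum_cnt[of z k] sum_cnt[of z "Suc k"] by simp
    then show ?thesis using cap[of k] cap[of "Suc k"] Suc by (metis add_left_cancel)
  qed
  have "length (filter (\<lambda>c. j \<le> c) (code n (iv v))) = length (filter (\<lambda>c. j \<le> c) (code n (iv w)))" for j
    using cnt[of j] unfolding length_filter_code[OF AP_inv[OF v(1)]] length_filter_code[OF AP_inv[OF w(1)]] cnt_def .
  then have "mset (code n (iv v)) = mset (code n (iv w))" by (rule filter_length_determines_mset)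
  then have "code n (iv v) = code n (iv w)"
    using sorted_code[OF AP_inv[OF v(1)] v(2)] sorted_code[OF AP_inv[OF w(1)] w(2)]
    by (metis properties_for_sort)
  then have eq: "code_at (iv v) (int k) = code_at (iv w) (int k)" if "k \<in> {1..<Suc n}" for k
    using that unfolding code_eq by (simp del: upt_Suc)
  have "iv v = iv w"
  proof (rule code_inj[OF AP_inv[OF v(1)] AP_inv[OF w(1)]])
    fix m
    define k where "k = nat ((m - 1) mod int n) + 1"
    have k: "int k = (m - 1) mod int n + 1" "k \<in> {1..<Suc n}"
      using n3 pos_mod_bound[of "int n" "m - 1"] by (simp_all add: k_def nat_less_iff)
    then have m: "m = int k + ((m - 1) div int n) * int n" by simp
    have "code_at x (int k + ((m - 1) div int n) * int n) = code_at x (int k)" if "x \<in> AP" for x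
      by (rule periodic_mult) (rule code_at_shift[OF that])
    then show "code_at (iv v) m = code_at (iv w) m"
      using eq[OF k(2)] AP_inv[OF v(1)] AP_inv[OF w(1)] m by metis
  qed
  then show ?thesis using inv_AP_simps(5)[OF v(1)] inv_AP_simps(5)[OF w(1)] by metis
qed

theorem shape_surj:
  assumes "l \<in> Par n"
  shows "\<exists>w. grassmannian n w \<and> shape n w = l"
proof -
  have dec: "l ! t \<le> l ! s" if "s \<le> t" "t < length l" for s t
    using assms that unfolding Par_def by (cases "s = t") (auto simp: sorted_wrt_iff_nth_less)
  have bnd: "1 \<le> l ! t" "l ! t \<le> n - 1" if "t < length l" for t
    using assms that unfolding Par_def by auto
  define r where "r m = nat ((m - 1) mod int n) + 1" for m
  \<comment> \<open>With \<open>r m\<close> the representative of \<open>m\<close> in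
    \<open>1..n\<close>, position \<open>i\<close> gets the number of parts exceeding
    \<open>n - i\<close>. This is the conjugate partition in increasing order; position 1 gets 0
    because parts are at most \<open>n - 1\<close>, and \<open>code_surj\<close> needs this
    zero.\<close>
  define g where "g m = card {t. t < length l \<and> n - r m < l ! t}" for m
  have r_shift: "r (m + int n) = r m" for m
  proof -
    have "m + int n - 1 = (m - 1) + int n" by simp
    then show ?thesis unfolding r_def by (simp only: mod_add_self2)
  qed
  have r_nat: "r (int i) = i" if "i \<in> {1..<Suc n}" for i
  proof -
    have "(int i - 1) mod int n = int i - 1" using that by (intro mod_pos_pos_trivial) auto
    moreover have "Suc 0 \<le> i" using that by simp
    ultimately show ?thesis by (simp add: r_def nat_diff_distrib)
  qed
  have g_shift: "g (m + int n) = g m" for m by (simp add: g_def r_shift)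
  have "{t. t < length l \<and> n - r (int 1) < l ! t} = {}"
    using bnd(2) r_nat[of 1] n3 by fastforce
  then have "g (int 1) = 0" by (simp only: g_def card.empty)
  then obtain x where x: "x \<in> AP" "\<And>m. code_at x m = g m" using code_surj[of g "int 1"] g_shift by blast
  define w where "w = iv x"
  have w: "w \<in> AP" "iv w = x" unfolding w_def using x(1) by (rule AP_inv, rule inv_AP_simps(5))
  have "ascending x"
    unfolding ascending_code[OF x(1)] x(2)
  proof
    fix i assume i: "i \<in> {1..<n}"
    have "r (int i) = i" "r (int i + 1) = Suc i" using r_nat[of i] r_nat[of "Suc i"] i by (simp_all add: add.commute)
    then show "g (int i) \<le> g (int i + 1)" unfolding g_def by (intro card_mono) auto
  qed
  then have G: "grassmannian n w" unfolding grassmannian_iff w(2) using w(1) by blast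
  have g_ge: "Suc t \<le> g (int i) \<longleftrightarrow> t < length l \<and> n - i < l ! t" if i: "i \<in> {1..<Suc n}" for i t
  proof
    assume "t < length l \<and> n - i < l ! t"
    then have "{..t} \<subseteq> {t. t < length l \<and> n - r (int i) < l ! t}"
      using dec r_nat[OF i] by (auto intro: less_le_trans)
    then have "card {..t} \<le> g (int i)" unfolding g_def by (intro card_mono) auto
    then show "Suc t \<le> g (int i)" by simp
  next
    assume ge: "Suc t \<le> g (int i)"
    show "t < length l \<and> n - i < l ! t"
    proof (rule ccontr)
      assume not: "\<not> (t < length l \<and> n - i < l ! t)"
      have "{t. t < length l \<and> n - r (int i) < l ! t} \<subseteq> {..<t}"
      proof
        fix s assume "s \<in> {t. t < length l \<and> n - r (int i) < l ! t}"
        then have s: "s < length l" "n - i < l ! s" using r_nat[OF i] by auto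
        show "s \<in> {..<t}"
        proof (rule ccontr)
          assume "s \<notin> {..<t}"
          then have "t \<le> s" by simp
          then show False using dec[of t s] s not by linarith
        qed
      qed
      then have "g (int i) \<le> card {..<t}" unfolding g_def by (intro card_mono) auto
      then show False using ge by simp
    qed
  qed
  have cnt: "cnt w (Suc t) = (if t < length l then l ! t else 0)" for t
  proof -
    have "cnt w (Suc t) = (\<Sum>i<n. if Suc t \<le> g (int i) then 1 else 0)"
      unfolding cnt_def w(2) x(2) using card_as_sum[of "{..<n}" "\<lambda>i. Suc t \<le> g (int i)"] by simp
    also have "\<dots> = (\<Sum>i\<in>{1..<Suc n}. if Suc t \<le> g (int i) then 1 else 0)"
      by (rule sum_window[of "\<lambda>m. if Suc t \<le> g m then 1 else 0", symmetric]) (simp only: g_shift)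
    also have "\<dots> = card {i \<in> {1..<Suc n}. Suc t \<le> g (int i)}" by (rule card_as_sum[symmetric]) simp
    also have "{i \<in> {1..<Suc n}. Suc t \<le> g (int i)} = (if t < length l then {n - l ! t<..n} else {})"
      using g_ge bnd(2)[of t] n3 by auto
    finally show ?thesis using bnd(2)[of t] by auto
  qed
  have "shape n w = map (cnt w) [1..<Suc (length l)]"
  proof (rule shape_eqI[OF w(1)])
    fix j :: nat assume "1 \<le> j"
    then obtain t where "j = Suc t" by (cases j) auto
    then show "0 < cnt w j \<longleftrightarrow> j \<le> length l" using cnt[of t] bnd(1)[of t] by auto
  qed
  also have "\<dots> = l" by (rule nth_equalityI) (simp_all add: cnt del: upt_Suc)
  finally show ?thesis using G by blast
qed

abbreviation "gof \<equiv> grassmannian_of n"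

lemma gof:
  assumes "l \<in> Par n"
  shows "grassmannian n (gof l)" "shape n (gof l) = l"
proof -
  have inj: "inj_on (shape n) {v. grassmannian n v}" using shape_inj by (auto intro: inj_onI)
  have im: "l \<in> shape n ` {v. grassmannian n v}" using shape_surj[OF assms] by blast
  show "shape n (gof l) = l" unfolding grassmannian_of_def by (rule f_the_inv_into_f[OF inj im])
  have "gof l \<in> {v. grassmannian n v}"
    unfolding grassmannian_of_def by (rule the_inv_into_into[OF inj im]) simp
  then show "grassmannian n (gof l)" by simp
qed

lemma gof_shape: "grassmannian n w \<Longrightarrow> gof (shape n w) = w"
  using gof[OF shape_Par[of w]] grassmannian_iff shape_inj by blast

section \<open>The diagram automorphism\<close>

definition star :: "(int \<Rightarrow> int) \<Rightarrow> int \<Rightarrow> int" where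
  "star w j = 1 - w (1 - j)"

lemma star_star: "star (star w) = w" by (simp add: star_def fun_eq_iff)

lemma star_comp: "star (v \<circ> w) = star v \<circ> star w" by (simp add: star_def fun_eq_iff)

lemma star_id: "star id = id" by (simp add: star_def fun_eq_iff)

lemma star_AP:
  assumes "w \<in> AP"
  shows "star w \<in> AP"
proof -
  have b: "bij w" using AP_bij[OF assms] .
  have "star w \<circ> star (iv w) = id" "star (iv w) \<circ> star w = id"
    unfolding star_comp[symmetric] inv_AP_simps(3,4)[OF assms] star_id by (rule refl)+
  then have "bij (star w)" using o_bij by blast
  moreover have sh: "star w (i + int n) = star w i + int n" for i
    using AP_shift[OF assms, of "1 - i - int n"] by (simp add: star_def algebra_simps)
  moreover have "(\<Sum>k<n. star w (int k) - int k) = 0"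
  proof -
    have "(\<Sum>k<n. star w (int k) - int k) = - (\<Sum>k<n. w (1 - int k) - (1 - int k))"
      by (simp add: star_def sum_negf[symmetric] algebra_simps)
    also have "(\<Sum>k<n. w (1 - int k) - (1 - int k)) = (\<Sum>m\<in>(\<lambda>k. 1 - int k) ` {..<n}. w m - m)"
      by (subst sum.reindex) (auto simp: inj_on_def)
    also have "(\<lambda>k. 1 - int k) ` {..<n} = {2 - int n..<2 - int n + int n}"
    proof
      show "{2 - int n..<2 - int n + int n} \<subseteq> (\<lambda>k. 1 - int k) ` {..<n}"
      proof
        fix m assume "m \<in> {2 - int n..<2 - int n + int n}"
        then show "m \<in> (\<lambda>k. 1 - int k) ` {..<n}" by (intro image_eqI[of _ _ "nat (1 - m)"]) auto
      qed
    qed auto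
    also have "(\<Sum>m\<in>{2 - int n..<2 - int n + int n}. w m - m) = (\<Sum>k<n. w (int k) - int k)"
      using AP_shift[OF assms] by (intro sum_ressys ressys_interval) simp
    finally show ?thesis using assms by (simp add: AP_iff)
  qed
  ultimately show ?thesis by (simp add: AP_iff)
qed

lemma star_inv:
  assumes "w \<in> AP"
  shows "iv (star w) = star (iv w)"
  by (rule inv_unique_comp)
    (simp_all only: star_comp[symmetric] inv_AP_simps(3,4)[OF assms] star_id)

lemma S_mod: "S (i mod n) = S i"
  unfolding simple_refl_def by (auto simp: fun_eq_iff of_nat_mod mod_add_left_eq)

text \<open>\<open>star\<close> is conjugation by the reflection sending \<open>j\<close> to
  \<open>1 - j\<close>. It carries the pair \<open>i, i + 1\<close> to \<open>1 - i, - i\<close>,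
  which modulo \<open>n\<close> is the pair exchanged by \<open>S (n - i)\<close>.\<close>

lemma star_S:
  assumes "i \<le> n"
  shows "star (S i) = S (n - i)"
proof
  fix j
  have dv: "int n dvd a \<longleftrightarrow> int n dvd b" if "a = - b - int n" for a b
    using that by (metis dvd_add_triv_right_iff dvd_minus_iff diff_add_cancel)
  have 1: "int n dvd (1 - j) - int i \<longleftrightarrow> int n dvd j - int (n - i) - 1"
    using assms by (intro dv) (simp add: of_nat_diff)
  have 2: "int n dvd (1 - j) - int i - 1 \<longleftrightarrow> int n dvd j - int (n - i)"
    using assms by (intro dv) (simp add: of_nat_diff)
  have 3: "\<not> (int n dvd j - int (n - i) \<and> int n dvd j - int (n - i) - 1)"
    using dvd_consecutive(2)[OF n3'] by blast
  show "star (S i) j = S (n - i) j"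
    unfolding star_def S_eq[of i] S_eq[of "n - i"] 1 2 using 3 by auto
qed

definition neg :: "nat \<Rightarrow> nat" where "neg i = (n - i) mod n"

lemma star_prodw: "set is \<subseteq> {..<n} \<Longrightarrow> star (prodw is) = prodw (map neg is)"
proof (induction "is")
  case Nil
  show ?case by (simp only: prodw_simps list.map star_id)
next
  case (Cons i "is")
  have "star (S i) = S (neg i)" using Cons.prems unfolding neg_def S_mod by (intro star_S) auto
  moreover have "star (prodw is) = prodw (map neg is)" using Cons by simp
  ultimately show ?case by (simp only: prodw_simps list.map star_comp)
qed

lemma len_star:
  assumes "w \<in> AP"
  shows "len (star w) = len w"
proof -
  have le: "len (star w) \<le> len w" if w: "w \<in> AP" for w
  proof -
    obtain "is" where "is": "set is \<subseteq> {..<n}" "length is = len w" "w = prodw is" using reduced_word_exists[OF w] by blast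
    have "star w = prodw (map neg is)" unfolding "is"(3) by (rule star_prodw[OF "is"(1)])
    then show ?thesis using len_prodw_comp[OF AP_id, of "map neg is"] "is"(2) by simp
  qed
  have "len (star (star w)) \<le> len (star w)" by (rule le[OF star_AP[OF assms]])
  then show ?thesis using le[OF assms] unfolding star_star by simp
qed

text \<open>Values on generators fix an automorphism on all words, and extensionality fixes it off
  the group, so the restriction of \<open>star\<close> is the only candidate.\<close>

theorem affine_star_eq:
  assumes "w \<in> AP"
  shows "affine_star n w = star w"
proof -
  let ?f = "restrict star AP"
  let ?P = "\<lambda>\<phi>. \<phi> \<in> auto (affine_group n) \<and> (\<forall>i<n. \<phi> (S i) = S (n - i))"
  have f: "?P ?f"
  proof (intro conjI allI impI)
    show "?f \<in> auto (affine_group n)"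
      unfolding auto_def Bij_def hom_def affine_group_simps
    proof (intro IntI CollectI conjI ballI)
      show "?f \<in> AP \<rightarrow> AP" using star_AP by auto
      show "?f (x \<circ> y) = ?f x \<circ> ?f y" if "x \<in> AP" "y \<in> AP" for x y
        using that AP_comp[OF that] by (simp only: restrict_apply if_True star_comp)
      show "bij_betw ?f AP AP"
        by (rule bij_betw_byWitness[of _ star]) (auto simp: star_star star_AP)
    qed simp
    fix i assume "i < n"
    then show "?f (S i) = S (n - i)" using star_S[of i] AP_S[of i] by simp
  qed
  have uniq: "\<phi> = ?f" if P: "?P \<phi>" for \<phi>
  proof -
    have hom: "\<phi> (x \<circ> y) = \<phi> x \<circ> \<phi> y" if "x \<in> AP" "y \<in> AP" for x y
      using P that unfolding auto_def hom_def affine_group_simps by blast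
    have ext: "\<phi> \<in> extensional AP" and cl: "\<phi> x \<in> AP" if "x \<in> AP" for x
      using P that unfolding auto_def hom_def Bij_def affine_group_simps by blast+
    have one: "\<phi> id = id"
    proof -
      have "\<phi> id \<circ> \<phi> id = \<phi> id" using hom[OF AP_id AP_id] unfolding comp_id by metis
      then have "iv (\<phi> id) \<circ> (\<phi> id \<circ> \<phi> id) = iv (\<phi> id) \<circ> \<phi> id" by (rule arg_cong)
      then show ?thesis unfolding comp_assoc[symmetric] inv_AP_simps(3)[OF cl[OF AP_id]] id_comp .
    qed
    have words: "set is \<subseteq> {..<n} \<Longrightarrow> \<phi> (prodw is) = star (prodw is)" for "is"
    proof (induction "is")
      case Nil
      show ?case unfolding prodw_simps one star_id ..
    next
      case (Cons i "is")
      have "\<phi> (S i) = star (S i)" using P Cons.prems star_S[of i] by auto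
      moreover have "\<phi> (prodw is) = star (prodw is)" using Cons by simp
      ultimately show ?case unfolding prodw_simps hom[OF AP_S prodw_AP] star_comp by (simp only:)
    qed
    show ?thesis
    proof (rule extensionalityI[OF ext[OF AP_id]])
      show "?f \<in> extensional AP" by simp
      fix x assume x: "x \<in> AP"
      then obtain "is" where "set is \<subseteq> {..<n}" "x = prodw is" using reduced_word_exists by metis
      then show "\<phi> x = ?f x" using words x by simp
    qed
  qed
  have "affine_star n = ?f" unfolding affine_star_def using f uniq by (rule the_equality)
  then show ?thesis using assms by simp
qed

lemma grassmannian_star:
  assumes "grassmannian n w"
  shows "grassmannian n (star w)"
proof -
  have w: "w \<in> AP" "ascending (iv w)" using assms grassmannian_iff by auto
  have "star (iv w) (int i) < star (iv w) (int i + 1)" if i: "i \<in> {1..<n}" for i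
  proof -
    have "iv w (int (n - i)) < iv w (int (n - i) + 1)"
      by (rule ascendingD[OF w(2)]) (use i in auto)
    moreover have "int (n - i) = - int i + int n" "int (n - i) + 1 = 1 - int i + int n" using i by (simp_all add: of_nat_diff)
    ultimately have "iv w (- int i + int n) < iv w (1 - int i + int n)" by (simp only:)
    then have "iv w (- int i) < iv w (1 - int i)"
      unfolding AP_shift[OF AP_inv[OF w(1)]] by simp
    then show ?thesis by (simp add: star_def)
  qed
  then show ?thesis unfolding grassmannian_iff star_inv[OF w(1)] ascending_def using star_AP[OF w(1)] by blast
qed

lemma par_star:
  assumes "l \<in> Par n"
  shows "par_star n l \<in> Par n" "gof (par_star n l) = star (gof l)" "par_star n (par_star n l) = l"
proof -
  have g: "grassmannian n (gof l)" "gof l \<in> AP" using gof(1)[OF assms] grassmannian_iff by auto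
  have gs: "grassmannian n (star (gof l))" "star (gof l) \<in> AP" using grassmannian_star[OF g(1)] grassmannian_iff by auto
  have e: "par_star n l = shape n (star (gof l))" unfolding par_star_def affine_star_eq[OF g(2)] ..
  show p: "par_star n l \<in> Par n" unfolding e by (rule shape_Par[OF gs(2)])
  show g2: "gof (par_star n l) = star (gof l)" unfolding e by (rule gof_shape[OF gs(1)])
  have "par_star n (par_star n l) = shape n (star (gof (par_star n l)))"
    unfolding par_star_def[of n "par_star n l"] g2 affine_star_eq[OF gs(2)] ..
  then show "par_star n (par_star n l) = l" unfolding g2 star_star gof(2)[OF assms] .
qed

end

subsection \<open>Symmetry of affine Stanley functions\<close>

text \<open>The locale \<open>nil_coxeter\<close> asks for a ring, so the additive operators are
  made into a type of their own.\<close>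

typedef endo = "{f :: group_vec \<Rightarrow> group_vec. \<forall>x y. f (x + y) = f x + f y}"
  morphisms app Abs_endo
  by (rule exI[of _ "\<lambda>x. x"]) simp

lemma app_add: "app a (x + y) = app a x + app a y"
  using app[of a] by simp

lemma endo_eqI: "(\<And>x. app a x = app b x) \<Longrightarrow> a = b"
  using app_inject by blast

lemma app_0_right: "app a 0 = 0"
  using app_add[of a 0 0] by simp

instantiation endo :: ring_1
begin

definition zero_endo where "0 = Abs_endo (\<lambda>_. 0)"
definition one_endo where "1 = Abs_endo (\<lambda>x. x)"
definition plus_endo where "a + b = Abs_endo (\<lambda>x. app a x + app b x)"
definition uminus_endo where "- a = Abs_endo (\<lambda>x. - app a x)"
definition minus_endo where "a - b = Abs_endo (\<lambda>x. app a x - app b x)"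
definition times_endo where "a * b = Abs_endo (\<lambda>x. app a (app b x))"

lemma app_simps:
  "app 0 x = 0" "app 1 x = x" "app (a + b) x = app a x + app b x" "app (- a) x = - app a x"
  "app (a - b) x = app a x - app b x" "app (a * b) x = app a (app b x)"
  unfolding zero_endo_def one_endo_def plus_endo_def uminus_endo_def minus_endo_def times_endo_def
  by (subst Abs_endo_inverse; simp add: app_add algebra_simps)+

instance
proof
  have "app (0 :: endo) (Poly_Mapping.single id 1) \<noteq> app 1 (Poly_Mapping.single id 1)"
    unfolding app_simps by (metis lookup_single_eq lookup_zero zero_neq_one)
  then show "(0 :: endo) \<noteq> 1" by metis
qed (rule endo_eqI; simp add: app_simps app_add algebra_simps)+

end

lemma app_sum: "app (sum g I) x = (\<Sum>i\<in>I. app (g i) x)"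
  by (induction I rule: infinite_finite_induct) (simp_all add: app_simps)

context affine
begin

section \<open>The operators satisfy the nilCoxeter relations\<close>

lemma S_block:
  assumes "int n dvd a - int i"
  shows "S i a = a + 1" "S i (a + 1) = a" "S i (a + 2) = a + 2"
    "S (Suc i) a = a" "S (Suc i) (a + 1) = a + 2" "S (Suc i) (a + 2) = a + 1"
  using dvd_consecutive[OF n3' assms] assms unfolding S_eq
  by (simp_all add: algebra_simps)

lemma prodw_3: "prodw [i, j, k] = S i \<circ> (S j \<circ> S k)" "prodw [i, j] = S i \<circ> S j"
  by (simp_all only: prodw_simps comp_id)

lemma braid_S: "prodw [i, Suc i mod n, i] = prodw [Suc i mod n, i, Suc i mod n]"
  unfolding prodw_3 S_mod
proof
  fix m
  consider "int n dvd m - int i" | "int n dvd (m - 1) - int i" | "int n dvd (m - 2) - int i"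
    | "\<not> int n dvd m - int i" "\<not> int n dvd (m - 1) - int i" "\<not> int n dvd (m - 2) - int i" by blast
  then show "(S i \<circ> (S (Suc i) \<circ> S i)) m = (S (Suc i) \<circ> (S i \<circ> S (Suc i))) m"
  proof cases
    case 1
    from S_block[OF this] show ?thesis by simp
  next
    case 2
    from S_block[OF this] show ?thesis by simp
  next
    case 3
    have e: "m - 2 + 1 = m - 1" "m - 2 + 2 = m" by simp_all
    from S_block[OF 3, unfolded e] show ?thesis by simp
  next
    case 4
    then have "S i m = m" "S (Suc i) m = m" by (simp_all add: S_eq algebra_simps)
    then show ?thesis by simp
  qed
qed

lemma far_S:
  assumes "i < n" "j < n" "i \<noteq> j" "j \<noteq> Suc i mod n" "i \<noteq> Suc j mod n" "int n dvd a - int i"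
  shows "S j a = a" "S j (a + 1) = a + 1"
proof -
  have c: "int n dvd a - c \<longleftrightarrow> int n dvd int i - c" for c
    using dvd_add_right_iff[OF assms(6), of "int i - c"] by simp
  have "\<not> int n dvd a - int j" "\<not> int n dvd a - int j - 1"
    using c[of "int j"] c[of "int j + 1"] res_eq[OF assms(2,1)] assms(3,5) by (simp_all add: diff_diff_eq)
  moreover have "\<not> int n dvd a + 1 - int j"
  proof -
    have "int n dvd int i + 1 - int j \<longleftrightarrow> int n dvd int j - int i - 1"
      using dvd_diff_commute[of "int n" "int i + 1" "int j"] by (simp add: diff_diff_eq)
    then show ?thesis using c[of "int j - 1"] res_eq(2)[OF assms(1,2)] assms(4) by (simp add: algebra_simps)
  qed
  ultimately show "S j a = a" "S j (a + 1) = a + 1" by (simp_all add: S_eq)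
qed

lemma commute_S:
  assumes "i < n" "j < n" "j \<noteq> Suc i mod n" "i \<noteq> Suc j mod n"
  shows "prodw [i, j] = prodw [j, i]"
proof (cases "i = j")
  case False
  show ?thesis
    unfolding prodw_3
  proof
    fix m
    note f = far_S[OF assms(1,2) False assms(3,4)] far_S[OF assms(2,1) False[symmetric] assms(4,3)]
    consider "int n dvd m - int i" | "int n dvd (m - 1) - int i" | "int n dvd m - int j" | "int n dvd (m - 1) - int j"
      | "\<not> int n dvd m - int i" "\<not> int n dvd (m - 1) - int i" "\<not> int n dvd m - int j" "\<not> int n dvd (m - 1) - int j"
      by blast
    then show "(S i \<circ> S j) m = (S j \<circ> S i) m"
    proof cases
      case 1
      from S_block(1,2)[OF this] f(1,2)[OF this] show ?thesis by simp
    next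
      case 2
      from S_block(1,2)[OF this] f(1,2)[OF this] show ?thesis by simp
    next
      case 3
      from S_block(1,2)[OF this] f(3,4)[OF this] show ?thesis by simp
    next
      case 4
      from S_block(1,2)[OF this] f(3,4)[OF this] show ?thesis by simp
    next
      case 5
      then have "S i m = m" "S j m = m" by (simp_all add: S_eq algebra_simps)
      then show ?thesis by simp
    qed
  qed
qed simp

lemma lookup_word_outside: "w \<notin> AP \<Longrightarrow> is \<noteq> [] \<Longrightarrow> lkp (foldr (u_act n) is f) w = 0"
  by (cases "is") (simp_all add: lookup_u_act)

text \<open>By \<open>lookup_word_act\<close> only the length and the product of a word matter, so
  group relations between words of equal length become relations of operators.\<close>

lemma word_act_cong:
  assumes "length is = length js" "prodw is = prodw js"
  shows "foldr (u_act n) is f = foldr (u_act n) js f"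
proof (cases "is = []")
  case False
  then have ne: "js \<noteq> []" using assms(1) by auto
  have r: "prodw (rev is) = prodw (rev js)" unfolding inv_prodw[symmetric] assms(2) ..
  show ?thesis
  proof (rule poly_mapping_eqI)
    fix w
    show "lkp (foldr (u_act n) is f) w = lkp (foldr (u_act n) js f) w"
    proof (cases "w \<in> AP")
      case True
      show ?thesis unfolding lookup_word_act[OF True] assms(1) r ..
    next
      case F: False
      show ?thesis unfolding lookup_word_outside[OF F False] lookup_word_outside[OF F ne] ..
    qed
  qed
qed (use assms in auto)

definition uo :: "nat \<Rightarrow> endo" where "uo i = Abs_endo (u_act n i)"

lemma app_uo: "app (uo i) f = u_act n i f"
  unfolding uo_def by (subst Abs_endo_inverse) (simp_all add: u_act_add)

lemma app_word: "app (prod_list (map uo is)) f = foldr (u_act n) is f"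
  by (induction "is") (simp_all add: app_simps app_uo)

interpretation nc: nil_coxeter n uo
proof
  show "3 \<le> n" by (rule n3)
  fix i assume i: "i < n"
  show "uo i * uo i = 0"
  proof (rule endo_eqI)
    fix f
    have "foldr (u_act n) [i, i] f = 0"
    proof (rule poly_mapping_eqI)
      fix w
      show "lkp (foldr (u_act n) [i, i] f) w = lkp 0 w"
      proof (cases "w \<in> AP")
        case True
        \<comment> \<open>The product is the identity, so the length would have to drop by two and
          stay the same.\<close>
        have "prodw (rev [i, i]) \<circ> w = w" unfolding rev.simps append.simps prodw_3 by (simp add: fun_eq_iff)
        then show ?thesis unfolding lookup_word_act[OF True] by simp
      next
        case False
        show ?thesis by (subst lookup_word_outside[OF False]) simp_all
      qed
    qed
    then show "app (uo i * uo i) f = app 0 f" by (simp add: app_simps app_uo)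
  qed
  show "uo i * uo (Suc i mod n) * uo i = uo (Suc i mod n) * uo i * uo (Suc i mod n)"
    using word_act_cong[OF _ braid_S, of i] by (intro endo_eqI) (simp add: app_simps app_uo)
  fix j assume "j < n" "j \<noteq> Suc i mod n" "i \<noteq> Suc j mod n"
  then show "uo i * uo j = uo j * uo i"
    using word_act_cong[OF _ commute_S[OF i], of j] by (intro endo_eqI) (simp add: app_simps app_uo)
qed

abbreviation "v1 \<equiv> Poly_Mapping.single (id :: int \<Rightarrow> int) (1 :: complex)"

lemma app_h: "app (nc.h k) f = h_act n k f"
  unfolding nc.h_def nc.u_dec_def nc.uprod_def app_sum app_word h_act_eq ..

lemma fold_h_act: "fold (h_act n) as f = app (prod_list (map nc.h (rev as))) f"
  by (induction as arbitrary: f) (simp_all add: app_simps app_h)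

lemma fac_app: "lkp (app (prod_list (map nc.h as)) v1) w = fac w (rev as)"
  unfolding fac_def fold_h_act rev_rev_ident ..

lemma fac_mset:
  assumes "mset as = mset bs"
  shows "fac w as = fac w bs"
proof -
  have "h_act n x \<circ> h_act n y = h_act n y \<circ> h_act n x" for x y
  proof
    fix f
    have "app (nc.h x * nc.h y) f = app (nc.h y * nc.h x) f" unfolding nc.h_commute[of x y] ..
    then show "(h_act n x \<circ> h_act n y) f = (h_act n y \<circ> h_act n x) f" by (simp add: app_simps app_h)
  qed
  then show ?thesis unfolding fac_def using fold_multiset_equiv[OF _ assms, of "h_act n"] by simp
qed

lemma h_act_0: "h_act n 0 f = f"
  unfolding app_h[symmetric] by (simp add: app_simps)

lemma fac_filter: "fac w (filter (\<lambda>x. 0 < x) as) = fac w as"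
proof -
  have "fold (h_act n) (filter (\<lambda>x. 0 < x) as) f = fold (h_act n) as f" for f
    by (induction as arbitrary: f) (auto simp: h_act_0)
  then show ?thesis by (simp add: fac_def)
qed

section \<open>Coefficients of monomials in the \<open>e k\<close>\<close>

definition eco :: "(int \<Rightarrow> int) \<Rightarrow> nat list \<Rightarrow> complex" where
  "eco w as = lkp (app (prod_list (map nc.e (rev as))) v1) w"

lemma eco_Nil: "eco w [] = (if w = id then 1 else 0)"
  by (simp add: eco_def app_simps lookup_single when_def eq_commute)

text \<open>\<open>u_inc\<close> acts by a reversed word, so stripping it multiplies by the
  decreasing word itself. The choice \<open>W\<close> stays open because \<open>fac_star\<close>
  uses negated words while \<open>fac_inv\<close> uses \<open>dec_word_of\<close>.\<close>

lemma eco_snoc: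
  assumes "w \<in> AP" "\<And>A. A \<subset> {..<n} \<Longrightarrow> dec_word n (W A) \<and> set (W A) = A"
  shows "eco w (as @ [k]) = (\<Sum>A | A \<subset> {..<n} \<and> card A = k.
    if len w = k + len (prodw (W A) \<circ> w) then eco (prodw (W A) \<circ> w) as else 0)"
proof -
  have "eco w (as @ [k]) = (\<Sum>A | A \<subset> {..<n} \<and> card A = k. lkp (app (nc.u_inc A) (app (prod_list (map nc.e (rev as))) v1)) w)"
    by (simp add: eco_def app_simps nc.e_def app_sum lookup_sum)
  also have "\<dots> = (\<Sum>A | A \<subset> {..<n} \<and> card A = k.
    if len w = k + len (prodw (W A) \<circ> w) then eco (prodw (W A) \<circ> w) as else 0)"
  proof (intro sum.cong refl)
    fix A assume A: "A \<in> {A. A \<subset> {..<n} \<and> card A = k}"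
    then have Ap: "A \<subset> {..<n}" and W: "dec_word n (W A)" "set (W A) = A" using assms(2) by auto
    have "length (rev (W A)) = k"
      using distinct_card[OF nc.dec_word_distinct[OF W(1)]] W(2) A by simp
    then show "lkp (app (nc.u_inc A) (app (prod_list (map nc.e (rev as))) v1)) w =
       (if len w = k + len (prodw (W A) \<circ> w) then eco (prodw (W A) \<circ> w) as else 0)"
      unfolding nc.u_inc_eq[OF W Ap] nc.uprod_def app_word lookup_word_act[OF assms(1)] eco_def rev_rev_ident
      by (simp only:)
  qed
  finally show ?thesis .
qed

lemma neg_eq: "i < n \<Longrightarrow> neg i = (if i = 0 then 0 else n - i)"
  by (auto simp: neg_def)

lemma neg_less: "i < n \<Longrightarrow> neg i < n"
  by (auto simp: neg_eq)

lemma neg_neg: "i < n \<Longrightarrow> neg (neg i) = i"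
  by (auto simp: neg_eq neg_less)

lemma neg_Suc: "x < n \<Longrightarrow> y < n \<Longrightarrow> neg x = Suc (neg y) mod n \<Longrightarrow> y = Suc x mod n"
  by (auto simp: neg_eq mod_Suc split: if_splits)

lemma neg_image_image: "A \<subseteq> {..<n} \<Longrightarrow> neg ` neg ` A = A"
  unfolding image_image using neg_neg by (force simp: image_iff)

lemma neg_image_proper:
  assumes "A \<subset> {..<n}"
  shows "neg ` A \<subset> {..<n}" "card (neg ` A) = card A"
proof -
  have inj: "inj_on neg {..<n}" using neg_neg by (metis inj_onI lessThan_iff)
  then have inj': "inj_on neg A" using assms inj_on_subset by blast
  then show c: "card (neg ` A) = card A" by (rule card_image)
  have "card A < n" using psubset_card_mono[OF _ assms] by simp
  then have "neg ` A \<noteq> {..<n}" using c by auto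
  moreover have "neg ` A \<subseteq> {..<n}" using assms neg_less by auto
  ultimately show "neg ` A \<subset> {..<n}" by blast
qed

lemma dec_word_neg:
  assumes "dec_word n is" "set is \<subseteq> {..<n}"
  shows "dec_word n (rev (map neg is))"
  unfolding dec_word_def sorted_wrt_rev sorted_wrt_map
proof (rule sorted_wrt_mono_rel[OF _ assms(1)[unfolded dec_word_def]])
  fix x y assume xy: "x \<in> set is" "y \<in> set is" "x \<noteq> y \<and> y \<noteq> Suc x mod n"
  then have "x < n" "y < n" using assms(2) by auto
  then show "neg y \<noteq> neg x \<and> neg x \<noteq> Suc (neg y) mod n" using xy(3) neg_neg neg_Suc by metis
qed

text \<open>Negating the letters reverses the orientation of the cycle: decreasing factors become
  increasing, and the order of the factors is kept.\<close>

theorem fac_star: "w \<in> AP \<Longrightarrow> fac (star w) as = eco w as"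
proof (induction as arbitrary: w rule: rev_induct)
  case Nil
  have "star w = id \<longleftrightarrow> w = id" using star_star star_id by metis
  then show ?case unfolding fac_Nil eco_Nil by (simp only:)
next
  case (snoc k as)
  let ?P = "{A. A \<subset> {..<n} \<and> card A = k}"
  define W where "W A = rev (map neg (dec_word_of n (neg ` A)))" for A
  have W: "dec_word n (W A) \<and> set (W A) = A" if "A \<subset> {..<n}" for A
    using word_of[OF neg_image_proper(1)[OF that]] dec_word_neg[of "dec_word_of n (neg ` A)"]
      neg_image_proper(1)[OF that] neg_image_image[of A] that unfolding W_def by auto
  let ?G = "\<lambda>A. if len w = k + len (prodw (W A) \<circ> w) then eco (prodw (W A) \<circ> w) as else 0"
  have "eco w (as @ [k]) = sum ?G ?P" by (rule eco_snoc[OF snoc.prems W])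
  also have "\<dots> = (\<Sum>A\<in>?P. ?G (neg ` A))"
    by (rule sum.reindex_bij_witness[of _ "image neg" "image neg"])
      (use neg_image_image neg_image_proper in \<open>auto simp: psubset_imp_subset\<close>)
  also have "\<dots> = (\<Sum>A\<in>?P. if len (star w) = k + len (strip A (star w)) then fac (strip A (star w)) as else 0)"
  proof (intro sum.cong refl)
    fix A assume "A \<in> ?P"
    then have A: "A \<subset> {..<n}" by simp
    have sw: "star w \<in> AP" by (rule star_AP[OF snoc.prems])
    have st: "strip A (star w) \<in> AP" by (rule AP_comp[OF prodw_AP sw])
    have sub: "set (rev (dec_word_of n A)) \<subseteq> {..<n}" using word_of(1)[OF A] A by auto
    have "W (neg ` A) = map neg (rev (dec_word_of n A))"
      unfolding W_def using neg_image_image[of A] A by (simp add: rev_map psubset_imp_subset)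
    then have "prodw (W (neg ` A)) = star (prodw (rev (dec_word_of n A)))" using star_prodw[OF sub] by simp
    then have e: "prodw (W (neg ` A)) \<circ> w = star (strip A (star w))" unfolding star_comp star_star by (simp only:)
    have "fac (strip A (star w)) as = eco (star (strip A (star w))) as"
      using snoc.IH[OF star_AP[OF st]] unfolding star_star .
    then show "?G (neg ` A) = (if len (star w) = k + len (strip A (star w)) then fac (strip A (star w)) as else 0)"
      unfolding e len_star[OF st] len_star[OF snoc.prems] by (simp only:)
  qed
  also have "\<dots> = fac (star w) (as @ [k])" by (rule fac_snoc[OF star_AP[OF snoc.prems], symmetric])
  finally show ?case ..
qed

abbreviation rstrip :: "nat set \<Rightarrow> (int \<Rightarrow> int) \<Rightarrow> int \<Rightarrow> int" where
  "rstrip A w \<equiv> w \<circ> prodw (rev (dec_word_of n A))"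

lemma len_strip_le:
  assumes "w \<in> AP" "A \<subset> {..<n}"
  shows "len w \<le> card A + len (strip A w)" "len w \<le> card A + len (rstrip A w)"
proof -
  let ?d = "dec_word_of n A"
  show "len w \<le> card A + len (strip A w)"
    using len_prodw_comp[OF AP_comp[OF prodw_AP assms(1)], of ?d "rev ?d"] word_of(4)[OF assms(2)]
    unfolding prodw_cancel by (simp only:)
  have i: "iv (rstrip A w) = prodw ?d \<circ> iv w"
    unfolding inv_comp_AP[OF assms(1) prodw_AP] inv_prodw rev_rev_ident ..
  have "len (iv w) \<le> card A + len (prodw ?d \<circ> iv w)"
    using len_prodw_comp[OF AP_comp[OF prodw_AP AP_inv[OF assms(1)]], of "rev ?d" ?d] word_of(4)[OF assms(2)]
    unfolding prodw_cancel length_rev by (simp only:)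
  then show "len w \<le> card A + len (rstrip A w)"
    unfolding i[symmetric] len_inv[OF assms(1)] len_inv[OF AP_comp[OF assms(1) prodw_AP]] .
qed

lemma strip_id_iff: "strip A w = id \<longleftrightarrow> rstrip A w = id"
proof
  let ?d = "dec_word_of n A"
  have c: "prodw ?d \<circ> prodw (rev ?d) = id" "prodw (rev ?d) \<circ> prodw ?d = id"
    using prodw_cancel[of ?d id] unfolding comp_id by (simp_all only: comp_id)
  show "rstrip A w = id" if "strip A w = id"
  proof -
    have "w = prodw ?d" using prodw_cancel(1)[of ?d w] unfolding that comp_id by (rule sym)
    then show ?thesis using c by (simp only:)
  qed
  show "strip A w = id" if "rstrip A w = id"
  proof -
    have "w = rstrip A w \<circ> prodw ?d" unfolding comp_assoc c comp_id ..
    then have "w = prodw ?d" unfolding that id_comp .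
    then show ?thesis using c by (simp only:)
  qed
qed

text \<open>Inversion needs factors stripped on the right, whereas \<open>fac_snoc\<close> strips on
  the left. The two kinds of stripping commute by associativity; each loses at most as much length
  as it has letters, so the combined length condition splits in either order.\<close>

lemma fac_Cons:
  "w \<in> AP \<Longrightarrow> fac w (k # as) = (\<Sum>A | A \<subset> {..<n} \<and> card A = k.
    if len w = k + len (rstrip A w) then fac (rstrip A w) as else 0)"
proof (induction as arbitrary: w rule: rev_induct)
  case Nil
  have "fac w [k] = (\<Sum>A | A \<subset> {..<n} \<and> card A = k.
    if len w = k + len (strip A w) then fac (strip A w) [] else 0)"
    using fac_snoc[OF Nil, of "[]" k] unfolding append.simps .
  also have "\<dots> = (\<Sum>A | A \<subset> {..<n} \<and> card A = k.
    if len w = k + len (rstrip A w) then fac (rstrip A w) [] else 0)"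
  proof (intro sum.cong refl)
    fix A
    show "(if len w = k + len (strip A w) then fac (strip A w) [] else 0) =
      (if len w = k + len (rstrip A w) then fac (rstrip A w) [] else 0)"
    \<comment> \<open>A single factor must exhaust \<open>w\<close>, and stripping it on the left or
      on the right does so for the same sets \<open>A\<close>.\<close>
    proof (cases "strip A w = id")
      case True
      then have "rstrip A w = id" using strip_id_iff by blast
      with True show ?thesis by (simp only:)
    next
      case False
      then have "rstrip A w \<noteq> id" using strip_id_iff by blast
      with False show ?thesis by (simp only: fac_Nil if_False if_cancel)
    qed
  qed
  finally show ?case .
next
  case (snoc l as)
  let ?P = "\<lambda>k. {A. A \<subset> {..<n} \<and> card A = k}"
  let ?Z = "\<lambda>A B. rstrip B (strip A w)"
  let ?F = "\<lambda>A B. if len w = l + (k + len (?Z A B)) then fac (?Z A B) as else 0"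
  have s: "strip A w \<in> AP" "rstrip A w \<in> AP" for A
    by (rule AP_comp[OF prodw_AP snoc.prems], rule AP_comp[OF snoc.prems prodw_AP])
  have Z: "strip A (rstrip B w) = ?Z A B" for A B by (rule comp_assoc[symmetric])
  have "fac w (k # as @ [l]) = (\<Sum>A\<in>?P l. if len w = l + len (strip A w) then fac (strip A w) (k # as) else 0)"
    using fac_snoc[OF snoc.prems, of "k # as" l] unfolding append.simps .
  also have "\<dots> = (\<Sum>A\<in>?P l. \<Sum>B\<in>?P k. ?F A B)"
  proof (rule sum.cong[OF refl])
    fix A assume A: "A \<in> ?P l"
    have IH: "fac (strip A w) (k # as) = (\<Sum>B\<in>?P k. if len (strip A w) = k + len (?Z A B) then fac (?Z A B) as else 0)"
      by (rule snoc.IH[OF s(1)])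
    have "(if len w = l + len (strip A w) then fac (strip A w) (k # as) else 0) =
      (\<Sum>B\<in>?P k. if len w = l + len (strip A w) then if len (strip A w) = k + len (?Z A B) then fac (?Z A B) as else 0 else 0)"
      unfolding IH by simp
    also have "\<dots> = (\<Sum>B\<in>?P k. ?F A B)"
    proof (rule sum.cong[OF refl])
      fix B assume B: "B \<in> ?P k"
      have "len w \<le> l + len (strip A w)" using len_strip_le(1)[OF snoc.prems, of A] A by simp
      moreover have "len (strip A w) \<le> k + len (?Z A B)" using len_strip_le(2)[OF s(1)[of A], of B] B by simp
      ultimately have "len w = l + (k + len (?Z A B)) \<longleftrightarrow> len w = l + len (strip A w) \<and> len (strip A w) = k + len (?Z A B)"
        by linarith
      then show "(if len w = l + len (strip A w) then if len (strip A w) = k + len (?Z A B) then fac (?Z A B) as else 0 else 0) = ?F A B"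
        by presburger
    qed
    finally show "(if len w = l + len (strip A w) then fac (strip A w) (k # as) else 0) = (\<Sum>B\<in>?P k. ?F A B)" .
  qed
  also have "\<dots> = (\<Sum>B\<in>?P k. \<Sum>A\<in>?P l. ?F A B)" by (rule sum.swap)
  also have "\<dots> = (\<Sum>B\<in>?P k. if len w = k + len (rstrip B w) then fac (rstrip B w) (as @ [l]) else 0)"
  proof (rule sum.cong[OF refl])
    fix B assume B: "B \<in> ?P k"
    have IH: "fac (rstrip B w) (as @ [l]) = (\<Sum>A\<in>?P l. if len (rstrip B w) = l + len (?Z A B) then fac (?Z A B) as else 0)"
      using fac_snoc[OF s(2)[of B], of as l] unfolding Z .
    have "(\<Sum>A\<in>?P l. ?F A B) = (\<Sum>A\<in>?P l. if len w = k + len (rstrip B w) then if len (rstrip B w) = l + len (?Z A B) then fac (?Z A B) as else 0 else 0)"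
    proof (rule sum.cong[OF refl])
      fix A assume A: "A \<in> ?P l"
      have "len w \<le> k + len (rstrip B w)" using len_strip_le(2)[OF snoc.prems, of B] B by simp
      moreover have "len (rstrip B w) \<le> l + len (?Z A B)" using len_strip_le(1)[OF s(2)[of B], of A] A unfolding Z by simp
      ultimately have "len w = l + (k + len (?Z A B)) \<longleftrightarrow> len w = k + len (rstrip B w) \<and> len (rstrip B w) = l + len (?Z A B)"
        by linarith
      then show "?F A B = (if len w = k + len (rstrip B w) then if len (rstrip B w) = l + len (?Z A B) then fac (?Z A B) as else 0 else 0)"
        by presburger
    qed
    also have "\<dots> = (if len w = k + len (rstrip B w) then fac (rstrip B w) (as @ [l]) else 0)"
      unfolding IH by simp
    finally show "(\<Sum>A\<in>?P l. ?F A B) = (if len w = k + len (rstrip B w) then fac (rstrip B w) (as @ [l]) else 0)" .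
  qed
  finally show ?case .
qed

text \<open>Inversion reverses words: decreasing factors become increasing ones and their order is
  reversed.\<close>

theorem fac_inv: "w \<in> AP \<Longrightarrow> fac (iv w) as = eco w (rev as)"
proof (induction as arbitrary: w)
  case Nil
  have "iv w = id \<longleftrightarrow> w = id" using inv_AP_simps(5)[OF Nil] inv_id by metis
  then show ?case unfolding fac_Nil eco_Nil rev.simps by (simp only:)
next
  case (Cons k as)
  let ?P = "{A. A \<subset> {..<n} \<and> card A = k}"
  have "fac (iv w) (k # as) = (\<Sum>A\<in>?P. if len (iv w) = k + len (rstrip A (iv w)) then fac (rstrip A (iv w)) as else 0)"
    by (rule fac_Cons[OF AP_inv[OF Cons.prems]])
  also have "\<dots> = (\<Sum>A\<in>?P. if len w = k + len (prodw (dec_word_of n A) \<circ> w)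
      then eco (prodw (dec_word_of n A) \<circ> w) (rev as) else 0)"
  proof (intro sum.cong refl)
    fix A
    have d: "prodw (dec_word_of n A) \<circ> w \<in> AP" by (rule AP_comp[OF prodw_AP Cons.prems])
    have "rstrip A (iv w) = iv (prodw (dec_word_of n A) \<circ> w)"
      unfolding inv_comp_AP[OF prodw_AP Cons.prems] inv_prodw ..
    then show "(if len (iv w) = k + len (rstrip A (iv w)) then fac (rstrip A (iv w)) as else 0) =
       (if len w = k + len (prodw (dec_word_of n A) \<circ> w) then eco (prodw (dec_word_of n A) \<circ> w) (rev as) else 0)"
      using Cons.IH[OF d] len_inv[OF d] len_inv[OF Cons.prems] by (simp only:)
  qed
  also have "\<dots> = eco w (rev (k # as))"
    unfolding rev.simps using word_of by (intro eco_snoc[OF Cons.prems, symmetric]) auto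
  finally show ?case .
qed

text \<open>Both sides are values of \<open>eco w\<close>, with the entries in opposite orders; the
  symmetry \<open>fac_mset\<close> removes the difference.\<close>

lemma fac_inv_star: "w \<in> AP \<Longrightarrow> fac (iv w) as = fac (star w) as"
  using fac_inv[of w as] fac_star[of w "rev as"] fac_mset[of "rev as" as] by simp

text \<open>Taking the coefficient at a fixed element is additive in the operator, so the relation
  extends from the monomials in \<open>h\<close> to \<open>nc.hspan\<close>; at a monomial in
  \<open>e\<close> it reads as a relation between the starred elements.\<close>

lemma relation_star:
  assumes "finite I" "w \<in> AP" "\<And>l. l \<in> I \<Longrightarrow> W l \<in> AP"
    and "\<And>as. set as \<subseteq> {..<n} \<Longrightarrow> fac w as = (\<Sum>l\<in>I. b l * fac (W l) as)"
    and "set as \<subseteq> {..<n}"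
  shows "fac (star w) as = (\<Sum>l\<in>I. b l * fac (star (W l)) as)"
proof -
  have "lkp (app X v1) w = (\<Sum>l\<in>I. b l * lkp (app X v1) (W l))" if "X \<in> nc.hspan" for X
    using that
  proof induction
    case (hspan_mono as)
    then show ?case unfolding fac_app by (intro assms(4)) simp
  next
    case (hspan_diff x y)
    then show ?case by (simp add: app_simps lookup_minus right_diff_distrib sum_subtractf)
  qed
  moreover have "prod_list (map nc.e (rev as)) \<in> nc.hspan" using assms(5) by (intro nc.hspan_prod_e) simp
  ultimately have "eco w as = (\<Sum>l\<in>I. b l * eco (W l) as)" unfolding eco_def by blast
  then show ?thesis using fac_star assms(2,3) by simp
qed

subsection \<open>Triangular expansions\<close>

lemma take_sums_eq:
  fixes l m :: "nat list"
  assumes "\<And>k. sum_list (take k l) = sum_list (take k m)" "\<forall>x\<in>set l. 1 \<le> x" "\<forall>x\<in>set m. 1 \<le> x"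
  shows "l = m"
  using assms
proof (induction l arbitrary: m)
  case Nil
  then show ?case using Nil(1)[of 1] by (cases m) auto
next
  case (Cons x l)
  obtain y m' where m: "m = y # m'" using Cons.prems(1)[of 1] Cons.prems(2) by (cases m) auto
  have xy: "x = y" using Cons.prems(1)[of 1] m by simp
  have "sum_list (take k l) = sum_list (take k m')" for k using Cons.prems(1)[of "Suc k"] m xy by simp
  then have "l = m'" using Cons.prems m by (intro Cons.IH) auto
  then show ?case using m xy by simp
qed

lemma dominated_refl: "dominated l l" by (simp add: dominated_def)

lemma dominated_trans: "dominated k l \<Longrightarrow> dominated l m \<Longrightarrow> dominated k m"
  unfolding dominated_def using order_trans by metis

lemma dominated_antisym:
  assumes "l \<in> Par n" "m \<in> Par n" "dominated l m" "dominated m l"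
  shows "l = m"
proof (rule take_sums_eq)
  show "sum_list (take k l) = sum_list (take k m)" for k
    using assms(3,4) unfolding dominated_def by (meson order_antisym)
qed (use assms(1,2) in \<open>auto simp: Par_def\<close>)

lemma maximal_partition:
  assumes "finite U" "U \<noteq> {}" "U \<subseteq> Par n"
  shows "\<exists>m\<in>U. \<forall>l\<in>U. dominated m l \<longrightarrow> l = m"
proof -
  have "\<exists>m\<in>U. \<forall>l\<in>U. l \<noteq> m \<longrightarrow> \<not> (dominated m l \<and> m \<noteq> l)"
  proof (rule Finite_Set.bex_max_element[OF assms(1) _ _ assms(2)])
    show "asymp_on U (\<lambda>m l. dominated m l \<and> m \<noteq> l)"
      using dominated_antisym assms(3) by (intro asymp_onI) blast
    show "transp_on U (\<lambda>m l. dominated m l \<and> m \<noteq> l)"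
    proof (rule transp_onI)
      fix x y z assume u: "x \<in> U" "y \<in> U" "z \<in> U" and d: "dominated x y \<and> x \<noteq> y" "dominated y z \<and> y \<noteq> z"
      have "x \<noteq> z"
      proof
        assume "x = z"
        then have "x = y" using d u assms(3) dominated_antisym[of x y] by auto
        then show False using d by simp
      qed
      then show "dominated x z \<and> x \<noteq> z" using d dominated_trans by blast
    qed
  qed
  then show ?thesis by blast
qed

section \<open>Unitriangularity and existence of expansions\<close>

lemma gof_AP: "l \<in> Par n \<Longrightarrow> gof l \<in> AP"
  using gof(1) grassmannian_iff by blast

lemma fac_gof_dominated: "l \<in> Par n \<Longrightarrow> fac (gof l) m \<noteq> 0 \<Longrightarrow> dominated m l"
  using fac_dominated[OF gof_AP] gof(2) by metis

lemma fac_shape: "w \<in> AP \<Longrightarrow> fac w (shape n w) = 1"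
  using fac_rev_shape fac_mset[of "rev (shape n w)" "shape n w" w] by simp

lemma fac_gof_self: "l \<in> Par n \<Longrightarrow> fac (gof l) l = 1"
  using fac_shape[OF gof_AP] gof(2) by metis

text \<open>Choose \<open>m\<close> maximal in dominance among the members of the support above
  \<open>l\<close>. By triangularity no other term contributes at \<open>m\<close>, so the value
  there is \<open>a m\<close>.\<close>

lemma expansion_support:
  fixes a :: "nat list \<Rightarrow> complex"
  assumes fin: "finite {l. a l \<noteq> 0}" and par: "{l. a l \<noteq> 0} \<subseteq> Par n" and "a l \<noteq> 0"
  shows "\<exists>m\<in>Par n. dominated l m \<and> (\<Sum>k | a k \<noteq> 0. a k * fac (gof k) m) \<noteq> 0"
proof -
  let ?U = "{k. a k \<noteq> 0 \<and> dominated l k}"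
  have "finite ?U" using fin by (rule rev_finite_subset) blast
  moreover have "?U \<noteq> {}" using assms(3) dominated_refl by blast
  moreover have "?U \<subseteq> Par n" using par by blast
  ultimately have "\<exists>m\<in>?U. \<forall>k\<in>?U. dominated m k \<longrightarrow> k = m" by (rule maximal_partition)
  then obtain m where m: "m \<in> ?U" and max: "\<forall>k\<in>?U. dominated m k \<longrightarrow> k = m" by (rule bexE)
  have mP: "m \<in> Par n" using m par by blast
  have "(\<Sum>k | a k \<noteq> 0. a k * fac (gof k) m) = (\<Sum>k | a k \<noteq> 0. if k = m then a m else 0)"
  proof (intro sum.cong refl)
    fix k assume k: "k \<in> {k. a k \<noteq> 0}"
    show "a k * fac (gof k) m = (if k = m then a m else 0)"
    proof (cases "k = m")
      case True
      then show ?thesis using fac_gof_self[OF mP] by simp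
    next
      case False
      have "fac (gof k) m = 0"
      proof (rule ccontr)
        assume "fac (gof k) m \<noteq> 0"
        then have "dominated m k" using fac_gof_dominated k par by blast
        moreover have "k \<in> ?U" using k m dominated_trans[OF _ calculation, of l] by simp
        ultimately show False using max[rule_format, of k] False by simp
      qed
      then show ?thesis using False by simp
    qed
  qed
  also have "\<dots> = a m" using fin m by (subst sum.delta) auto
  finally show ?thesis using m mP by auto
qed

text \<open>Subtracting the multiple of a dominance-maximal term \<open>k\<close> makes the
  remainder vanish at \<open>k\<close>, and \<open>D\<close> without \<open>k\<close> is still
  closed under smaller partitions.\<close>

lemma expansion_exists:
  fixes f :: "nat list \<Rightarrow> complex"
  assumes "finite D" "D \<subseteq> Par n"
    and "\<And>l m. l \<in> D \<Longrightarrow> m \<in> Par n \<Longrightarrow> dominated m l \<Longrightarrow> m \<in> D"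
    and "\<And>m. m \<in> Par n \<Longrightarrow> f m \<noteq> 0 \<Longrightarrow> m \<in> D"
  shows "\<exists>a. {l. a l \<noteq> 0} \<subseteq> D \<and> (\<forall>m\<in>Par n. f m = (\<Sum>l\<in>D. a l * fac (gof l) m))"
  using assms
proof (induction "card D" arbitrary: D f)
  case 0
  then have "D = {}" by simp
  then show ?case using 0 by (intro exI[of _ "\<lambda>_. 0"]) auto
next
  case (Suc c)
  have "D \<noteq> {}" using Suc.hyps(2) by auto
  then have "\<exists>m\<in>D. \<forall>l\<in>D. dominated m l \<longrightarrow> l = m"
    by (rule maximal_partition[OF Suc.prems(1) _ Suc.prems(2)])
  then obtain k where k: "k \<in> D" and max: "\<And>l. l \<in> D \<Longrightarrow> dominated k l \<Longrightarrow> l = k" by blast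
  have kP: "k \<in> Par n" using k Suc.prems(2) by blast
  define f' where "f' m = f m - f k * fac (gof k) m" for m
  have "\<exists>a. {l. a l \<noteq> 0} \<subseteq> D - {k} \<and> (\<forall>m\<in>Par n. f' m = (\<Sum>l\<in>D - {k}. a l * fac (gof l) m))"
  proof (rule Suc.hyps(1))
    show "c = card (D - {k})" using Suc.hyps(2) k Suc.prems(1) by simp
    show "finite (D - {k})" "D - {k} \<subseteq> Par n" using Suc.prems(1,2) by auto
    show "m \<in> D - {k}" if "l \<in> D - {k}" "m \<in> Par n" "dominated m l" for l m
      using that Suc.prems(3)[of l m] max[of l] by auto
    show "m \<in> D - {k}" if m: "m \<in> Par n" "f' m \<noteq> 0" for m
    proof -
      have "m \<noteq> k" using m(2) fac_gof_self[OF kP] by (auto simp: f'_def)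
      moreover have "m \<in> D"
      proof (cases "f m = 0")
        case True
        then have "fac (gof k) m \<noteq> 0" using m(2) by (auto simp: f'_def)
        then show ?thesis using Suc.prems(3)[OF k m(1)] fac_gof_dominated[OF kP] by blast
      qed (use Suc.prems(4) m in blast)
      ultimately show ?thesis by blast
    qed
  qed
  then obtain a where a: "{l. a l \<noteq> 0} \<subseteq> D - {k}"
    and f': "\<And>m. m \<in> Par n \<Longrightarrow> f' m = (\<Sum>l\<in>D - {k}. a l * fac (gof l) m)" by blast
  have "f m = (\<Sum>l\<in>D. (a(k := f k)) l * fac (gof l) m)" if "m \<in> Par n" for m
  proof -
    have "(\<Sum>l\<in>D - {k}. (a(k := f k)) l * fac (gof l) m) = (\<Sum>l\<in>D - {k}. a l * fac (gof l) m)"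
      by (intro sum.cong refl) auto
    then show ?thesis
      using f'[OF that] by (subst sum.remove[OF Suc.prems(1) k]) (simp add: f'_def diff_eq_eq add.commute)
  qed
  moreover have "{l. (a(k := f k)) l \<noteq> 0} \<subseteq> D" using a k by auto
  ultimately show ?case by blast
qed

text \<open>The expansion tested at partitions only; by symmetry these coefficients determine all
  others.\<close>

definition is_expansion :: "(int \<Rightarrow> int) \<Rightarrow> (nat list \<Rightarrow> complex) \<Rightarrow> bool" where
  "is_expansion w a \<longleftrightarrow> finite {l. a l \<noteq> 0} \<and> {l. a l \<noteq> 0} \<subseteq> Par n \<and>
     (\<forall>m\<in>Par n. fac w m = (\<Sum>l | a l \<noteq> 0. a l * fac (gof l) m))"

lemma is_expansion_unique:
  assumes "is_expansion w a" "is_expansion w b"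
  shows "a = b"
proof (rule ccontr)
  assume "a \<noteq> b"
  define d where "d l = a l - b l" for l
  let ?I = "{l. a l \<noteq> 0} \<union> {l. b l \<noteq> 0}"
  have I: "finite ?I" "?I \<subseteq> Par n" using assms by (auto simp: is_expansion_def)
  have sub: "{l. d l \<noteq> 0} \<subseteq> ?I" by (auto simp: d_def)
  obtain l where "d l \<noteq> 0" using \<open>a \<noteq> b\<close> by (auto simp: d_def fun_eq_iff)
  then obtain m where m: "m \<in> Par n" "(\<Sum>k | d k \<noteq> 0. d k * fac (gof k) m) \<noteq> 0"
    using expansion_support[of d l] finite_subset[OF sub I(1)] subset_trans[OF sub I(2)] by blast
  have ext: "(\<Sum>k | c k \<noteq> 0. c k * fac (gof k) m) = (\<Sum>k\<in>?I. c k * fac (gof k) m)" if "{k. c k \<noteq> 0} \<subseteq> ?I" for c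
    using I(1) that by (intro sum.mono_neutral_left) auto
  have "(\<Sum>k\<in>?I. d k * fac (gof k) m) = (\<Sum>k\<in>?I. a k * fac (gof k) m) - (\<Sum>k\<in>?I. b k * fac (gof k) m)"
    by (simp add: d_def left_diff_distrib sum_subtractf)
  also have "\<dots> = 0"
    using assms m(1) ext[of a] ext[of b] unfolding is_expansion_def by auto
  finally show False using m(2) ext[OF sub] by simp
qed

lemma is_expansion_exists:
  assumes "w \<in> AP"
  shows "\<exists>a. is_expansion w a"
proof -
  \<comment> \<open>Expansions are homogeneous of degree \<open>len w\<close>, which makes this set
    finite, and dominance preserves the size.\<close>
  let ?D = "{l \<in> Par n. sum_list l = len w}"
  have "length l \<le> sum_list l" if "\<forall>x\<in>set l. 1 \<le> x" for l :: "nat list"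
    using that by (induction l) auto
  then have "?D \<subseteq> {l. set l \<subseteq> {..n} \<and> length l \<le> len w}" unfolding Par_def by force
  then have fin: "finite ?D" by (rule finite_subset) (rule finite_lists_length_le, simp)
  have "\<exists>a. {l. a l \<noteq> 0} \<subseteq> ?D \<and> (\<forall>m\<in>Par n. fac w m = (\<Sum>l\<in>?D. a l * fac (gof l) m))"
  proof (rule expansion_exists[OF fin])
    show "m \<in> ?D" if "l \<in> ?D" "m \<in> Par n" "dominated m l" for l m
      using that by (simp add: dominated_def)
    show "m \<in> ?D" if "m \<in> Par n" "fac w m \<noteq> 0" for m
      using that fac_nonzero[OF assms] by simp
  qed blast
  then obtain a where a: "{l. a l \<noteq> 0} \<subseteq> ?D" "\<And>m. m \<in> Par n \<Longrightarrow> fac w m = (\<Sum>l\<in>?D. a l * fac (gof l) m)" by blast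
  have "(\<Sum>l\<in>?D. a l * fac (gof l) m) = (\<Sum>l | a l \<noteq> 0. a l * fac (gof l) m)" for m
    using fin a(1) by (intro sum.mono_neutral_right) auto
  then have "is_expansion w a"
    unfolding is_expansion_def using a finite_subset[OF a(1) fin] by auto
  then show ?thesis by blast
qed

section \<open>Return to the series and their coefficients\<close>

lemma fac_partition:
  assumes "set as \<subseteq> {..<n}"
  obtains m where "m \<in> Par n" "\<And>w. fac w as = fac w m"
proof -
  let ?m = "rev (sort (filter (\<lambda>x. 0 < x) as))"
  have "sorted_wrt (\<ge>) ?m" unfolding sorted_wrt_rev using sorted_sort[of "filter (\<lambda>x. 0 < x) as"] by simp
  then have "?m \<in> Par n" using assms unfolding Par_def by fastforce
  moreover have "fac w as = fac w ?m" for w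
    using fac_mset[of ?m "filter (\<lambda>x. 0 < x) as" w] fac_filter[of w as] by simp
  ultimately show ?thesis using that by blast
qed

lemma affine_stanley_eq:
  "affine_stanley n w \<alpha> = (if \<forall>i. lkp \<alpha> i \<le> n - 1
     then fac w (map (lkp \<alpha>) [0..<Poly_Mapping.degree \<alpha>]) else 0)"
  unfolding affine_stanley_def fac_def ..

lemma affine_stanley_nth:
  assumes "l \<in> Par n"
  shows "affine_stanley n w (Poly_Mapping.nth l) = fac w l"
proof -
  let ?a = "Poly_Mapping.nth l"
  have pos: "\<forall>x\<in>set l. 0 < x" and le: "\<forall>x\<in>set l. x \<le> n - 1" using assms by (auto simp: Par_def)
  have lk: "lkp ?a i = (if i < length l then l ! i else 0)" for i
    by (simp add: nth_default_def)
  have "i < Poly_Mapping.degree ?a" if "i < length l" for i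
  proof (rule Poly_Mapping.in_keys_less_degree)
    have "lkp ?a i \<noteq> 0" using that pos unfolding lk by (simp add: all_set_conv_all_nth)
    then show "i \<in> Poly_Mapping.keys ?a" by (simp only: Poly_Mapping.in_keys_iff not_False_eq_True)
  qed
  then have d: "length l \<le> Poly_Mapping.degree ?a" by (meson not_le less_irrefl)
  have "[0..<Poly_Mapping.degree ?a] = [0..<length l] @ [length l..<Poly_Mapping.degree ?a]"
    using upt_add_eq_append[of 0 "length l" "Poly_Mapping.degree ?a - length l"] d by simp
  then have "map (lkp ?a) [0..<Poly_Mapping.degree ?a] =
     map (lkp ?a) [0..<length l] @ map (lkp ?a) [length l..<Poly_Mapping.degree ?a]" by (simp only: map_append)
  also have "map (lkp ?a) [0..<length l] = l" by (rule nth_equalityI) (simp_all add: nth_default_def)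
  finally have m: "map (lkp ?a) [0..<Poly_Mapping.degree ?a] = l @ map (lkp ?a) [length l..<Poly_Mapping.degree ?a]" .
  have "filter (\<lambda>x. 0 < x) (map (lkp ?a) [length l..<Poly_Mapping.degree ?a]) = []"
    unfolding filter_empty_conv by (auto simp: nth_default_def)
  moreover have "filter (\<lambda>x. 0 < x) l = l" using pos by simp
  ultimately have "filter (\<lambda>x. 0 < x) (map (lkp ?a) [0..<Poly_Mapping.degree ?a]) = l"
    unfolding m filter_append by simp
  then have "fac w (map (lkp ?a) [0..<Poly_Mapping.degree ?a]) = fac w l" using fac_filter by metis
  moreover have "\<forall>i. lkp ?a i \<le> n - 1" using le unfolding lk by simp
  ultimately show ?thesis unfolding affine_stanley_eq by simp
qed

lemma affine_stanley_partition:
  obtains "\<And>w. affine_stanley n w \<alpha> = 0"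
  | m where "m \<in> Par n" "\<And>w. affine_stanley n w \<alpha> = fac w m"
proof (cases "\<forall>i. lkp \<alpha> i \<le> n - 1")
  case True
  have "lkp \<alpha> i < n" for i using True[rule_format, of i] n3 by linarith
  then have "set (map (lkp \<alpha>) [0..<Poly_Mapping.degree \<alpha>]) \<subseteq> {..<n}" by auto
  then show ?thesis using fac_partition True that(2) unfolding affine_stanley_eq by metis
next
  case False
  then show ?thesis using that(1) unfolding affine_stanley_eq by metis
qed

text \<open>Every coefficient of the series is 0 for all elements or equals one at a partition, so
  the description that defines \<open>schur_coeff\<close> singles out exactly the expansions in the
  sense of \<open>is_expansion\<close>.\<close>

lemma schur_coeff_expansion:
  assumes "w \<in> AP"
  shows "is_expansion w (schur_coeff n w)"
proof -
  let ?Q = "\<lambda>a. finite {l. a l \<noteq> 0} \<and> {l. a l \<noteq> 0} \<subseteq> Par n \<and>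
     (\<forall>\<alpha>. affine_stanley n w \<alpha> = (\<Sum>l | a l \<noteq> 0. a l * affine_schur n l \<alpha>))"
  have eq: "?Q a \<longleftrightarrow> is_expansion w a" for a
  proof
    assume Q: "?Q a"
    have "fac w m = (\<Sum>l | a l \<noteq> 0. a l * fac (gof l) m)" if "m \<in> Par n" for m
    proof -
      have "affine_stanley n w (Poly_Mapping.nth m) = (\<Sum>l | a l \<noteq> 0. a l * affine_schur n l (Poly_Mapping.nth m))"
        using Q by blast
      then show ?thesis unfolding affine_schur_def affine_stanley_nth[OF that] .
    qed
    then show "is_expansion w a" using Q unfolding is_expansion_def by blast
  next
    assume E: "is_expansion w a"
    have "affine_stanley n w \<alpha> = (\<Sum>l | a l \<noteq> 0. a l * affine_schur n l \<alpha>)" for \<alpha>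
    proof (rule affine_stanley_partition[of \<alpha>])
      assume "\<And>w. affine_stanley n w \<alpha> = 0"
      then show ?thesis by (simp add: affine_schur_def)
    next
      fix m assume "m \<in> Par n" "\<And>w. affine_stanley n w \<alpha> = fac w m"
      then show ?thesis using E by (simp add: affine_schur_def is_expansion_def)
    qed
    then show "?Q a" using E unfolding is_expansion_def by blast
  qed
  obtain a where a: "is_expansion w a" using is_expansion_exists[OF assms] by blast
  have "schur_coeff n w = a"
    unfolding schur_coeff_def eq using a is_expansion_unique[OF _ a] by (rule the_equality)
  then show ?thesis using a by simp
qed

lemma schur_coeff_upper:
  assumes "w \<in> AP" "schur_coeff n w l \<noteq> 0"
  shows "dominated l (shape n w)"
proof -
  note E = schur_coeff_expansion[OF assms(1), unfolded is_expansion_def]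
  obtain m where "m \<in> Par n" "dominated l m" "fac w m \<noteq> 0"
    using expansion_support[of "schur_coeff n w" l] E assms(2) by auto
  then show ?thesis using fac_dominated[OF assms(1)] dominated_trans by blast
qed

text \<open>Evaluate the expansion at \<open>shape n w\<close>. A further contributing partition
  would dominate the shape by triangularity and be dominated by it through the upper bound, so only
  one term is left.\<close>

lemma schur_coeff_shape:
  assumes "w \<in> AP"
  shows "schur_coeff n w (shape n w) = 1"
proof -
  let ?a = "schur_coeff n w" and ?s = "shape n w"
  note E = schur_coeff_expansion[OF assms, unfolded is_expansion_def]
  note sP = shape_Par[OF assms]
  have "1 = (\<Sum>l | ?a l \<noteq> 0. ?a l * fac (gof l) ?s)"
    using E sP fac_shape[OF assms] by metis
  also have "\<dots> = (\<Sum>l | ?a l \<noteq> 0. if l = ?s then ?a ?s else 0)"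
  proof (intro sum.cong refl)
    fix l assume l: "l \<in> {l. ?a l \<noteq> 0}"
    then have lP: "l \<in> Par n" using E by blast
    show "?a l * fac (gof l) ?s = (if l = ?s then ?a ?s else 0)"
    proof (cases "l = ?s")
      case True
      then show ?thesis using fac_gof_self[OF sP] by simp
    next
      case False
      have "fac (gof l) ?s = 0"
      proof (rule ccontr)
        assume "fac (gof l) ?s \<noteq> 0"
        then have "dominated ?s l" by (rule fac_gof_dominated[OF lP])
        moreover have "dominated l ?s" using schur_coeff_upper[OF assms] l by blast
        ultimately show False using dominated_antisym[OF lP sP] False by blast
      qed
      then show ?thesis using False by simp
    qed
  qed
  also have "\<dots> = ?a ?s" using E by (subst sum.delta) auto
  finally show ?thesis by simp
qed

text \<open>By \<open>fac_inv_star\<close> the inverse and the starred element have the same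
  coefficients. Starring the expansion of \<open>w\<close> permutes the affine Schur functions by
  \<open>par_star\<close>, and uniqueness of expansions identifies the coefficients.\<close>

lemma schur_coeff_inv:
  assumes "w \<in> AP" "l \<in> Par n"
  shows "schur_coeff n (iv w) (par_star n l) = schur_coeff n w l"
proof -
  define a where "a = schur_coeff n w"
  have E: "finite {l. a l \<noteq> 0}" "{l. a l \<noteq> 0} \<subseteq> Par n"
    "\<And>m. m \<in> Par n \<Longrightarrow> fac w m = (\<Sum>l | a l \<noteq> 0. a l * fac (gof l) m)"
    using schur_coeff_expansion[OF assms(1)] unfolding is_expansion_def a_def by auto
  define b where "b m = (if m \<in> Par n then a (par_star n m) else 0)" for m
  have supp: "{l. b l \<noteq> 0} = par_star n ` {l. a l \<noteq> 0}"
  proof (intro equalityI subsetI)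
    fix l assume "l \<in> {l. b l \<noteq> 0}"
    then have "l \<in> Par n" "a (par_star n l) \<noteq> 0" by (auto simp: b_def split: if_splits)
    then show "l \<in> par_star n ` {l. a l \<noteq> 0}" using par_star(3)[of l] by (intro rev_image_eqI[of "par_star n l"]) auto
  next
    fix l assume "l \<in> par_star n ` {l. a l \<noteq> 0}"
    then obtain k where "a k \<noteq> 0" "l = par_star n k" by blast
    then show "l \<in> {l. b l \<noteq> 0}" using E(2) par_star(1,3)[of k] by (auto simp: b_def)
  qed
  have inj: "inj_on (par_star n) {l. a l \<noteq> 0}"
  proof (rule inj_on_inverseI[of _ "par_star n"])
    fix l assume "l \<in> {l. a l \<noteq> 0}"
    then show "par_star n (par_star n l) = l" by (intro par_star(3) subsetD[OF E(2)])
  qed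
  have rel: "fac w as = (\<Sum>l | a l \<noteq> 0. a l * fac (gof l) as)" if as: "set as \<subseteq> {..<n}" for as
    by (rule fac_partition[OF as]) (simp add: E(3))
  have "is_expansion (iv w) b"
    unfolding is_expansion_def
  proof (intro conjI ballI)
    show "finite {l. b l \<noteq> 0}" unfolding supp using E(1) by simp
    show "{l. b l \<noteq> 0} \<subseteq> Par n" by (auto simp: b_def)
    fix m assume "m \<in> Par n"
    then have "set m \<subseteq> {..<n}" using n3 by (auto simp: Par_def)
    have "fac (iv w) m = (\<Sum>l | a l \<noteq> 0. a l * fac (star (gof l)) m)"
      unfolding fac_inv_star[OF assms(1)]
      using E(2) gof_AP by (intro relation_star[OF E(1) assms(1) _ rel \<open>set m \<subseteq> {..<n}\<close>]) auto
    also have "\<dots> = (\<Sum>l | a l \<noteq> 0. b (par_star n l) * fac (gof (par_star n l)) m)"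
    proof (intro sum.cong refl)
      fix l assume "l \<in> {l. a l \<noteq> 0}"
      then have "l \<in> Par n" using E(2) by blast
      from par_star[OF this] show "a l * fac (star (gof l)) m = b (par_star n l) * fac (gof (par_star n l)) m"
        by (simp add: b_def)
    qed
    also have "\<dots> = (\<Sum>l | b l \<noteq> 0. b l * fac (gof l) m)"
      unfolding supp by (simp add: sum.reindex[OF inj])
    finally show "fac (iv w) m = (\<Sum>l | b l \<noteq> 0. b l * fac (gof l) m)" .
  qed
  then have "schur_coeff n (iv w) = b"
    using schur_coeff_expansion[OF AP_inv[OF assms(1)]] is_expansion_unique by blast
  then show ?thesis using par_star(1,3)[OF assms(2)] by (simp add: b_def a_def)
qed

lemma schur_coeff_bounds:
  assumes "w \<in> AP"
  shows "(\<forall>l\<in>Par n. schur_coeff n w l \<noteq> 0 \<longrightarrow>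
            star_dominated n (lower_shape n w) l \<and> dominated l (shape n w)) \<and>
         schur_coeff n w (shape n w) = 1 \<and>
         schur_coeff n w (lower_shape n w) = 1"
proof -
  note iw = AP_inv[OF assms]
  have low: "lower_shape n w = par_star n (shape n (iv w))"
    unfolding lower_shape_def group_inv[OF assms] ..
  note sP = shape_Par[OF iw]
  have ps: "par_star n (lower_shape n w) = shape n (iv w)" "lower_shape n w \<in> Par n"
    unfolding low by (rule par_star(3)[OF sP], rule par_star(1)[OF sP])
  have "star_dominated n (lower_shape n w) l \<and> dominated l (shape n w)"
    if l: "l \<in> Par n" "schur_coeff n w l \<noteq> 0" for l
  proof
    have "schur_coeff n (iv w) (par_star n l) \<noteq> 0" using schur_coeff_inv[OF assms l(1)] l(2) by simp
    then have "dominated (par_star n l) (shape n (iv w))" by (rule schur_coeff_upper[OF iw])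
    then show "star_dominated n (lower_shape n w) l" unfolding star_dominated_def ps(1) .
    show "dominated l (shape n w)" by (rule schur_coeff_upper[OF assms l(2)])
  qed
  moreover have "schur_coeff n w (lower_shape n w) = 1"
    using schur_coeff_inv[OF assms ps(2)] schur_coeff_shape[OF iw] unfolding ps(1) by simp
  ultimately show ?thesis using schur_coeff_shape[OF assms] by blast
qed

end

theorem theorem10p3:
  fixes n :: nat and w :: "int \<Rightarrow> int"
  assumes "n \<ge> 3" and "w \<in> affine_perms n"
  shows "(\<forall>l\<in>Par n. schur_coeff n w l \<noteq> 0 \<longrightarrow>
            star_dominated n (lower_shape n w) l \<and> dominated l (shape n w)) \<and>
         schur_coeff n w (shape n w) = 1 \<and>
         schur_coeff n w (lower_shape n w) = 1"
proof -
  interpret affine n by (rule affine.intro) (rule assms(1))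
  show ?thesis by (rule schur_coeff_bounds[OF assms(2)])
qed

end
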